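(* Let $K$ be any field, let $E$ be a finite graph, let $v\in E^0$ be a regular vertex which is not the base of a loop, and let $G$ be the "collapse at $v$" graph of $E$. Then $L_K(E)$ is Morita equivalent to $L_K(G)$.
   Context: A (directed) graph $E=(E^0,E^1,s,r)$ consists of disjoint sets $E^0$ (vertices) and $E^1$ (edges) and maps $s,r:E^1\to E^0$ (source and range). It is finite if $E^0$ and $E^1$ are finite; the vertex set is nonempty. A vertex $v$ is a sink if $s^{-1}(v)=\emptyset$; in a finite graph, a vertex is regular if it is not a sink. A loop based at $v$ is an edge $e$ with $s(e)=r(e)=v$. The Leavitt path algebra $L_K(E)$ is the $K$-algebra generated by $E^0\cup E^1\cup\{e^*\mid e\in E^1\}$ subject to, for all $v,w\in E^0$ and $e,f\in E^1$: (1) $vw=\delta_{v,w}w$; (2) $s(e)e=e=er(e)$ and $r(e)e^*=e^*=e^*s(e)$; (3) $e^*f=\delta_{e,f}r(e)$; (4) $v=\sum_{e\in s^{-1}(v)}ee^*$ for every regular vertex $v$. For finite $E$ it is unital with identity $\sum_{v\in E^0}v$. Collapse at $v$: let $E$ be a finite graph and $v$ a regular vertex which is not the base of a loop. The "collapse at $v$" graph $G=(G^0,G^1,s_G,r_G)$ is given by $G^0=E^0\setminus\{v\}$ and $G^1=(E^1\setminus(r^{-1}(v)\cup s^{-1}(v)))\cup\{[ef]\mid e\in r^{-1}(v),\ f\in s^{-1}(v)\}$ (the $[ef]$ being new, pairwise distinct edges), where $s_G,r_G$ agree with $s,r$ on the edges of $E$ that remain, and $s_G([ef])=s(e)$, $r_G([ef])=r(f)$.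 (If $v$ is a source, i.e. $r^{-1}(v)=\emptyset$, then $G^1=E^1\setminus s^{-1}(v)$.) Unital rings $R$ and $S$ are Morita equivalent if their categories of left modules are equivalent. *)

theory Defs
  imports
    "Graph_Theory.Digraph"
    "HOL-Algebra.QuotRing"
    "HOL-Algebra.Module"
    "HOL-Library.Poly_Mapping"
    "HOL-Library.FuncSet"
begin

section \<open>Graphs and the collapse at a vertex\<close>

text \<open>
  A graph is a \<^typ>\<open>('v, 'e) pre_digraph\<close> satisfying \<^locale>\<open>wf_digraph\<close>, which permits loops and
  parallel edges; source and range are \<^const>\<open>tail\<close> and \<^const>\<open>head\<close>.
\<close>

definition is_sink :: "('v, 'e) pre_digraph \<Rightarrow> 'v \<Rightarrow> bool" where
  "is_sink E v \<longleftrightarrow> v \<in> verts E \<and> out_arcs E v = {}"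

text \<open>For finite graphs only; in general a regular vertex must also not be an infinite emitter.\<close>

definition regular_vertex :: "('v, 'e) pre_digraph \<Rightarrow> 'v \<Rightarrow> bool" where
  "regular_vertex E v \<longleftrightarrow> v \<in> verts E \<and> \<not> is_sink E v"

definition base_of_loop :: "('v, 'e) pre_digraph \<Rightarrow> 'v \<Rightarrow> bool" where
  "base_of_loop E v \<longleftrightarrow> (\<exists>e \<in> arcs E. tail E e = v \<and> head E e = v)"

datatype 'e collapse_edge = Old 'e | New 'e 'e

definition collapse :: "('v, 'e) pre_digraph \<Rightarrow> 'v \<Rightarrow> ('v, 'e collapse_edge) pre_digraph" where
  "collapse E v = \<lparr>
     verts = verts E - {v},
     arcs = Old ` (arcs E - (in_arcs E v \<union> out_arcs E v))
            \<union> {New e f | e f. e \<in> in_arcs E v \<and> f \<in> out_arcs E v},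
     tail = (\<lambda>x. case x of Old e \<Rightarrow> tail E e | New e f \<Rightarrow> tail E e),
     head = (\<lambda>x. case x of Old e \<Rightarrow> head E e | New e f \<Rightarrow> head E f)\<rparr>"


section \<open>Leavitt path algebras\<close>

text \<open>
  Words over \<open>'x\<close> under concatenation, written additively so that \<open>'x word \<Rightarrow>\<^sub>0 'k\<close>, with the
  convolution product of \<^theory>\<open>HOL-Library.Poly_Mapping\<close>, is the free unital associative
  \<open>'k\<close>-algebra on \<open>'x\<close>.
\<close>

datatype 'x word = Word (letters: "'x list")

instantiation word :: (type) monoid_add
begin

definition zero_word :: "'a word" where
  "0 = Word []"

definition plus_word :: "'a word \<Rightarrow> 'a word \<Rightarrow> 'a word" where
  "u + w = Word (letters u @ letters w)"

instance
  by standard (simp_all add: zero_word_def plus_word_def)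

end

datatype ('v, 'e) gen = Vertex 'v | Edge 'e | Ghost 'e

type_synonym ('k, 'v, 'e) free_elem = "('v, 'e) gen word \<Rightarrow>\<^sub>0 'k"

definition var :: "('v, 'e) gen \<Rightarrow> ('k::field, 'v, 'e) free_elem" where
  "var x = Poly_Mapping.single (Word [x]) 1"

definition gens :: "('v, 'e) pre_digraph \<Rightarrow> ('v, 'e) gen set" where
  "gens E = Vertex ` verts E \<union> Edge ` arcs E \<union> Ghost ` arcs E"

text \<open>
  The presentation is one of algebras that need not be unital, so the free algebra has only nonempty
  words: with the empty word included, and without imposing that the vertices sum to \<open>1\<close>, the
  quotient would be the unitization of the Leavitt path algebra.
\<close>

definition free_carrier :: "('v, 'e) pre_digraph \<Rightarrow> ('k::field, 'v, 'e) free_elem set" where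
  "free_carrier E =
     {p. \<forall>w \<in> Poly_Mapping.keys p. letters w \<noteq> [] \<and> set (letters w) \<subseteq> gens E}"

text \<open>
  The field \<^const>\<open>one\<close> is not an identity (\<open>1\<close> is the empty word, outside the carrier). It is there
  only to fill the record and is replaced in the quotient below.
\<close>

definition free_algebra :: "('v, 'e) pre_digraph \<Rightarrow> ('k::field, 'v, 'e) free_elem ring" where
  "free_algebra E =
     \<lparr>carrier = free_carrier E, mult = (*), one = 1, zero = 0, add = (+)\<rparr>"

text \<open>Each relation \<open>a = b\<close> of the presentation is given by the element \<open>a - b\<close>.\<close>

inductive_set leavitt_relators ::
  "('v, 'e) pre_digraph \<Rightarrow> ('k::field, 'v, 'e) free_elem set"
  for E :: "('v, 'e) pre_digraph"
where
  vertices: "\<lbrakk>v \<in> verts E; w \<in> verts E\<rbrakk> \<Longrightarrow>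
     var (Vertex v) * var (Vertex w) - (if v = w then var (Vertex w) else 0) \<in> leavitt_relators E"
| source_edge: "e \<in> arcs E \<Longrightarrow>
     var (Vertex (tail E e)) * var (Edge e) - var (Edge e) \<in> leavitt_relators E"
| edge_range: "e \<in> arcs E \<Longrightarrow>
     var (Edge e) * var (Vertex (head E e)) - var (Edge e) \<in> leavitt_relators E"
| range_ghost: "e \<in> arcs E \<Longrightarrow>
     var (Vertex (head E e)) * var (Ghost e) - var (Ghost e) \<in> leavitt_relators E"
| ghost_source: "e \<in> arcs E \<Longrightarrow>
     var (Ghost e) * var (Vertex (tail E e)) - var (Ghost e) \<in> leavitt_relators E"
| ghost_edge: "\<lbrakk>e \<in> arcs E; f \<in> arcs E\<rbrakk> \<Longrightarrow>
     var (Ghost e) * var (Edge f) - (if e = f then var (Vertex (head E e)) else 0)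
       \<in> leavitt_relators E"
| regular: "regular_vertex E v \<Longrightarrow>
     var (Vertex v) - (\<Sum>e \<in> out_arcs E v. var (Edge e) * var (Ghost e)) \<in> leavitt_relators E"

text \<open>
  The two-sided algebra ideal of \<^const>\<open>free_algebra\<close> generated by the relators. Multiplication by
  \<open>Poly_Mapping.single 0 c\<close> is scalar multiplication by \<open>c\<close>; \<^const>\<open>genideal\<close> is not applicable,
  as it presupposes an identity.
\<close>

inductive_set leavitt_ideal ::
  "('v, 'e) pre_digraph \<Rightarrow> ('k::field, 'v, 'e) free_elem set"
  for E :: "('v, 'e) pre_digraph"
where
  zero: "0 \<in> leavitt_ideal E"
| relator: "p \<in> leavitt_relators E \<Longrightarrow> p \<in> leavitt_ideal E"
| add: "\<lbrakk>p \<in> leavitt_ideal E; q \<in> leavitt_ideal E\<rbrakk> \<Longrightarrow> p + q \<in> leavitt_ideal E"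
| scale: "p \<in> leavitt_ideal E \<Longrightarrow> Poly_Mapping.single 0 c * p \<in> leavitt_ideal E"
| left: "\<lbrakk>a \<in> free_carrier E; p \<in> leavitt_ideal E\<rbrakk> \<Longrightarrow> a * p \<in> leavitt_ideal E"
| right: "\<lbrakk>a \<in> free_carrier E; p \<in> leavitt_ideal E\<rbrakk> \<Longrightarrow> p * a \<in> leavitt_ideal E"

text \<open>For finite graphs, where the class of the sum of all vertices is the identity.\<close>

definition leavitt_path_algebra ::
  "'k::field itself \<Rightarrow> ('v, 'e) pre_digraph \<Rightarrow> ('k, 'v, 'e) free_elem set ring"
where
  "leavitt_path_algebra K E =
     (free_algebra E Quot leavitt_ideal E)
       \<lparr>one := leavitt_ideal E +>\<^bsub>free_algebra E\<^esub> (\<Sum>v \<in> verts E. var (Vertex v))\<rparr>"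


section \<open>Equivalence of categories\<close>

text \<open>
  Hom-sets for different pairs of objects may overlap, so operations on morphisms take the objects
  as arguments: \<open>Comp C x y z g f\<close> is the composite of \<open>f : x \<rightarrow> y\<close> followed by \<open>g : y \<rightarrow> z\<close>.
\<close>

record ('o, 'm) cat =
  Obj :: "'o set"
  Hom :: "'o \<Rightarrow> 'o \<Rightarrow> 'm set"
  Id :: "'o \<Rightarrow> 'm"
  Comp :: "'o \<Rightarrow> 'o \<Rightarrow> 'o \<Rightarrow> 'm \<Rightarrow> 'm \<Rightarrow> 'm"

definition is_category :: "('o, 'm) cat \<Rightarrow> bool" where
  "is_category C \<longleftrightarrow>
     (\<forall>x \<in> Obj C. Id C x \<in> Hom C x x) \<and>
     (\<forall>x \<in> Obj C. \<forall>y \<in> Obj C. \<forall>z \<in> Obj C. \<forall>f \<in> Hom C x y. \<forall>g \<in> Hom C y z.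
        Comp C x y z g f \<in> Hom C x z) \<and>
     (\<forall>x \<in> Obj C. \<forall>y \<in> Obj C. \<forall>f \<in> Hom C x y.
        Comp C x x y f (Id C x) = f \<and> Comp C x y y (Id C y) f = f) \<and>
     (\<forall>w \<in> Obj C. \<forall>x \<in> Obj C. \<forall>y \<in> Obj C. \<forall>z \<in> Obj C.
        \<forall>f \<in> Hom C w x. \<forall>g \<in> Hom C x y. \<forall>h \<in> Hom C y z.
        Comp C w x z (Comp C x y z h g) f = Comp C w y z h (Comp C w x y g f))"

record ('o, 'm, 'p, 'n) cat_functor =
  fobj :: "'o \<Rightarrow> 'p"
  fmap :: "'o \<Rightarrow> 'o \<Rightarrow> 'm \<Rightarrow> 'n"

definition is_functor ::
  "('o, 'm) cat \<Rightarrow> ('p, 'n) cat \<Rightarrow> ('o, 'm, 'p, 'n) cat_functor \<Rightarrow> bool"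
where
  "is_functor C D F \<longleftrightarrow>
     (\<forall>x \<in> Obj C. fobj F x \<in> Obj D) \<and>
     (\<forall>x \<in> Obj C. \<forall>y \<in> Obj C. \<forall>f \<in> Hom C x y. fmap F x y f \<in> Hom D (fobj F x) (fobj F y)) \<and>
     (\<forall>x \<in> Obj C. fmap F x x (Id C x) = Id D (fobj F x)) \<and>
     (\<forall>x \<in> Obj C. \<forall>y \<in> Obj C. \<forall>z \<in> Obj C. \<forall>f \<in> Hom C x y. \<forall>g \<in> Hom C y z.
        fmap F x z (Comp C x y z g f) =
          Comp D (fobj F x) (fobj F y) (fobj F z) (fmap F y z g) (fmap F x y f))"

definition id_functor :: "('o, 'm, 'o, 'm) cat_functor" where
  "id_functor = \<lparr>fobj = (\<lambda>x. x), fmap = (\<lambda>x y f. f)\<rparr>"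

definition comp_functor ::
  "('p, 'n, 'q, 'l) cat_functor \<Rightarrow> ('o, 'm, 'p, 'n) cat_functor \<Rightarrow> ('o, 'm, 'q, 'l) cat_functor"
where
  "comp_functor G F =
     \<lparr>fobj = (\<lambda>x. fobj G (fobj F x)),
      fmap = (\<lambda>x y f. fmap G (fobj F x) (fobj F y) (fmap F x y f))\<rparr>"

definition is_iso :: "('o, 'm) cat \<Rightarrow> 'o \<Rightarrow> 'o \<Rightarrow> 'm \<Rightarrow> bool" where
  "is_iso C x y f \<longleftrightarrow>
     f \<in> Hom C x y \<and>
     (\<exists>g \<in> Hom C y x. Comp C x y x g f = Id C x \<and> Comp C y x y f g = Id C y)"

definition naturally_isomorphic ::
  "('o, 'm) cat \<Rightarrow> ('p, 'n) cat \<Rightarrow>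
   ('o, 'm, 'p, 'n) cat_functor \<Rightarrow> ('o, 'm, 'p, 'n) cat_functor \<Rightarrow> bool"
where
  "naturally_isomorphic C D F G \<longleftrightarrow>
     (\<exists>\<eta>. (\<forall>x \<in> Obj C. is_iso D (fobj F x) (fobj G x) (\<eta> x)) \<and>
        (\<forall>x \<in> Obj C. \<forall>y \<in> Obj C. \<forall>f \<in> Hom C x y.
           Comp D (fobj F x) (fobj F y) (fobj G y) (\<eta> y) (fmap F x y f) =
           Comp D (fobj F x) (fobj G x) (fobj G y) (fmap G x y f) (\<eta> x)))"

definition equivalent_categories :: "('o, 'm) cat \<Rightarrow> ('p, 'n) cat \<Rightarrow> bool" where
  "equivalent_categories C D \<longleftrightarrow>
     is_category C \<and> is_category D \<and>
     (\<exists>F G. is_functor C D F \<and> is_functor D C G \<and>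
        naturally_isomorphic C C (comp_functor G F) id_functor \<and>
        naturally_isomorphic D D (comp_functor F G) id_functor)"


section \<open>Left modules and Morita equivalence\<close>

text \<open>
  The locale \<^locale>\<open>module\<close> with its commutative ring of scalars replaced by an arbitrary unital
  one. As there, the fields \<^const>\<open>mult\<close> and \<^const>\<open>one\<close> of the module record play no role.
\<close>

locale left_module = R?: ring R + M?: abelian_group M
  for R :: "('a, 'b) ring_scheme" (structure) and M :: "('a, 'm, 'c) module_scheme" (structure) +
  assumes smult_closed:
      "\<lbrakk>a \<in> carrier R; x \<in> carrier M\<rbrakk> \<Longrightarrow> a \<odot>\<^bsub>M\<^esub> x \<in> carrier M"
    and smult_l_distr:
      "\<lbrakk>a \<in> carrier R; b \<in> carrier R; x \<in> carrier M\<rbrakk> \<Longrightarrow>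
       (a \<oplus>\<^bsub>R\<^esub> b) \<odot>\<^bsub>M\<^esub> x = a \<odot>\<^bsub>M\<^esub> x \<oplus>\<^bsub>M\<^esub> b \<odot>\<^bsub>M\<^esub> x"
    and smult_r_distr:
      "\<lbrakk>a \<in> carrier R; x \<in> carrier M; y \<in> carrier M\<rbrakk> \<Longrightarrow>
       a \<odot>\<^bsub>M\<^esub> (x \<oplus>\<^bsub>M\<^esub> y) = a \<odot>\<^bsub>M\<^esub> x \<oplus>\<^bsub>M\<^esub> a \<odot>\<^bsub>M\<^esub> y"
    and smult_assoc:
      "\<lbrakk>a \<in> carrier R; b \<in> carrier R; x \<in> carrier M\<rbrakk> \<Longrightarrow>
       (a \<otimes>\<^bsub>R\<^esub> b) \<odot>\<^bsub>M\<^esub> x = a \<odot>\<^bsub>M\<^esub> (b \<odot>\<^bsub>M\<^esub> x)"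
    and smult_one:
      "x \<in> carrier M \<Longrightarrow> \<one>\<^bsub>R\<^esub> \<odot>\<^bsub>M\<^esub> x = x"

text \<open>Homomorphisms are extensional, so that equality of morphisms is equality on the carrier.\<close>

definition left_module_hom ::
  "'a ring \<Rightarrow> ('a, 'u) module \<Rightarrow> ('a, 'u) module \<Rightarrow> ('u \<Rightarrow> 'u) set"
where
  "left_module_hom R M N =
     {f \<in> carrier M \<rightarrow>\<^sub>E carrier N.
        (\<forall>x \<in> carrier M. \<forall>y \<in> carrier M. f (x \<oplus>\<^bsub>M\<^esub> y) = f x \<oplus>\<^bsub>N\<^esub> f y) \<and>
        (\<forall>a \<in> carrier R. \<forall>x \<in> carrier M. f (a \<odot>\<^bsub>M\<^esub> x) = a \<odot>\<^bsub>N\<^esub> f x)}"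

text \<open>
  HOL has no category of all modules; \<open>left_module_cat TYPE('u) R\<close> consists of the left
  \<open>R\<close>-modules whose carrier is a subset of the type \<open>'u\<close>, which plays the role of the universe.
\<close>

definition left_module_cat ::
  "'u itself \<Rightarrow> 'a ring \<Rightarrow> (('a, 'u) module, 'u \<Rightarrow> 'u) cat"
where
  "left_module_cat U R =
     \<lparr>Obj = {M. left_module R M},
      Hom = left_module_hom R,
      Id = (\<lambda>M. restrict id (carrier M)),
      Comp = (\<lambda>M N P g f. compose (carrier M) g f)\<rparr>"

text \<open>
  Morita equivalence relative to the universe \<open>'u\<close>. A statement about Morita equivalence has to be
  made for all sufficiently large \<open>'u\<close>; for a finite \<open>'u\<close> the notion is not meaningful.
\<close>

definition morita_equivalent :: "'u itself \<Rightarrow> 'a ring \<Rightarrow> 'b ring \<Rightarrow> bool" where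
  "morita_equivalent U R S \<longleftrightarrow>
     ring R \<and> ring S \<and>
     equivalent_categories (left_module_cat U R) (left_module_cat U S)"

end

theory Submission
  imports Defs
begin

text \<open>
  Let \<open>R\<close> be the Leavitt path algebra of \<open>E\<close> and let \<open>e\<close> be the sum of the vertices other than
  \<open>v\<close>. No edge \<open>f\<close> leaving \<open>v\<close> returns to \<open>v\<close>, so \<open>f = f e\<close>, and \<open>v\<close> is the sum of the \<open>f f\<^sup>*\<close>.
  Hence \<open>1 = e e + \<Sum>f f\<^sup>*\<close> lies in \<open>R e R\<close>: the idempotent \<open>e\<close> is full, and \<open>R\<close> is Morita
  equivalent to the corner \<open>e R e\<close>. This corner is the Leavitt path algebra of the collapse: a
  vertex or an old edge goes to itself and the new edge \<open>[ef]\<close> goes to the path \<open>ef\<close>.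

  That the map from the algebra of the collapse to \<open>e R e\<close> is injective is often deduced from a
  uniqueness theorem for gradings. Here the inverse is written down. Put \<open>1 = \<Sum>a\<^sub>i b\<^sub>i\<close> with
  \<open>(a\<^sub>i) = (e, f, \<dots>)\<close> and \<open>(b\<^sub>i) = (e, f\<^sup>*, \<dots>)\<close>. Sending \<open>r\<close> to the matrix with entries
  \<open>b\<^sub>i r a\<^sub>j\<close> is multiplicative with values in matrices over \<open>e R e\<close>, and for a generator \<open>r\<close> each
  entry is visibly the image of a specific element of the algebra of the collapse
  (\<open>gen_matrix\<close>). Taking these elements as definition gives a matrix representation of the free
  algebra that respects the relations of \<open>E\<close> (\<open>corner_matrix_ideal\<close>). Composed with the map from
  the collapse, it is the identity in the corner position (\<open>corner_matrix_corner_subst\<close>), whence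
  injectivity; composed the other way it is \<open>r \<mapsto> b\<^sub>i r a\<^sub>j\<close> (\<open>corner_subst_corner_matrix\<close>), whence
  surjectivity onto \<open>e R e\<close>. All of this is done with representatives in the free algebra, modulo
  the ideals of relations.

  The Morita equivalence is \<open>M \<mapsto> e M\<close>. It is fully faithful because \<open>x = \<Sum>a\<^sub>i (b\<^sub>i x)\<close> recovers
  every \<open>x\<close> from the elements \<open>b\<^sub>i x\<close> of \<open>e M\<close>. It is essentially surjective because for a module
  \<open>N\<close> over the corner the matrices \<open>(b\<^sub>i r a\<^sub>j)\<close> act on \<open>N\<^sup>I\<close>, and the image of the matrix of
  \<open>1\<close> is an \<open>R\<close>-module whose corner is \<open>N\<close>. As \<open>I\<close> is finite and the universe is infinite,
  \<open>N\<^sup>I\<close> embeds into the universe.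
\<close>

section \<open>Fully faithful and essentially surjective functors\<close>

text \<open>
  Choose for each object \<open>d\<close> of \<open>D\<close> a preimage \<open>P d\<close> up to an isomorphism \<open>\<epsilon> d\<close>, conjugate
  morphisms of \<open>D\<close> by these isomorphisms, and lift the result along the bijections of hom-sets.
  Every identity needed in \<open>C\<close> is checked after applying the faithful functor \<open>F\<close>.
\<close>

lemma equivalent_categories_if_fully_faithful:
  assumes C: "is_category C" and D: "is_category D" and F: "is_functor C D F"
    and ff: "\<And>x y. \<lbrakk>x \<in> Obj C; y \<in> Obj C\<rbrakk> \<Longrightarrow>
               bij_betw (fmap F x y) (Hom C x y) (Hom D (fobj F x) (fobj F y))"
    and es: "\<And>d. d \<in> Obj D \<Longrightarrow> \<exists>c \<in> Obj C. \<exists>h. is_iso D (fobj F c) d h"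
  shows "equivalent_categories C D"
proof -
  have C_id: "Id C x \<in> Hom C x x" if "x \<in> Obj C" for x
    using C that by (simp add: is_category_def)
  have C_comp: "Comp C x y z g f \<in> Hom C x z"
    if "x \<in> Obj C" "y \<in> Obj C" "z \<in> Obj C" "f \<in> Hom C x y" "g \<in> Hom C y z" for x y z f g
    using C that by (simp add: is_category_def)
  have D_id: "Id D x \<in> Hom D x x" if "x \<in> Obj D" for x
    using D that by (simp add: is_category_def)
  have D_comp: "Comp D x y z g f \<in> Hom D x z"
    if "x \<in> Obj D" "y \<in> Obj D" "z \<in> Obj D" "f \<in> Hom D x y" "g \<in> Hom D y z" for x y z f g
    using D that by (simp add: is_category_def)
  have D_unit: "Comp D x x y f (Id D x) = f" "Comp D x y y (Id D y) f = f"
    if "x \<in> Obj D" "y \<in> Obj D" "f \<in> Hom D x y" for x y f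
    using D that by (simp_all add: is_category_def)
  have D_assoc: "Comp D w x z (Comp D x y z h g) f = Comp D w y z h (Comp D w x y g f)"
    if "w \<in> Obj D" "x \<in> Obj D" "y \<in> Obj D" "z \<in> Obj D"
      "f \<in> Hom D w x" "g \<in> Hom D x y" "h \<in> Hom D y z" for w x y z f g h
    using D that unfolding is_category_def by blast
  have F_obj: "fobj F x \<in> Obj D" if "x \<in> Obj C" for x
    using F that by (simp add: is_functor_def)
  have F_map: "fmap F x y f \<in> Hom D (fobj F x) (fobj F y)"
    if "x \<in> Obj C" "y \<in> Obj C" "f \<in> Hom C x y" for x y f
    using F that by (simp add: is_functor_def)
  have F_id: "fmap F x x (Id C x) = Id D (fobj F x)" if "x \<in> Obj C" for x
    using F that by (simp add: is_functor_def)
  have F_comp: "fmap F x z (Comp C x y z g f) =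
      Comp D (fobj F x) (fobj F y) (fobj F z) (fmap F y z g) (fmap F x y f)"
    if "x \<in> Obj C" "y \<in> Obj C" "z \<in> Obj C" "f \<in> Hom C x y" "g \<in> Hom C y z" for x y z f g
    using F that by (simp add: is_functor_def)
  define lift where "lift x y = inv_into (Hom C x y) (fmap F x y)" for x y
  have lift_hom: "lift x y h \<in> Hom C x y" and F_lift: "fmap F x y (lift x y h) = h"
    if "x \<in> Obj C" "y \<in> Obj C" "h \<in> Hom D (fobj F x) (fobj F y)" for x y h
    using ff[OF that(1,2)] that(3) unfolding lift_def
    by (auto simp: bij_betw_def inv_into_into f_inv_into_f)
  have F_inj: "f = g" if "x \<in> Obj C" "y \<in> Obj C" "f \<in> Hom C x y" "g \<in> Hom C x y"
    "fmap F x y f = fmap F x y g" for x y f g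
    using ff[OF that(1,2)] that(3-) by (auto simp: bij_betw_def inj_on_def)
  have "\<forall>d. \<exists>c h k. d \<in> Obj D \<longrightarrow> c \<in> Obj C \<and> h \<in> Hom D (fobj F c) d \<and> k \<in> Hom D d (fobj F c)
      \<and> Comp D (fobj F c) d (fobj F c) k h = Id D (fobj F c)
      \<and> Comp D d (fobj F c) d h k = Id D d"
    using es unfolding is_iso_def by meson
  then obtain P \<epsilon> \<delta> where
    "\<And>d. d \<in> Obj D \<Longrightarrow> P d \<in> Obj C \<and> \<epsilon> d \<in> Hom D (fobj F (P d)) d \<and> \<delta> d \<in> Hom D d (fobj F (P d))
      \<and> Comp D (fobj F (P d)) d (fobj F (P d)) (\<delta> d) (\<epsilon> d) = Id D (fobj F (P d))
      \<and> Comp D d (fobj F (P d)) d (\<epsilon> d) (\<delta> d) = Id D d"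
    by metis
  then have P: "\<And>d. d \<in> Obj D \<Longrightarrow> P d \<in> Obj C"
    and \<epsilon>: "\<And>d. d \<in> Obj D \<Longrightarrow> \<epsilon> d \<in> Hom D (fobj F (P d)) d"
    and \<delta>: "\<And>d. d \<in> Obj D \<Longrightarrow> \<delta> d \<in> Hom D d (fobj F (P d))"
    and \<delta>\<epsilon>: "\<And>d. d \<in> Obj D \<Longrightarrow> Comp D (fobj F (P d)) d (fobj F (P d)) (\<delta> d) (\<epsilon> d) = Id D (fobj F (P d))"
    and \<epsilon>\<delta>: "\<And>d. d \<in> Obj D \<Longrightarrow> Comp D d (fobj F (P d)) d (\<epsilon> d) (\<delta> d) = Id D d"
    by blast+
  have FP: "fobj F (P d) \<in> Obj D" if "d \<in> Obj D" for d using F_obj P that by blast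
  \<comment> \<open>The image under \<open>F\<close> of the morphism that the inverse functor assigns to \<open>h\<close>.\<close>
  define conj where "conj d d' h =
      Comp D (fobj F (P d)) d' (fobj F (P d')) (\<delta> d') (Comp D (fobj F (P d)) d d' h (\<epsilon> d))" for d d' h
  have conj_hom: "conj d d' h \<in> Hom D (fobj F (P d)) (fobj F (P d'))"
    if "d \<in> Obj D" "d' \<in> Obj D" "h \<in> Hom D d d'" for d d' h
    unfolding conj_def using that by (intro D_comp FP \<epsilon> \<delta>) auto
  have \<epsilon>_conj: "Comp D (fobj F (P d)) (fobj F (P d')) d' (\<epsilon> d') (conj d d' h)
       = Comp D (fobj F (P d)) d d' h (\<epsilon> d)"
    if "d \<in> Obj D" "d' \<in> Obj D" "h \<in> Hom D d d'" for d d' h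
  proof -
    let ?h = "Comp D (fobj F (P d)) d d' h (\<epsilon> d)"
    have h: "?h \<in> Hom D (fobj F (P d)) d'"
      using that by (auto intro: D_comp FP \<epsilon>)
    then have "Comp D (fobj F (P d)) (fobj F (P d')) d' (\<epsilon> d') (conj d d' h)
        = Comp D (fobj F (P d)) d' d' (Id D d') ?h"
      unfolding conj_def using that
      by (subst D_assoc[symmetric]) (auto intro!: FP \<epsilon> \<delta> simp: \<epsilon>\<delta>)
    with h that show ?thesis by (simp add: D_unit FP)
  qed
  define G where "G = \<lparr>fobj = P, fmap = (\<lambda>d d' h. lift (P d) (P d') (conj d d' h))\<rparr>"
  have G_simps: "fobj G d = P d" "fmap G d d' h = lift (P d) (P d') (conj d d' h)" for d d' h
    by (simp_all add: G_def)
  have G_map: "fmap G d d' h \<in> Hom C (P d) (P d')" and F_G: "fmap F (P d) (P d') (fmap G d d' h) = conj d d' h"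
    if "d \<in> Obj D" "d' \<in> Obj D" "h \<in> Hom D d d'" for d d' h
    unfolding G_simps using that by (auto intro!: lift_hom F_lift P conj_hom)
  \<comment> \<open>Isomorphisms are monic, so identities between conjugates may be tested after composing with \<open>\<epsilon>\<close>.\<close>
  have \<epsilon>_mono: "p = q" if "d \<in> Obj D" "x \<in> Obj D" "p \<in> Hom D x (fobj F (P d))" "q \<in> Hom D x (fobj F (P d))"
      "Comp D x (fobj F (P d)) d (\<epsilon> d) p = Comp D x (fobj F (P d)) d (\<epsilon> d) q" for d x p q
  proof -
    have "r = Comp D x d (fobj F (P d)) (\<delta> d) (Comp D x (fobj F (P d)) d (\<epsilon> d) r)"
      if "r \<in> Hom D x (fobj F (P d))" for r
      using that \<open>d \<in> Obj D\<close> \<open>x \<in> Obj D\<close>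
      by (subst D_assoc[symmetric]) (auto intro!: FP \<epsilon> \<delta> simp: \<delta>\<epsilon> D_unit FP)
    with that show ?thesis by metis
  qed
  have conj_id: "conj d d (Id D d) = Id D (fobj F (P d))" if "d \<in> Obj D" for d
    using that by (simp add: conj_def D_unit \<epsilon> FP \<delta>\<epsilon>)
  have conj_comp: "conj d d'' (Comp D d d' d'' h' h) =
      Comp D (fobj F (P d)) (fobj F (P d')) (fobj F (P d'')) (conj d' d'' h') (conj d d' h)"
    if d: "d \<in> Obj D" "d' \<in> Obj D" "d'' \<in> Obj D" and h: "h \<in> Hom D d d'" "h' \<in> Hom D d' d''" for d d' d'' h h'
  proof (rule \<epsilon>_mono[where d = d'' and x = "fobj F (P d)"])
    show "Comp D (fobj F (P d)) (fobj F (P d'')) d'' (\<epsilon> d'') (conj d d'' (Comp D d d' d'' h' h)) =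
      Comp D (fobj F (P d)) (fobj F (P d'')) d'' (\<epsilon> d'')
       (Comp D (fobj F (P d)) (fobj F (P d')) (fobj F (P d'')) (conj d' d'' h') (conj d d' h))"
    proof -
      let ?a = "fobj F (P d)" and ?b = "fobj F (P d')" and ?c = "fobj F (P d'')"
      have "Comp D ?a ?c d'' (\<epsilon> d'') (Comp D ?a ?b ?c (conj d' d'' h') (conj d d' h))
          = Comp D ?a ?b d'' (Comp D ?b ?c d'' (\<epsilon> d'') (conj d' d'' h')) (conj d d' h)"
        using d h by (subst D_assoc) (auto intro!: FP conj_hom \<epsilon>)
      also have "\<dots> = Comp D ?a ?b d'' (Comp D ?b d' d'' h' (\<epsilon> d')) (conj d d' h)"
        using d h by (simp add: \<epsilon>_conj)
      also have "\<dots> = Comp D ?a d' d'' h' (Comp D ?a ?b d' (\<epsilon> d') (conj d d' h))"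
        using d h by (subst D_assoc) (auto intro!: FP conj_hom \<epsilon>)
      also have "\<dots> = Comp D ?a d' d'' h' (Comp D ?a d d' h (\<epsilon> d))"
        using d h by (simp add: \<epsilon>_conj)
      also have "\<dots> = Comp D ?a d d'' (Comp D d d' d'' h' h) (\<epsilon> d)"
        using d h by (subst D_assoc) (auto intro!: FP \<epsilon>)
      also have "\<dots> = Comp D ?a ?c d'' (\<epsilon> d'') (conj d d'' (Comp D d d' d'' h' h))"
        using d h by (simp add: \<epsilon>_conj D_comp)
      finally show ?thesis ..
    qed
  qed (use that in \<open>auto intro!: FP D_comp conj_hom\<close>)
  have G: "is_functor D C G"
    unfolding is_functor_def
  proof (intro conjI ballI)
    fix d assume d: "d \<in> Obj D"
    show "fobj G d \<in> Obj C" using d P by (simp add: G_simps)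
    show "fmap G d d (Id D d) = Id C (fobj G d)"
      using d by (intro F_inj[where x = "P d" and y = "P d"])
        (auto simp: F_G conj_id F_id P G_simps(1) D_id C_id intro!: G_map)
  next
    fix d d' h assume "d \<in> Obj D" "d' \<in> Obj D" "h \<in> Hom D d d'"
    then show "fmap G d d' h \<in> Hom C (fobj G d) (fobj G d')"
      using G_map by (simp add: G_simps(1))
  next
    fix d d' d'' h h'
    assume "d \<in> Obj D" "d' \<in> Obj D" "d'' \<in> Obj D" "h \<in> Hom D d d'" "h' \<in> Hom D d' d''"
    then show "fmap G d d'' (Comp D d d' d'' h' h) =
       Comp C (fobj G d) (fobj G d') (fobj G d'') (fmap G d' d'' h') (fmap G d d' h)"
      by (intro F_inj[where x = "P d" and y = "P d''"])
        (auto simp: F_G conj_comp F_comp P G_simps(1) D_comp G_map intro!: G_map C_comp)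
  qed
  have FG: "naturally_isomorphic D D (comp_functor F G) id_functor"
    unfolding naturally_isomorphic_def
    by (rule exI[of _ \<epsilon>])
      (auto simp: comp_functor_def id_functor_def is_iso_def F_G \<epsilon>_conj G_simps(1)
        intro!: \<epsilon> bexI[OF _ \<delta>] \<delta>\<epsilon> \<epsilon>\<delta>)
  \<comment> \<open>The isomorphism at \<open>F c\<close> and its inverse, lifted to \<open>C\<close>.\<close>
  define \<eta> where "\<eta> c = lift (P (fobj F c)) c (\<epsilon> (fobj F c))" for c
  define \<eta>' where "\<eta>' c = lift c (P (fobj F c)) (\<delta> (fobj F c))" for c
  have \<eta>: "\<eta> c \<in> Hom C (P (fobj F c)) c" "fmap F (P (fobj F c)) c (\<eta> c) = \<epsilon> (fobj F c)"
    and \<eta>': "\<eta>' c \<in> Hom C c (P (fobj F c))" "fmap F c (P (fobj F c)) (\<eta>' c) = \<delta> (fobj F c)"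
    and PF: "P (fobj F c) \<in> Obj C" if "c \<in> Obj C" for c
    unfolding \<eta>_def \<eta>'_def using that by (auto intro!: lift_hom F_lift \<epsilon> \<delta> P F_obj)
  have GF: "naturally_isomorphic C C (comp_functor G F) id_functor"
    unfolding naturally_isomorphic_def
  proof (intro exI[of _ \<eta>] conjI ballI)
    fix c assume c: "c \<in> Obj C"
    have "Comp C (P (fobj F c)) c (P (fobj F c)) (\<eta>' c) (\<eta> c) = Id C (P (fobj F c))"
      using c by (intro F_inj[OF PF PF])
        (auto simp: F_comp PF \<eta> \<eta>' F_id \<delta>\<epsilon> F_obj intro!: C_comp C_id)
    moreover have "Comp C c (P (fobj F c)) c (\<eta> c) (\<eta>' c) = Id C c"
      using c by (intro F_inj[of c c])
        (auto simp: F_comp PF \<eta> \<eta>' F_id \<epsilon>\<delta> F_obj intro!: C_comp C_id)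
    ultimately show "is_iso C (fobj (comp_functor G F) c) (fobj id_functor c) (\<eta> c)"
      using \<eta>(1)[OF c] \<eta>'(1)[OF c]
      by (auto simp: comp_functor_def id_functor_def is_iso_def G_simps(1))
  next
    fix c d f assume c: "c \<in> Obj C" "d \<in> Obj C" and f: "f \<in> Hom C c d"
    let ?c = "P (fobj F c)" and ?d = "P (fobj F d)" and ?Gf = "fmap G (fobj F c) (fobj F d) (fmap F c d f)"
    have Gf: "?Gf \<in> Hom C ?c ?d" using c f by (auto intro!: G_map F_obj F_map)
    have "Comp C ?c ?d d (\<eta> d) ?Gf = Comp C ?c c d f (\<eta> c)"
      using c f Gf by (intro F_inj[of ?c d])
        (auto simp: F_comp PF \<eta> F_G F_obj F_map \<epsilon>_conj intro!: C_comp)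
    then show "Comp C (fobj (comp_functor G F) c) (fobj (comp_functor G F) d) (fobj id_functor d) (\<eta> d)
         (fmap (comp_functor G F) c d f) =
        Comp C (fobj (comp_functor G F) c) (fobj id_functor c) (fobj id_functor d)
         (fmap id_functor c d f) (\<eta> c)"
      by (simp add: comp_functor_def id_functor_def G_simps(1))
  qed
  show ?thesis
    unfolding equivalent_categories_def using C D F G FG GF by blast
qed

section \<open>Left modules over a ring\<close>

lemma additive_zero:
  assumes M: "abelian_group M" and N: "abelian_group N"
    and h: "h \<in> carrier M \<rightarrow> carrier N"
    and add: "\<And>x y. \<lbrakk>x \<in> carrier M; y \<in> carrier M\<rbrakk> \<Longrightarrow> h (x \<oplus>\<^bsub>M\<^esub> y) = h x \<oplus>\<^bsub>N\<^esub> h y"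
  shows "h \<zero>\<^bsub>M\<^esub> = \<zero>\<^bsub>N\<^esub>"
proof -
  interpret M: abelian_group M by fact
  interpret N: abelian_group N by fact
  have "h \<zero>\<^bsub>M\<^esub> \<oplus>\<^bsub>N\<^esub> h \<zero>\<^bsub>M\<^esub> = h \<zero>\<^bsub>M\<^esub>" using add[of "\<zero>\<^bsub>M\<^esub>" "\<zero>\<^bsub>M\<^esub>"] by simp
  moreover have "h \<zero>\<^bsub>M\<^esub> \<in> carrier N" using h by auto
  ultimately show ?thesis by (metis N.add.r_cancel_one')
qed

lemma additive_finsum:
  assumes M: "abelian_group M" and N: "abelian_group N"
    and h: "h \<in> carrier M \<rightarrow> carrier N"
    and add: "\<And>x y. \<lbrakk>x \<in> carrier M; y \<in> carrier M\<rbrakk> \<Longrightarrow> h (x \<oplus>\<^bsub>M\<^esub> y) = h x \<oplus>\<^bsub>N\<^esub> h y"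
    and f: "\<And>i. i \<in> I \<Longrightarrow> f i \<in> carrier M"
  shows "h (\<Oplus>\<^bsub>M\<^esub>i\<in>I. f i) = (\<Oplus>\<^bsub>N\<^esub>i\<in>I. h (f i))"
proof -
  interpret M: abelian_group M by fact
  interpret N: abelian_group N by fact
  note h0 = additive_zero[OF M N h add]
  show ?thesis
  proof (cases "finite I")
    case True
    then show ?thesis using f
    proof (induction I)
      case empty
      then show ?case by (simp add: h0)
    next
      case (insert i I)
      then have "h (\<Oplus>\<^bsub>M\<^esub>j\<in>insert i I. f j) = h (f i \<oplus>\<^bsub>M\<^esub> (\<Oplus>\<^bsub>M\<^esub>j\<in>I. f j))"
        by (subst M.finsum_insert) auto
      also have "\<dots> = h (f i) \<oplus>\<^bsub>N\<^esub> (\<Oplus>\<^bsub>N\<^esub>j\<in>I. h (f j))"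
        using insert by (subst add) (auto intro!: M.finsum_closed)
      also have "\<dots> = (\<Oplus>\<^bsub>N\<^esub>j\<in>insert i I. h (f j))"
        using insert h by (subst N.finsum_insert) auto
      finally show ?case .
    qed
  next
    case False
    then show ?thesis by (simp add: M.finsum_infinite N.finsum_infinite h0)
  qed
qed

lemma (in abelian_group) finsum_swap:
  assumes "finite A" and f: "\<And>i j. \<lbrakk>i \<in> A; j \<in> B\<rbrakk> \<Longrightarrow> f i j \<in> carrier G"
  shows "(\<Oplus>i\<in>A. \<Oplus>j\<in>B. f i j) = (\<Oplus>j\<in>B. \<Oplus>i\<in>A. f i j)"
  using assms
proof (induction A)
  case empty
  then show ?case by simp
next
  case (insert i A)
  have "(\<Oplus>j\<in>B. \<Oplus>k\<in>insert i A. f k j) = (\<Oplus>j\<in>B. f i j \<oplus> (\<Oplus>k\<in>A. f k j))"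
    using insert by (intro finsum_cong' refl) (auto intro!: finsum_closed)
  also have "\<dots> = (\<Oplus>j\<in>B. f i j) \<oplus> (\<Oplus>j\<in>B. \<Oplus>k\<in>A. f k j)"
    using insert by (intro finsum_addf) (auto intro!: finsum_closed)
  also have "\<dots> = (\<Oplus>j\<in>B. f i j) \<oplus> (\<Oplus>k\<in>A. \<Oplus>j\<in>B. f k j)"
    using insert by simp
  also have "\<dots> = (\<Oplus>k\<in>insert i A. \<Oplus>j\<in>B. f k j)"
    using insert by (subst finsum_insert) (auto intro!: finsum_closed)
  finally show ?case ..
qed

context left_module
begin

lemma smult_r_null: "a \<in> carrier R \<Longrightarrow> a \<odot>\<^bsub>M\<^esub> \<zero>\<^bsub>M\<^esub> = \<zero>\<^bsub>M\<^esub>"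
  by (rule additive_zero[where h = "\<lambda>x. a \<odot>\<^bsub>M\<^esub> x"])
    (auto intro: M.abelian_group_axioms smult_closed simp: smult_r_distr)

lemma smult_l_null: "x \<in> carrier M \<Longrightarrow> \<zero>\<^bsub>R\<^esub> \<odot>\<^bsub>M\<^esub> x = \<zero>\<^bsub>M\<^esub>"
  by (rule additive_zero[where h = "\<lambda>a. a \<odot>\<^bsub>M\<^esub> x" and M = R])
    (auto intro: M.abelian_group_axioms R.abelian_group_axioms smult_closed simp: smult_l_distr)

lemma smult_finsum_right:
  "\<lbrakk>a \<in> carrier R; \<And>i. i \<in> I \<Longrightarrow> f i \<in> carrier M\<rbrakk> \<Longrightarrow>
     a \<odot>\<^bsub>M\<^esub> (\<Oplus>\<^bsub>M\<^esub>i\<in>I. f i) = (\<Oplus>\<^bsub>M\<^esub>i\<in>I. a \<odot>\<^bsub>M\<^esub> f i)"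
  by (rule additive_finsum[where h = "\<lambda>x. a \<odot>\<^bsub>M\<^esub> x"])
    (auto intro: M.abelian_group_axioms smult_closed simp: smult_r_distr)

lemma smult_finsum_left:
  "\<lbrakk>x \<in> carrier M; \<And>i. i \<in> I \<Longrightarrow> f i \<in> carrier R\<rbrakk> \<Longrightarrow>
     (\<Oplus>\<^bsub>R\<^esub>i\<in>I. f i) \<odot>\<^bsub>M\<^esub> x = (\<Oplus>\<^bsub>M\<^esub>i\<in>I. f i \<odot>\<^bsub>M\<^esub> x)"
  by (rule additive_finsum[where h = "\<lambda>a. a \<odot>\<^bsub>M\<^esub> x" and M = R])
    (auto intro: M.abelian_group_axioms R.abelian_group_axioms smult_closed simp: smult_l_distr)

lemma smult_minus:
  assumes "a \<in> carrier R" "x \<in> carrier M"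
  shows "a \<odot>\<^bsub>M\<^esub> (\<ominus>\<^bsub>M\<^esub> x) = \<ominus>\<^bsub>M\<^esub> (a \<odot>\<^bsub>M\<^esub> x)"
proof -
  have "a \<odot>\<^bsub>M\<^esub> (\<ominus>\<^bsub>M\<^esub> x) \<oplus>\<^bsub>M\<^esub> a \<odot>\<^bsub>M\<^esub> x = \<zero>\<^bsub>M\<^esub>"
    using assms by (subst smult_r_distr[symmetric]) (auto simp: M.l_neg smult_r_null)
  then show ?thesis using assms by (simp add: M.minus_equality smult_closed)
qed

end

lemma is_category_left_module_cat: "is_category (left_module_cat U R)"
  unfolding is_category_def
proof (intro conjI ballI)
  fix M assume "M \<in> Obj (left_module_cat U R)"
  then interpret M: left_module R M by (simp add: left_module_cat_def)
  show "Id (left_module_cat U R) M \<in> Hom (left_module_cat U R) M M"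
    by (auto simp: left_module_cat_def left_module_hom_def M.smult_closed)
next
  fix M N P f g
  assume "M \<in> Obj (left_module_cat U R)"
    and f: "f \<in> Hom (left_module_cat U R) M N" and g: "g \<in> Hom (left_module_cat U R) N P"
  then interpret M: left_module R M by (simp add: left_module_cat_def)
  have fc: "f x \<in> carrier N" if "x \<in> carrier M" for x
    using f that by (auto simp: left_module_cat_def left_module_hom_def)
  show "Comp (left_module_cat U R) M N P g f \<in> Hom (left_module_cat U R) M P"
    using f g by (auto simp: left_module_cat_def left_module_hom_def M.smult_closed fc compose_def)
next
  fix M N f assume f: "f \<in> Hom (left_module_cat U R) M N"
  then have fM: "f \<in> carrier M \<rightarrow>\<^sub>E carrier N" by (simp add: left_module_cat_def left_module_hom_def)
  show "Comp (left_module_cat U R) M M N f (Id (left_module_cat U R) M) = f"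
    using fM by (intro extensionalityI[of _ "carrier M"])
      (auto simp: left_module_cat_def compose_def PiE_def)
  show "Comp (left_module_cat U R) M N N (Id (left_module_cat U R) N) f = f"
    using fM by (intro extensionalityI[of _ "carrier M"])
      (auto simp: left_module_cat_def compose_def PiE_def)
next
  fix M N P Q f g h assume f: "f \<in> Hom (left_module_cat U R) M N"
  then have "f \<in> carrier M \<rightarrow> carrier N" by (auto simp: left_module_cat_def left_module_hom_def)
  then show "Comp (left_module_cat U R) M N Q (Comp (left_module_cat U R) N P Q h g) f =
     Comp (left_module_cat U R) M P Q h (Comp (left_module_cat U R) M N P g f)"
    by (simp add: left_module_cat_def compose_assoc)
qed

text \<open>
  The two modules may live on different types. The maps need not be extensional, so that they
  compose as plain functions; \<open>module_iso_is_iso\<close> turns them into isomorphisms of the category.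
\<close>

definition module_iso ::
  "'a ring \<Rightarrow> ('a, 'm) module \<Rightarrow> ('a, 'n) module \<Rightarrow> ('m \<Rightarrow> 'n) \<Rightarrow> bool" where
  "module_iso R M N h \<longleftrightarrow> bij_betw h (carrier M) (carrier N) \<and>
     (\<forall>x \<in> carrier M. \<forall>y \<in> carrier M. h (x \<oplus>\<^bsub>M\<^esub> y) = h x \<oplus>\<^bsub>N\<^esub> h y) \<and>
     (\<forall>a \<in> carrier R. \<forall>x \<in> carrier M. h (a \<odot>\<^bsub>M\<^esub> x) = a \<odot>\<^bsub>N\<^esub> h x)"

lemma module_iso_compose:
  assumes "left_module R M" "module_iso R M N h" "module_iso R N P k"
  shows "module_iso R M P (k \<circ> h)"
proof -
  interpret left_module R M by fact
  have hc: "h x \<in> carrier N" if "x \<in> carrier M" for x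
    using assms(2) that by (auto simp: module_iso_def bij_betw_def)
  show ?thesis
    using assms(2,3) by (auto simp: module_iso_def hc smult_closed intro: bij_betw_trans)
qed

lemma module_iso_is_iso:
  assumes M: "left_module R M" and N: "left_module R N" and h: "module_iso R M N h"
  shows "\<exists>k. is_iso (left_module_cat U R) N M k"
proof -
  interpret M: left_module R M by fact
  interpret N: left_module R N by fact
  have bij: "bij_betw h (carrier M) (carrier N)" using h by (simp add: module_iso_def)
  let ?k = "restrict (inv_into (carrier M) h) (carrier N)"
  let ?h = "restrict h (carrier M)"
  have hk: "\<And>y. y \<in> carrier N \<Longrightarrow> h (inv_into (carrier M) h y) = y"
    and kc: "\<And>y. y \<in> carrier N \<Longrightarrow> inv_into (carrier M) h y \<in> carrier M"
    and kh: "\<And>x. x \<in> carrier M \<Longrightarrow> inv_into (carrier M) h (h x) = x"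
    and hc: "\<And>x. x \<in> carrier M \<Longrightarrow> h x \<in> carrier N"
    using bij by (auto simp: bij_betw_def f_inv_into_f inv_into_into)
  have "?h \<in> left_module_hom R M N"
    using h hc by (auto simp: module_iso_def left_module_hom_def M.smult_closed)
  moreover have "?k \<in> left_module_hom R N M"
  proof -
    have "inv_into (carrier M) h (x \<oplus>\<^bsub>N\<^esub> y) = inv_into (carrier M) h x \<oplus>\<^bsub>M\<^esub> inv_into (carrier M) h y"
      if "x \<in> carrier N" "y \<in> carrier N" for x y
      using h kh[of "inv_into (carrier M) h x \<oplus>\<^bsub>M\<^esub> inv_into (carrier M) h y"] that
      by (simp add: module_iso_def hk kc)
    moreover have "inv_into (carrier M) h (r \<odot>\<^bsub>N\<^esub> x) = r \<odot>\<^bsub>M\<^esub> inv_into (carrier M) h x"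
      if "x \<in> carrier N" "r \<in> carrier R" for x r
      using h kh[of "r \<odot>\<^bsub>M\<^esub> inv_into (carrier M) h x"] that
      by (simp add: module_iso_def hk kc M.smult_closed)
    ultimately show ?thesis
      using kc by (auto simp: left_module_hom_def N.smult_closed)
  qed
  moreover have "compose (carrier N) ?h ?k = restrict id (carrier N)"
    "compose (carrier M) ?k ?h = restrict id (carrier M)"
    using hk kc kh hc by (auto simp: compose_def fun_eq_iff)
  ultimately show ?thesis
    by (auto simp: is_iso_def left_module_cat_def)
qed

text \<open>
  Module constructions produce carriers on types of functions; this moves them into the universe.
\<close>

lemma module_iso_transport:
  fixes M :: "('a, 'm) module" and c :: "'m \<Rightarrow> 'c"
  assumes M: "left_module R M" and c: "inj_on c (carrier M)"
  shows "\<exists>M'. left_module R M' \<and> module_iso R M M' c"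
proof -
  interpret M: left_module R M by fact
  define d where "d = inv_into (carrier M) c"
  have dc: "\<And>x. x \<in> carrier M \<Longrightarrow> d (c x) = x" using c by (simp add: d_def)
  define M' :: "('a, 'c) module" where "M' = \<lparr>carrier = c ` carrier M, mult = undefined, one = undefined,
     zero = c \<zero>\<^bsub>M\<^esub>, add = (\<lambda>x y. c (d x \<oplus>\<^bsub>M\<^esub> d y)), smult = (\<lambda>r x. c (r \<odot>\<^bsub>M\<^esub> d x))\<rparr>"
  note defs = dc M.smult_closed M'_def
  have "abelian_group M'"
  proof (rule abelian_groupI)
    fix x assume "x \<in> carrier M'"
    then show "\<exists>y \<in> carrier M'. y \<oplus>\<^bsub>M'\<^esub> x = \<zero>\<^bsub>M'\<^esub>"
      by (intro bexI[of _ "c (\<ominus>\<^bsub>M\<^esub> d x)"]) (auto simp: defs M.l_neg)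
  qed (auto simp: defs M.a_ac)
  then have "left_module R M'"
    by (intro left_module.intro left_module_axioms.intro M.ring_axioms)
      (auto simp: defs M.smult_l_distr M.smult_r_distr M.smult_assoc M.smult_one)
  moreover have "module_iso R M M' c"
    using c by (auto simp: module_iso_def defs bij_betw_def)
  ultimately show ?thesis by blast
qed

text \<open>
  Induction on the index set, using that an infinite type is equipotent to its square.
\<close>

lemma infinite_product_embedding:
  assumes inf: "infinite (UNIV :: 'u set)" and "finite I"
  shows "\<exists>c :: ('i \<Rightarrow> 'u) \<Rightarrow> 'u. inj_on c (\<Pi>\<^sub>E i\<in>I. UNIV)"
proof -
  obtain p :: "'u \<times> 'u \<Rightarrow> 'u" where "bij_betw p (UNIV \<times> UNIV) UNIV"
    using card_of_Times_same_infinite[OF inf] unfolding card_of_ordIso[symmetric] by blast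
  then have p: "inj p" by (simp add: bij_betw_def)
  show ?thesis using \<open>finite I\<close>
  proof (induction I)
    case empty
    show ?case by (auto intro!: exI)
  next
    case (insert i I)
    then obtain c :: "('i \<Rightarrow> 'u) \<Rightarrow> 'u" where c: "inj_on c (\<Pi>\<^sub>E i\<in>I. UNIV)" by blast
    have "inj_on (\<lambda>x. p (x i, c (restrict x I))) (\<Pi>\<^sub>E j\<in>insert i I. UNIV)"
    proof (rule inj_onI)
      fix x y :: "'i \<Rightarrow> 'u"
      assume x: "x \<in> (\<Pi>\<^sub>E j\<in>insert i I. UNIV)" and y: "y \<in> (\<Pi>\<^sub>E j\<in>insert i I. UNIV)"
        and eq: "p (x i, c (restrict x I)) = p (y i, c (restrict y I))"
      from eq have "x i = y i" and "c (restrict x I) = c (restrict y I)"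
        using p by (auto dest: injD)
      moreover have "restrict x I = restrict y I"
        using calculation(2) c by (auto dest!: inj_onD)
      ultimately show "x = y"
        using x y by (intro PiE_ext[OF x y]) (metis insert_iff restrict_apply')
    qed
    then show ?case by blast
  qed
qed

text \<open>
  A map \<open>m\<close> into matrices over \<open>S\<close> that respects addition and multiplication turns \<open>N\<^sup>I\<close> into
  an \<open>R\<close>-module except that \<open>1\<close> acts as an idempotent matrix rather than as the identity. On the
  image of that idempotent the action is unital. With \<open>m\<close> built from a full corner this is the
  module induced from \<open>N\<close>, without tensor products.
\<close>

lemma
  fixes R :: "('a, 'x) ring_scheme" and S :: "('s, 'y) ring_scheme" and N :: "('s, 'n) module"
    and I :: "'i set" and m :: "'a \<Rightarrow> 'i \<Rightarrow> 'i \<Rightarrow> 's"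
  assumes R: "ring R" and N: "left_module S N" and fin: "finite I"
    and m_closed: "\<And>r i j. \<lbrakk>r \<in> carrier R; i \<in> I; j \<in> I\<rbrakk> \<Longrightarrow> m r i j \<in> carrier S"
    and m_add: "\<And>r s i j. \<lbrakk>r \<in> carrier R; s \<in> carrier R; i \<in> I; j \<in> I\<rbrakk> \<Longrightarrow>
       m (r \<oplus>\<^bsub>R\<^esub> s) i j = m r i j \<oplus>\<^bsub>S\<^esub> m s i j"
    and m_mult: "\<And>r s i j. \<lbrakk>r \<in> carrier R; s \<in> carrier R; i \<in> I; j \<in> I\<rbrakk> \<Longrightarrow>
       m (r \<otimes>\<^bsub>R\<^esub> s) i j = (\<Oplus>\<^bsub>S\<^esub>k\<in>I. m r i k \<otimes>\<^bsub>S\<^esub> m s k j)"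
  defines "act \<equiv> \<lambda>r y. \<lambda>i\<in>I. \<Oplus>\<^bsub>N\<^esub>j\<in>I. m r i j \<odot>\<^bsub>N\<^esub> y j"
  shows matrix_act_mult: "\<lbrakk>r \<in> carrier R; s \<in> carrier R; y \<in> (\<Pi>\<^sub>E i\<in>I. carrier N)\<rbrakk> \<Longrightarrow>
       act (r \<otimes>\<^bsub>R\<^esub> s) y = act r (act s y)"
    and left_module_matrix_act: "left_module R \<lparr>carrier = {y \<in> (\<Pi>\<^sub>E i\<in>I. carrier N). act \<one>\<^bsub>R\<^esub> y = y},
       mult = undefined, one = undefined, zero = (\<lambda>i\<in>I. \<zero>\<^bsub>N\<^esub>),
       add = (\<lambda>y z. \<lambda>i\<in>I. y i \<oplus>\<^bsub>N\<^esub> z i), smult = act\<rparr>"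
proof -
  interpret R: ring R by fact
  interpret N: left_module S N by fact
  let ?P = "\<Pi>\<^sub>E i\<in>I. carrier N"
  have PE: "y i \<in> carrier N" if "y \<in> ?P" "i \<in> I" for y i using that by auto
  have act_apply: "act r y i = (\<Oplus>\<^bsub>N\<^esub>j\<in>I. m r i j \<odot>\<^bsub>N\<^esub> y j)" if "i \<in> I" for r y i
    using that by (simp add: act_def)
  have act_ext: "act r y = z" if "z \<in> extensional I" "\<And>i. i \<in> I \<Longrightarrow> act r y i = z i" for r y z
    using that by (intro extensionalityI[of _ I]) (auto simp: act_def)
  note closed = PE m_closed N.smult_closed N.finsum_closed
  have act_closed: "act r y \<in> ?P" if "r \<in> carrier R" "y \<in> ?P" for r y
    using that by (auto simp: act_def intro!: closed)
  show act_mult: "act (r \<otimes>\<^bsub>R\<^esub> s) y = act r (act s y)"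
    if r: "r \<in> carrier R" "s \<in> carrier R" and y: "y \<in> ?P" for r s y
  proof -
    have yc: "y j \<in> carrier N" if "j \<in> I" for j using y that by auto
    have entry: "act (r \<otimes>\<^bsub>R\<^esub> s) y i = act r (act s y) i" if i: "i \<in> I" for i
    proof -
      have "act (r \<otimes>\<^bsub>R\<^esub> s) y i = (\<Oplus>\<^bsub>N\<^esub>k\<in>I. \<Oplus>\<^bsub>N\<^esub>j\<in>I. (m r i j \<otimes>\<^bsub>S\<^esub> m s j k) \<odot>\<^bsub>N\<^esub> y k)"
        unfolding act_apply[OF i]
        using r y i
        by (intro N.finsum_cong' refl)
          (auto simp: m_mult N.smult_finsum_left m_closed yc intro!: N.finsum_closed N.smult_closed m_closed)
      also have "\<dots> = (\<Oplus>\<^bsub>N\<^esub>j\<in>I. \<Oplus>\<^bsub>N\<^esub>k\<in>I. (m r i j \<otimes>\<^bsub>S\<^esub> m s j k) \<odot>\<^bsub>N\<^esub> y k)"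
        using r y i fin by (intro N.finsum_swap) (auto intro!: N.smult_closed m_closed)
      also have "\<dots> = act r (act s y) i"
        unfolding act_apply[OF i]
      proof (intro N.finsum_cong' refl)
        fix j assume j: "j \<in> I"
        have "(\<Oplus>\<^bsub>N\<^esub>k\<in>I. (m r i j \<otimes>\<^bsub>S\<^esub> m s j k) \<odot>\<^bsub>N\<^esub> y k)
            = (\<Oplus>\<^bsub>N\<^esub>k\<in>I. m r i j \<odot>\<^bsub>N\<^esub> (m s j k \<odot>\<^bsub>N\<^esub> y k))"
          using r y i j by (intro N.finsum_cong' refl) (auto simp: N.smult_assoc m_closed yc intro!: N.smult_closed m_closed)
        then show "(\<Oplus>\<^bsub>N\<^esub>k\<in>I. (m r i j \<otimes>\<^bsub>S\<^esub> m s j k) \<odot>\<^bsub>N\<^esub> y k) = m r i j \<odot>\<^bsub>N\<^esub> act s y j"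
          using r y i j by (subst act_apply[OF j], subst N.smult_finsum_right) (auto intro!: N.smult_closed m_closed)
      qed (use r y i act_closed[OF r(2) y] in \<open>auto intro!: N.smult_closed m_closed\<close>)
      finally show ?thesis .
    qed
    show ?thesis
      using act_closed[OF r(1) act_closed[OF r(2) y]] by (intro act_ext entry) (auto simp: PiE_def)
  qed
  let ?add = "\<lambda>y z. \<lambda>i\<in>I. y i \<oplus>\<^bsub>N\<^esub> z i"
  have act_l: "act (r \<oplus>\<^bsub>R\<^esub> s) y = ?add (act r y) (act s y)"
    if "r \<in> carrier R" "s \<in> carrier R" "y \<in> ?P" for r s y
  proof (unfold act_def, rule restrict_ext)
    fix i assume i: "i \<in> I"
    have "(\<Oplus>\<^bsub>N\<^esub>j\<in>I. m (r \<oplus>\<^bsub>R\<^esub> s) i j \<odot>\<^bsub>N\<^esub> y j)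
       = (\<Oplus>\<^bsub>N\<^esub>j\<in>I. m r i j \<odot>\<^bsub>N\<^esub> y j \<oplus>\<^bsub>N\<^esub> m s i j \<odot>\<^bsub>N\<^esub> y j)"
      using that i by (intro N.finsum_cong' refl) (auto simp: m_add N.smult_l_distr closed intro!: closed)
    also have "\<dots> = (\<Oplus>\<^bsub>N\<^esub>j\<in>I. m r i j \<odot>\<^bsub>N\<^esub> y j) \<oplus>\<^bsub>N\<^esub> (\<Oplus>\<^bsub>N\<^esub>j\<in>I. m s i j \<odot>\<^bsub>N\<^esub> y j)"
      using that i by (intro N.finsum_addf) (auto intro!: closed)
    finally show "(\<Oplus>\<^bsub>N\<^esub>j\<in>I. m (r \<oplus>\<^bsub>R\<^esub> s) i j \<odot>\<^bsub>N\<^esub> y j) =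
      (\<lambda>i\<in>I. \<Oplus>\<^bsub>N\<^esub>j\<in>I. m r i j \<odot>\<^bsub>N\<^esub> y j) i \<oplus>\<^bsub>N\<^esub> (\<lambda>i\<in>I. \<Oplus>\<^bsub>N\<^esub>j\<in>I. m s i j \<odot>\<^bsub>N\<^esub> y j) i"
      using i by simp
  qed
  have act_r: "act r (?add y z) = ?add (act r y) (act r z)"
    if "r \<in> carrier R" "y \<in> ?P" "z \<in> ?P" for r y z
  proof (unfold act_def, rule restrict_ext)
    fix i assume i: "i \<in> I"
    have "(\<Oplus>\<^bsub>N\<^esub>j\<in>I. m r i j \<odot>\<^bsub>N\<^esub> ?add y z j)
       = (\<Oplus>\<^bsub>N\<^esub>j\<in>I. m r i j \<odot>\<^bsub>N\<^esub> y j \<oplus>\<^bsub>N\<^esub> m r i j \<odot>\<^bsub>N\<^esub> z j)"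
      using that i by (intro N.finsum_cong' refl) (auto simp: N.smult_r_distr closed intro!: closed)
    also have "\<dots> = (\<Oplus>\<^bsub>N\<^esub>j\<in>I. m r i j \<odot>\<^bsub>N\<^esub> y j) \<oplus>\<^bsub>N\<^esub> (\<Oplus>\<^bsub>N\<^esub>j\<in>I. m r i j \<odot>\<^bsub>N\<^esub> z j)"
      using that i by (intro N.finsum_addf) (auto intro!: closed)
    finally show "(\<Oplus>\<^bsub>N\<^esub>j\<in>I. m r i j \<odot>\<^bsub>N\<^esub> ?add y z j) =
      (\<lambda>i\<in>I. \<Oplus>\<^bsub>N\<^esub>j\<in>I. m r i j \<odot>\<^bsub>N\<^esub> y j) i \<oplus>\<^bsub>N\<^esub> (\<lambda>i\<in>I. \<Oplus>\<^bsub>N\<^esub>j\<in>I. m r i j \<odot>\<^bsub>N\<^esub> z j) i"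
      using i by simp
  qed
  have add_P: "?add y z \<in> ?P" if "y \<in> ?P" "z \<in> ?P" for y z
    using that by auto
  have act_0: "act r (\<lambda>i\<in>I. \<zero>\<^bsub>N\<^esub>) = (\<lambda>i\<in>I. \<zero>\<^bsub>N\<^esub>)" if "r \<in> carrier R" for r
    using that unfolding act_def
    by (intro restrict_ext N.add.finprod_one_eqI) (simp add: N.smult_r_null m_closed)
  have act_neg: "?add (act (\<ominus>\<^bsub>R\<^esub> \<one>\<^bsub>R\<^esub>) y) y = (\<lambda>i\<in>I. \<zero>\<^bsub>N\<^esub>)" if y: "y \<in> ?P" "act \<one>\<^bsub>R\<^esub> y = y" for y
  proof -
    have m0: "m \<zero>\<^bsub>R\<^esub> i j = \<zero>\<^bsub>S\<^esub>" if "i \<in> I" "j \<in> I" for i j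
      by (rule additive_zero[where M = R and h = "\<lambda>r. m r i j"])
        (use that in \<open>auto intro: R.abelian_group_axioms N.R.abelian_group_axioms m_closed m_add\<close>)
    have "?add (act (\<ominus>\<^bsub>R\<^esub> \<one>\<^bsub>R\<^esub>) y) y = act (\<ominus>\<^bsub>R\<^esub> \<one>\<^bsub>R\<^esub> \<oplus>\<^bsub>R\<^esub> \<one>\<^bsub>R\<^esub>) y"
      using y by (simp add: act_l)
    also have "\<dots> = (\<lambda>i\<in>I. \<zero>\<^bsub>N\<^esub>)"
      unfolding act_def using y
      by (intro restrict_ext N.add.finprod_one_eqI) (simp add: R.l_neg m0 N.smult_l_null PE)
    finally show ?thesis .
  qed
  let ?X = "\<lparr>carrier = {y \<in> ?P. act \<one>\<^bsub>R\<^esub> y = y},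
       mult = undefined, one = undefined, zero = (\<lambda>i\<in>I. \<zero>\<^bsub>N\<^esub>), add = ?add, smult = act\<rparr>"
  have "abelian_group ?X"
  proof (rule abelian_groupI)
    \<comment> \<open>Negatives come from the action of \<open>- 1\<close>, which stays in the image of the matrix of \<open>1\<close>.\<close>
    fix x assume x: "x \<in> carrier ?X"
    have "act \<one>\<^bsub>R\<^esub> (act (\<ominus>\<^bsub>R\<^esub> \<one>\<^bsub>R\<^esub>) x) = act (\<ominus>\<^bsub>R\<^esub> \<one>\<^bsub>R\<^esub>) x"
      using x by (subst act_mult[symmetric]) auto
    then show "\<exists>y \<in> carrier ?X. y \<oplus>\<^bsub>?X\<^esub> x = \<zero>\<^bsub>?X\<^esub>"
      using x by (intro bexI[of _ "act (\<ominus>\<^bsub>R\<^esub> \<one>\<^bsub>R\<^esub>) x"]) (auto simp: act_neg act_closed)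
    show "\<zero>\<^bsub>?X\<^esub> \<oplus>\<^bsub>?X\<^esub> x = x"
      using x by (auto simp: fun_eq_iff PE PiE_def extensional_def)
  next
    fix x y z assume xyz: "x \<in> carrier ?X" "y \<in> carrier ?X" "z \<in> carrier ?X"
    show "x \<oplus>\<^bsub>?X\<^esub> y \<oplus>\<^bsub>?X\<^esub> z = x \<oplus>\<^bsub>?X\<^esub> (y \<oplus>\<^bsub>?X\<^esub> z)"
      using xyz by (auto simp: PE N.a_assoc intro!: restrict_ext)
  next
    fix x y assume xy: "x \<in> carrier ?X" "y \<in> carrier ?X"
    then show "x \<oplus>\<^bsub>?X\<^esub> y = y \<oplus>\<^bsub>?X\<^esub> x"
      by (auto simp: PE N.a_comm intro!: restrict_ext)
    show "x \<oplus>\<^bsub>?X\<^esub> y \<in> carrier ?X"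
      using xy add_P by (simp add: act_r)
  qed (simp add: act_0)
  then show "left_module R ?X"
  proof (intro left_module.intro left_module_axioms.intro R)
    fix r x assume r: "r \<in> carrier R" and x: "x \<in> carrier ?X"
    then have "act \<one>\<^bsub>R\<^esub> (act r x) = act r x" by (subst act_mult[symmetric]) auto
    then show "r \<odot>\<^bsub>?X\<^esub> x \<in> carrier ?X" using r x act_closed by simp
  qed (auto simp: act_l act_r act_mult)
qed

section \<open>Morita equivalence with a full corner\<close>

text \<open>
  \<open>S\<close> is identified by \<open>\<phi>\<close> with the corner \<open>e R e\<close>, where \<open>e\<close> is the image of \<open>1\<close>, and the
  fullness \<open>R e R = R\<close> is given in the form of a decomposition \<open>1 = \<Sum>a\<^sub>i b\<^sub>i\<close> with
  \<open>a\<^sub>i \<in> R e\<close> and \<open>b\<^sub>i \<in> e R\<close>.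
\<close>

locale full_corner = R: ring R + S: ring S
  for R :: "'a ring" and S :: "'s ring" +
  fixes \<phi> :: "'s \<Rightarrow> 'a" and I :: "'i set" and a b :: "'i \<Rightarrow> 'a"
  assumes \<phi>_closed: "s \<in> carrier S \<Longrightarrow> \<phi> s \<in> carrier R"
    and \<phi>_add: "\<lbrakk>s \<in> carrier S; t \<in> carrier S\<rbrakk> \<Longrightarrow> \<phi> (s \<oplus>\<^bsub>S\<^esub> t) = \<phi> s \<oplus>\<^bsub>R\<^esub> \<phi> t"
    and \<phi>_mult: "\<lbrakk>s \<in> carrier S; t \<in> carrier S\<rbrakk> \<Longrightarrow> \<phi> (s \<otimes>\<^bsub>S\<^esub> t) = \<phi> s \<otimes>\<^bsub>R\<^esub> \<phi> t"
    and \<phi>_inj: "inj_on \<phi> (carrier S)"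
    and \<phi>_surj: "r \<in> carrier R \<Longrightarrow> \<phi> \<one>\<^bsub>S\<^esub> \<otimes>\<^bsub>R\<^esub> r \<otimes>\<^bsub>R\<^esub> \<phi> \<one>\<^bsub>S\<^esub> \<in> \<phi> ` carrier S"
    and fin: "finite I"
    and a_closed: "i \<in> I \<Longrightarrow> a i \<in> carrier R" and b_closed: "i \<in> I \<Longrightarrow> b i \<in> carrier R"
    and a_corner: "i \<in> I \<Longrightarrow> a i \<otimes>\<^bsub>R\<^esub> \<phi> \<one>\<^bsub>S\<^esub> = a i"
    and b_corner: "i \<in> I \<Longrightarrow> \<phi> \<one>\<^bsub>S\<^esub> \<otimes>\<^bsub>R\<^esub> b i = b i"
    and full: "(\<Oplus>\<^bsub>R\<^esub>i\<in>I. a i \<otimes>\<^bsub>R\<^esub> b i) = \<one>\<^bsub>R\<^esub>"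
begin

abbreviation e where "e \<equiv> \<phi> \<one>\<^bsub>S\<^esub>"

abbreviation corner_pullback where "corner_pullback \<equiv> inv_into (carrier S) \<phi>"

lemma e_closed: "e \<in> carrier R"
  by (simp add: \<phi>_closed)

lemma e_\<phi>: "s \<in> carrier S \<Longrightarrow> e \<otimes>\<^bsub>R\<^esub> \<phi> s = \<phi> s" and \<phi>_e: "s \<in> carrier S \<Longrightarrow> \<phi> s \<otimes>\<^bsub>R\<^esub> e = \<phi> s"
  by (simp_all flip: \<phi>_mult)

lemma e_idem: "e \<otimes>\<^bsub>R\<^esub> e = e"
  by (simp add: e_\<phi>)

lemma
  assumes "r \<in> carrier R" "e \<otimes>\<^bsub>R\<^esub> r = r" "r \<otimes>\<^bsub>R\<^esub> e = r"
  shows corner_pullback_closed: "corner_pullback r \<in> carrier S"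
    and \<phi>_corner_pullback: "\<phi> (corner_pullback r) = r"
  using \<phi>_surj[OF assms(1)] assms(2,3) by (auto intro: inv_into_into f_inv_into_f)

lemma \<phi>_eqD: "\<lbrakk>\<phi> s = \<phi> t; s \<in> carrier S; t \<in> carrier S\<rbrakk> \<Longrightarrow> s = t"
  using \<phi>_inj by (rule inj_onD)

lemma \<phi>_finsum:
  "(\<And>i. i \<in> J \<Longrightarrow> f i \<in> carrier S) \<Longrightarrow> \<phi> (\<Oplus>\<^bsub>S\<^esub>i\<in>J. f i) = (\<Oplus>\<^bsub>R\<^esub>i\<in>J. \<phi> (f i))"
  by (rule additive_finsum)
    (auto intro: R.abelian_group_axioms S.abelian_group_axioms \<phi>_closed \<phi>_add)

lemma insert_unit:
  assumes "x \<in> carrier R" "y \<in> carrier R"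
  shows "(\<Oplus>\<^bsub>R\<^esub>k\<in>I. (x \<otimes>\<^bsub>R\<^esub> a k) \<otimes>\<^bsub>R\<^esub> (b k \<otimes>\<^bsub>R\<^esub> y)) = x \<otimes>\<^bsub>R\<^esub> y"
proof -
  have "x \<otimes>\<^bsub>R\<^esub> (\<Oplus>\<^bsub>R\<^esub>k\<in>I. a k \<otimes>\<^bsub>R\<^esub> b k) \<otimes>\<^bsub>R\<^esub> y = (\<Oplus>\<^bsub>R\<^esub>k\<in>I. x \<otimes>\<^bsub>R\<^esub> (a k \<otimes>\<^bsub>R\<^esub> b k) \<otimes>\<^bsub>R\<^esub> y)"
    using assms
    by (intro additive_finsum[where h = "\<lambda>z. x \<otimes>\<^bsub>R\<^esub> z \<otimes>\<^bsub>R\<^esub> y"])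
      (auto intro: R.abelian_group_axioms a_closed b_closed simp: R.r_distr R.l_distr)
  also have "\<dots> = (\<Oplus>\<^bsub>R\<^esub>k\<in>I. (x \<otimes>\<^bsub>R\<^esub> a k) \<otimes>\<^bsub>R\<^esub> (b k \<otimes>\<^bsub>R\<^esub> y))"
    using assms by (intro R.finsum_cong' refl) (auto simp: a_closed b_closed R.m_assoc)
  finally show ?thesis using assms by (simp add: full)
qed

definition corner_module :: "('a, 'm) module \<Rightarrow> ('s, 'm) module" where
  "corner_module M = \<lparr>carrier = {x \<in> carrier M. e \<odot>\<^bsub>M\<^esub> x = x}, mult = mult M, one = one M,
     zero = zero M, add = add M, smult = (\<lambda>s x. \<phi> s \<odot>\<^bsub>M\<^esub> x)\<rparr>"

lemma corner_module_simps:
  "x \<in> carrier (corner_module M) \<longleftrightarrow> x \<in> carrier M \<and> e \<odot>\<^bsub>M\<^esub> x = x"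
  "zero (corner_module M) = zero M" "add (corner_module M) = add M"
  "s \<odot>\<^bsub>corner_module M\<^esub> x = \<phi> s \<odot>\<^bsub>M\<^esub> x"
  by (simp_all add: corner_module_def)

lemma left_module_corner_module:
  assumes "left_module R M"
  shows "left_module S (corner_module M)"
proof -
  interpret left_module R M by fact
  have "abelian_group (corner_module M)"
  proof (rule abelian_groupI)
    fix x assume "x \<in> carrier (corner_module M)"
    then show "\<exists>y \<in> carrier (corner_module M). y \<oplus>\<^bsub>corner_module M\<^esub> x = \<zero>\<^bsub>corner_module M\<^esub>"
      by (intro bexI[of _ "\<ominus>\<^bsub>M\<^esub> x"])
        (auto simp: corner_module_simps smult_minus e_closed M.l_neg)
  qed (auto simp: corner_module_simps smult_r_distr e_closed M.a_ac smult_r_null)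
  then show ?thesis
    by (intro left_module.intro left_module_axioms.intro S.ring_axioms)
      (auto simp: corner_module_simps smult_closed smult_l_distr smult_r_distr smult_assoc
         \<phi>_closed \<phi>_add \<phi>_mult e_\<phi> simp flip: smult_assoc)
qed

text \<open>
  The operator \<^const>\<open>finsum\<close> depends on the carrier, so sums taken in \<open>e M\<close> and in \<open>M\<close> are
  compared through the additive inclusion.
\<close>

lemma finsum_corner_module:
  assumes "left_module R M" and f: "\<And>i. i \<in> J \<Longrightarrow> f i \<in> carrier (corner_module M)"
  shows "finsum (corner_module M) f J = finsum M f J"
proof -
  interpret M: left_module R M by fact
  interpret C: left_module S "corner_module M" by (rule left_module_corner_module) fact
  show ?thesis
    using f by (intro additive_finsum[where h = "\<lambda>x. x", simplified])
      (auto simp: corner_module_simps intro: M.M.abelian_group_axioms C.M.abelian_group_axioms)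
qed

lemma smult_in_corner:
  assumes M: "left_module R M" and "r \<in> carrier R" "e \<otimes>\<^bsub>R\<^esub> r = r" "x \<in> carrier M"
  shows "r \<odot>\<^bsub>M\<^esub> x \<in> carrier (corner_module M)"
proof -
  interpret M: left_module R M by fact
  show ?thesis using assms
    by (simp add: corner_module_simps M.smult_closed e_closed flip: M.smult_assoc)
qed

lemma smult_b_in_corner:
  "\<lbrakk>left_module R M; i \<in> I; x \<in> carrier M\<rbrakk> \<Longrightarrow> b i \<odot>\<^bsub>M\<^esub> x \<in> carrier (corner_module M)"
  by (rule smult_in_corner) (auto simp: b_closed b_corner)

text \<open>
  The identity behind full faithfulness: an element is recovered from its components
  \<open>b\<^sub>i x \<in> e M\<close>.
\<close>

lemma module_expansion:
  assumes "left_module R M" "x \<in> carrier M"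
  shows "(\<Oplus>\<^bsub>M\<^esub>i\<in>I. a i \<odot>\<^bsub>M\<^esub> (b i \<odot>\<^bsub>M\<^esub> x)) = x"
proof -
  interpret M: left_module R M by fact
  have "(\<Oplus>\<^bsub>M\<^esub>i\<in>I. a i \<odot>\<^bsub>M\<^esub> (b i \<odot>\<^bsub>M\<^esub> x)) = (\<Oplus>\<^bsub>M\<^esub>i\<in>I. (a i \<otimes>\<^bsub>R\<^esub> b i) \<odot>\<^bsub>M\<^esub> x)"
    using assms by (intro M.finsum_cong' refl) (auto simp: M.smult_assoc M.smult_closed a_closed b_closed)
  also have "\<dots> = (\<Oplus>\<^bsub>R\<^esub>i\<in>I. a i \<otimes>\<^bsub>R\<^esub> b i) \<odot>\<^bsub>M\<^esub> x"
    using assms by (intro M.smult_finsum_left[symmetric]) (auto simp: a_closed b_closed)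
  finally show ?thesis using assms by (simp add: full M.smult_one)
qed

definition corner_functor ::
  "(('a, 'u) module, 'u \<Rightarrow> 'u, ('s, 'u) module, 'u \<Rightarrow> 'u) cat_functor" where
  "corner_functor =
     \<lparr>fobj = corner_module, fmap = (\<lambda>M N f. restrict f (carrier (corner_module M)))\<rparr>"

lemma corner_hom:
  assumes M: "left_module R M" and f: "f \<in> left_module_hom R M N"
  shows "restrict f (carrier (corner_module M)) \<in> left_module_hom S (corner_module M) (corner_module N)"
proof -
  interpret M: left_module R M by fact
  interpret C: left_module S "corner_module M" by (rule left_module_corner_module) fact
  have f_smult: "\<And>r x. \<lbrakk>r \<in> carrier R; x \<in> carrier M\<rbrakk> \<Longrightarrow> f (r \<odot>\<^bsub>M\<^esub> x) = r \<odot>\<^bsub>N\<^esub> f x"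
    and f_add: "\<And>x y. \<lbrakk>x \<in> carrier M; y \<in> carrier M\<rbrakk> \<Longrightarrow> f (x \<oplus>\<^bsub>M\<^esub> y) = f x \<oplus>\<^bsub>N\<^esub> f y"
    and f_closed: "\<And>x. x \<in> carrier M \<Longrightarrow> f x \<in> carrier N"
    using f by (auto simp: left_module_hom_def)
  have "f x \<in> carrier (corner_module N)" if "x \<in> carrier (corner_module M)" for x
    using that f_smult[OF e_closed, of x] by (auto simp: corner_module_simps f_closed)
  moreover have "x \<oplus>\<^bsub>M\<^esub> y \<in> carrier (corner_module M)"
    if "x \<in> carrier (corner_module M)" "y \<in> carrier (corner_module M)" for x y
    using C.M.a_closed[OF that] by (simp add: corner_module_simps)
  moreover have "\<phi> s \<odot>\<^bsub>M\<^esub> x \<in> carrier (corner_module M)"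
    if "s \<in> carrier S" "x \<in> carrier (corner_module M)" for s x
    using C.smult_closed[OF that] by (simp add: corner_module_simps)
  ultimately show ?thesis
    by (auto simp: left_module_hom_def corner_module_simps f_add f_smult \<phi>_closed)
qed

lemma is_functor_corner:
  "is_functor (left_module_cat U R) (left_module_cat U S) corner_functor"
  unfolding is_functor_def
proof (intro conjI ballI)
  fix M assume "M \<in> Obj (left_module_cat U R)"
  then show "fobj corner_functor M \<in> Obj (left_module_cat U S)"
    by (simp add: left_module_cat_def corner_functor_def left_module_corner_module)
  show "fmap corner_functor M M (Id (left_module_cat U R) M) =
      Id (left_module_cat U S) (fobj corner_functor M)"
    by (auto simp: left_module_cat_def corner_functor_def corner_module_simps)
next
  fix M N f assume "M \<in> Obj (left_module_cat U R)" "f \<in> Hom (left_module_cat U R) M N"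
  then show "fmap corner_functor M N f
      \<in> Hom (left_module_cat U S) (fobj corner_functor M) (fobj corner_functor N)"
    by (simp add: left_module_cat_def corner_functor_def corner_hom)
next
  fix M N P f g assume M: "M \<in> Obj (left_module_cat U R)" and f: "f \<in> Hom (left_module_cat U R) M N"
  have "restrict f (carrier (corner_module M)) \<in> left_module_hom S (corner_module M) (corner_module N)"
    using M f by (simp add: left_module_cat_def corner_hom)
  then have "f x \<in> carrier (corner_module N)" if "x \<in> carrier (corner_module M)" for x
    using that by (auto simp: left_module_hom_def)
  then show "fmap corner_functor M P (Comp (left_module_cat U R) M N P g f) =
     Comp (left_module_cat U S) (fobj corner_functor M) (fobj corner_functor N) (fobj corner_functor P)
       (fmap corner_functor N P g) (fmap corner_functor M N f)"
    by (auto simp: left_module_cat_def corner_functor_def compose_def corner_module_simps fun_eq_iff)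
qed

lemma hom_corner_determines:
  assumes M: "left_module R M" and N: "left_module R N" and f: "f \<in> left_module_hom R M N" and x: "x \<in> carrier M"
  shows "f x = (\<Oplus>\<^bsub>N\<^esub>i\<in>I. a i \<odot>\<^bsub>N\<^esub> f (b i \<odot>\<^bsub>M\<^esub> x))"
proof -
  interpret M: left_module R M by fact
  interpret N: left_module R N by fact
  have f_smult: "\<And>r x. \<lbrakk>r \<in> carrier R; x \<in> carrier M\<rbrakk> \<Longrightarrow> f (r \<odot>\<^bsub>M\<^esub> x) = r \<odot>\<^bsub>N\<^esub> f x"
    and f_add: "\<And>x y. \<lbrakk>x \<in> carrier M; y \<in> carrier M\<rbrakk> \<Longrightarrow> f (x \<oplus>\<^bsub>M\<^esub> y) = f x \<oplus>\<^bsub>N\<^esub> f y"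
    and f_closed: "\<And>x. x \<in> carrier M \<Longrightarrow> f x \<in> carrier N"
    using f by (auto simp: left_module_hom_def)
  have "f x = f (\<Oplus>\<^bsub>M\<^esub>i\<in>I. a i \<odot>\<^bsub>M\<^esub> (b i \<odot>\<^bsub>M\<^esub> x))" by (simp add: module_expansion M x)
  also have "\<dots> = (\<Oplus>\<^bsub>N\<^esub>i\<in>I. f (a i \<odot>\<^bsub>M\<^esub> (b i \<odot>\<^bsub>M\<^esub> x)))"
    using x by (intro additive_finsum)
      (auto intro: M.M.abelian_group_axioms N.M.abelian_group_axioms simp: f_add f_closed M.smult_closed a_closed b_closed)
  also have "\<dots> = (\<Oplus>\<^bsub>N\<^esub>i\<in>I. a i \<odot>\<^bsub>N\<^esub> f (b i \<odot>\<^bsub>M\<^esub> x))"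
    using x by (intro N.finsum_cong' refl)
      (auto simp: f_smult f_closed M.smult_closed N.smult_closed a_closed b_closed)
  finally show ?thesis .
qed

text \<open>
  The extension is forced by \<open>hom_corner_determines\<close>: it sends \<open>x\<close> to \<open>\<Sum>a\<^sub>i g (b\<^sub>i x)\<close>. It is
  linear over all of \<open>R\<close> because \<open>b\<^sub>i r x = \<Sum>(b\<^sub>i r a\<^sub>j) (b\<^sub>j x)\<close> and the coefficients
  \<open>b\<^sub>i r a\<^sub>j\<close> lie in \<open>e R e\<close>, over which \<open>g\<close> is linear.
\<close>

lemma corner_hom_extends:
  assumes M: "left_module R M" and N: "left_module R N"
    and g: "g \<in> left_module_hom S (corner_module M) (corner_module N)"
  shows "\<exists>f \<in> left_module_hom R M N. restrict f (carrier (corner_module M)) = g"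
proof -
  interpret M: left_module R M by fact
  interpret N: left_module R N by fact
  interpret C: left_module S "corner_module M" by (rule left_module_corner_module) fact
  have g_smult: "\<And>s x. \<lbrakk>s \<in> carrier S; x \<in> carrier (corner_module M)\<rbrakk> \<Longrightarrow> g (\<phi> s \<odot>\<^bsub>M\<^esub> x) = \<phi> s \<odot>\<^bsub>N\<^esub> g x"
    and g_add: "\<And>x y. \<lbrakk>x \<in> carrier (corner_module M); y \<in> carrier (corner_module M)\<rbrakk> \<Longrightarrow> g (x \<oplus>\<^bsub>M\<^esub> y) = g x \<oplus>\<^bsub>N\<^esub> g y"
    and gN: "\<And>x. x \<in> carrier (corner_module M) \<Longrightarrow> g x \<in> carrier N"
    and eg: "\<And>x. x \<in> carrier (corner_module M) \<Longrightarrow> e \<odot>\<^bsub>N\<^esub> g x = g x"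
    and g_ext: "g \<in> extensional (carrier (corner_module M))"
    using g by (auto simp: left_module_hom_def corner_module_simps PiE_def)
  have g_corner: "g (r \<odot>\<^bsub>M\<^esub> x) = r \<odot>\<^bsub>N\<^esub> g x"
    if "r \<in> carrier R" "e \<otimes>\<^bsub>R\<^esub> r = r" "r \<otimes>\<^bsub>R\<^esub> e = r" "x \<in> carrier (corner_module M)" for r x
    using g_smult[OF corner_pullback_closed[OF that(1-3)] that(4)] by (simp add: \<phi>_corner_pullback that)
  note bM = smult_b_in_corner[OF M]
  have bM': "\<And>i x. i \<in> I \<Longrightarrow> x \<in> carrier M \<Longrightarrow> b i \<odot>\<^bsub>M\<^esub> x \<in> carrier M"
    using b_closed M.smult_closed by blast
  define f where "f = (\<lambda>x\<in>carrier M. \<Oplus>\<^bsub>N\<^esub>i\<in>I. a i \<odot>\<^bsub>N\<^esub> g (b i \<odot>\<^bsub>M\<^esub> x))"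
  have f_closed: "f x \<in> carrier N" if "x \<in> carrier M" for x
    using that by (auto simp: f_def intro!: N.finsum_closed N.smult_closed a_closed gN bM)
  have f_add: "f (x \<oplus>\<^bsub>M\<^esub> y) = f x \<oplus>\<^bsub>N\<^esub> f y" if xy: "x \<in> carrier M" "y \<in> carrier M" for x y
  proof -
    have "f (x \<oplus>\<^bsub>M\<^esub> y) = (\<Oplus>\<^bsub>N\<^esub>i\<in>I. a i \<odot>\<^bsub>N\<^esub> g (b i \<odot>\<^bsub>M\<^esub> x) \<oplus>\<^bsub>N\<^esub> a i \<odot>\<^bsub>N\<^esub> g (b i \<odot>\<^bsub>M\<^esub> y))"
      using xy by (auto simp: f_def M.smult_r_distr b_closed g_add bM N.smult_r_distr a_closed gN
          intro!: N.finsum_cong' N.smult_closed)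
    also have "\<dots> = f x \<oplus>\<^bsub>N\<^esub> f y"
      using xy by (auto simp: f_def intro!: N.finsum_addf N.smult_closed a_closed gN bM)
    finally show ?thesis .
  qed
  have f_smult: "f (r \<odot>\<^bsub>M\<^esub> x) = r \<odot>\<^bsub>N\<^esub> f x" if r: "r \<in> carrier R" and x: "x \<in> carrier M" for r x
  proof -
    \<comment> \<open>Expanding \<open>x\<close> turns the scalar \<open>b\<^sub>i r\<close> into scalars from the corner.\<close>
    have gb: "g (b i \<odot>\<^bsub>M\<^esub> (r \<odot>\<^bsub>M\<^esub> x)) = b i \<odot>\<^bsub>N\<^esub> (r \<odot>\<^bsub>N\<^esub> f x)" if i: "i \<in> I" for i
    proof -
      have cor: "b i \<otimes>\<^bsub>R\<^esub> r \<otimes>\<^bsub>R\<^esub> a j \<in> carrier R"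
        "e \<otimes>\<^bsub>R\<^esub> (b i \<otimes>\<^bsub>R\<^esub> r \<otimes>\<^bsub>R\<^esub> a j) = b i \<otimes>\<^bsub>R\<^esub> r \<otimes>\<^bsub>R\<^esub> a j"
        "b i \<otimes>\<^bsub>R\<^esub> r \<otimes>\<^bsub>R\<^esub> a j \<otimes>\<^bsub>R\<^esub> e = b i \<otimes>\<^bsub>R\<^esub> r \<otimes>\<^bsub>R\<^esub> a j" if "j \<in> I" for j
        using i r that
        by (auto simp: a_closed b_closed e_closed R.m_assoc a_corner)
          (metis R.m_assoc R.m_closed a_closed b_closed b_corner e_closed)
      have "b i \<odot>\<^bsub>M\<^esub> (r \<odot>\<^bsub>M\<^esub> x) = (b i \<otimes>\<^bsub>R\<^esub> r) \<odot>\<^bsub>M\<^esub> (\<Oplus>\<^bsub>M\<^esub>j\<in>I. a j \<odot>\<^bsub>M\<^esub> (b j \<odot>\<^bsub>M\<^esub> x))"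
        using i r x by (simp add: module_expansion M M.smult_assoc b_closed)
      also have "\<dots> = (\<Oplus>\<^bsub>M\<^esub>j\<in>I. (b i \<otimes>\<^bsub>R\<^esub> r \<otimes>\<^bsub>R\<^esub> a j) \<odot>\<^bsub>M\<^esub> (b j \<odot>\<^bsub>M\<^esub> x))"
        using i r x
        by (subst M.smult_finsum_right)
          (auto simp: M.smult_assoc b_closed a_closed M.smult_closed intro!: M.finsum_cong')
      also have "\<dots> = finsum (corner_module M) (\<lambda>j. (b i \<otimes>\<^bsub>R\<^esub> r \<otimes>\<^bsub>R\<^esub> a j) \<odot>\<^bsub>M\<^esub> (b j \<odot>\<^bsub>M\<^esub> x)) I"
        using cor x bM'
        by (intro finsum_corner_module[symmetric] M smult_in_corner) auto
      finally have "g (b i \<odot>\<^bsub>M\<^esub> (r \<odot>\<^bsub>M\<^esub> x)) =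
          g (finsum (corner_module M) (\<lambda>j. (b i \<otimes>\<^bsub>R\<^esub> r \<otimes>\<^bsub>R\<^esub> a j) \<odot>\<^bsub>M\<^esub> (b j \<odot>\<^bsub>M\<^esub> x)) I)" by simp
      also have "\<dots> = (\<Oplus>\<^bsub>N\<^esub>j\<in>I. g ((b i \<otimes>\<^bsub>R\<^esub> r \<otimes>\<^bsub>R\<^esub> a j) \<odot>\<^bsub>M\<^esub> (b j \<odot>\<^bsub>M\<^esub> x)))"
        using cor x bM'
        by (intro additive_finsum C.M.abelian_group_axioms N.M.abelian_group_axioms
              smult_in_corner M)
          (auto simp: gN g_add corner_module_simps(3))
      also have "\<dots> = (\<Oplus>\<^bsub>N\<^esub>j\<in>I. (b i \<otimes>\<^bsub>R\<^esub> r) \<odot>\<^bsub>N\<^esub> (a j \<odot>\<^bsub>N\<^esub> g (b j \<odot>\<^bsub>M\<^esub> x)))"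
        using i r x
        by (intro N.finsum_cong' refl)
          (auto simp: g_corner[OF cor bM] N.smult_assoc b_closed a_closed gN bM intro!: N.smult_closed)
      also have "\<dots> = (b i \<otimes>\<^bsub>R\<^esub> r) \<odot>\<^bsub>N\<^esub> f x"
        using i r x
        by (subst N.smult_finsum_right[symmetric])
          (auto simp: f_def b_closed a_closed gN bM intro!: N.smult_closed)
      also have "\<dots> = b i \<odot>\<^bsub>N\<^esub> (r \<odot>\<^bsub>N\<^esub> f x)"
        using i r x by (simp add: N.smult_assoc b_closed f_closed)
      finally show ?thesis .
    qed
    have "f (r \<odot>\<^bsub>M\<^esub> x) = (\<Oplus>\<^bsub>N\<^esub>i\<in>I. a i \<odot>\<^bsub>N\<^esub> (b i \<odot>\<^bsub>N\<^esub> (r \<odot>\<^bsub>N\<^esub> f x)))"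
      using r x by (auto simp: f_def[of] M.smult_closed gb[unfolded f_def]
          intro!: N.finsum_cong' N.smult_closed a_closed b_closed N.finsum_closed gN bM)
    also have "\<dots> = r \<odot>\<^bsub>N\<^esub> f x"
      using r x by (intro module_expansion N N.smult_closed f_closed)
    finally show ?thesis .
  qed
  \<comment> \<open>On \<open>e M\<close> the scalar \<open>b\<^sub>i\<close> may be replaced by \<open>b\<^sub>i e\<close>, which lies in the corner.\<close>
  have f_g: "f x = g x" if x: "x \<in> carrier (corner_module M)" for x
  proof -
    have xM: "x \<in> carrier M" "e \<odot>\<^bsub>M\<^esub> x = x" using x by (simp_all add: corner_module_simps)
    have "g (b i \<odot>\<^bsub>M\<^esub> x) = b i \<odot>\<^bsub>N\<^esub> g x" if i: "i \<in> I" for i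
    proof -
      have "g (b i \<odot>\<^bsub>M\<^esub> x) = g ((b i \<otimes>\<^bsub>R\<^esub> e) \<odot>\<^bsub>M\<^esub> x)"
        using i xM by (simp add: M.smult_assoc b_closed e_closed)
      also have "\<dots> = (b i \<otimes>\<^bsub>R\<^esub> e) \<odot>\<^bsub>N\<^esub> g x"
        using i x
        by (intro g_corner) (auto simp: b_closed e_closed R.m_assoc e_idem b_corner simp flip: R.m_assoc[of e])
      finally show ?thesis using i x by (simp add: N.smult_assoc b_closed e_closed gN eg)
    qed
    then have "f x = (\<Oplus>\<^bsub>N\<^esub>i\<in>I. a i \<odot>\<^bsub>N\<^esub> (b i \<odot>\<^bsub>N\<^esub> g x))"
      using x xM by (auto simp: f_def gN intro!: N.finsum_cong' N.smult_closed a_closed b_closed)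
    then show ?thesis using x by (simp add: module_expansion N gN)
  qed
  have "f \<in> left_module_hom R M N"
    using f_closed f_add f_smult by (auto simp: left_module_hom_def f_def extensional_def)
  moreover have "restrict f (carrier (corner_module M)) = g"
    using f_g g_ext by (intro extensionalityI[of _ "carrier (corner_module M)"]) auto
  ultimately show ?thesis by blast
qed

lemma corner_functor_fully_faithful:
  assumes M: "left_module R M" and N: "left_module R N"
  shows "bij_betw (\<lambda>f. restrict f (carrier (corner_module M))) (left_module_hom R M N)
           (left_module_hom S (corner_module M) (corner_module N))"
  unfolding bij_betw_def
proof
  show "inj_on (\<lambda>f. restrict f (carrier (corner_module M))) (left_module_hom R M N)"
  proof (rule inj_onI)
    fix f g assume f: "f \<in> left_module_hom R M N" and g: "g \<in> left_module_hom R M N"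
      and eq: "restrict f (carrier (corner_module M)) = restrict g (carrier (corner_module M))"
    have "f y = g y" if "y \<in> carrier (corner_module M)" for y
      using fun_cong[OF eq, of y] that by simp
    then have "f x = g x" if x: "x \<in> carrier M" for x
    proof -
      interpret N: left_module R N by fact
      show ?thesis
        unfolding hom_corner_determines[OF M N f x] hom_corner_determines[OF M N g x]
        using \<open>\<And>y. y \<in> carrier (corner_module M) \<Longrightarrow> f y = g y\<close> smult_b_in_corner[OF M _ x] g
        by (intro N.finsum_cong' refl)
          (auto simp: left_module_hom_def corner_module_simps intro!: N.smult_closed a_closed)
    qed
    moreover have "f \<in> extensional (carrier M)" "g \<in> extensional (carrier M)"
      using f g by (auto simp: left_module_hom_def PiE_def)
    ultimately show "f = g" by (intro extensionalityI)
  qed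
  show "(\<lambda>f. restrict f (carrier (corner_module M))) ` left_module_hom R M N =
      left_module_hom S (corner_module M) (corner_module N)"
    using corner_hom[OF M] corner_hom_extends[OF M N] by auto blast
qed

text \<open>
  Since \<open>1 = \<Sum>a\<^sub>k b\<^sub>k\<close>, the matrices with these entries multiply like the elements of \<open>R\<close>.
\<close>

definition entry where "entry r i j = corner_pullback (b i \<otimes>\<^bsub>R\<^esub> r \<otimes>\<^bsub>R\<^esub> a j)"

lemma
  assumes "r \<in> carrier R" "i \<in> I" "j \<in> I"
  shows entry_closed: "entry r i j \<in> carrier S"
    and \<phi>_entry: "\<phi> (entry r i j) = b i \<otimes>\<^bsub>R\<^esub> r \<otimes>\<^bsub>R\<^esub> a j"
proof -
  have *: "b i \<otimes>\<^bsub>R\<^esub> r \<otimes>\<^bsub>R\<^esub> a j \<in> carrier R"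
    "b i \<otimes>\<^bsub>R\<^esub> r \<otimes>\<^bsub>R\<^esub> a j \<otimes>\<^bsub>R\<^esub> e = b i \<otimes>\<^bsub>R\<^esub> r \<otimes>\<^bsub>R\<^esub> a j"
    "e \<otimes>\<^bsub>R\<^esub> (b i \<otimes>\<^bsub>R\<^esub> r \<otimes>\<^bsub>R\<^esub> a j) = b i \<otimes>\<^bsub>R\<^esub> r \<otimes>\<^bsub>R\<^esub> a j"
    using assms by (auto simp: a_closed b_closed e_closed R.m_assoc a_corner)
      (metis R.m_assoc R.m_closed a_closed b_closed b_corner e_closed)
  show "entry r i j \<in> carrier S" "\<phi> (entry r i j) = b i \<otimes>\<^bsub>R\<^esub> r \<otimes>\<^bsub>R\<^esub> a j"
    unfolding entry_def using * by (auto intro: corner_pullback_closed \<phi>_corner_pullback)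
qed

lemma entry_add:
  assumes "r \<in> carrier R" "s \<in> carrier R" "i \<in> I" "j \<in> I"
  shows "entry (r \<oplus>\<^bsub>R\<^esub> s) i j = entry r i j \<oplus>\<^bsub>S\<^esub> entry s i j"
  using assms
  by (intro \<phi>_eqD) (auto simp: \<phi>_entry \<phi>_add entry_closed R.r_distr R.l_distr a_closed b_closed)

lemma entry_mult:
  assumes "r \<in> carrier R" "s \<in> carrier R" "i \<in> I" "j \<in> I"
  shows "entry (r \<otimes>\<^bsub>R\<^esub> s) i j = (\<Oplus>\<^bsub>S\<^esub>k\<in>I. entry r i k \<otimes>\<^bsub>S\<^esub> entry s k j)"
proof (rule \<phi>_eqD)
  have "\<phi> (\<Oplus>\<^bsub>S\<^esub>k\<in>I. entry r i k \<otimes>\<^bsub>S\<^esub> entry s k j)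
      = (\<Oplus>\<^bsub>R\<^esub>k\<in>I. (b i \<otimes>\<^bsub>R\<^esub> r \<otimes>\<^bsub>R\<^esub> a k) \<otimes>\<^bsub>R\<^esub> (b k \<otimes>\<^bsub>R\<^esub> (s \<otimes>\<^bsub>R\<^esub> a j)))"
    using assms
    by (subst \<phi>_finsum)
      (auto simp: entry_closed \<phi>_mult \<phi>_entry a_closed b_closed R.m_assoc intro!: R.finsum_cong')
  also have "\<dots> = \<phi> (entry (r \<otimes>\<^bsub>R\<^esub> s) i j)"
    using assms by (subst insert_unit) (auto simp: \<phi>_entry a_closed b_closed R.m_assoc)
  finally show "\<phi> (entry (r \<otimes>\<^bsub>R\<^esub> s) i j) = \<phi> (\<Oplus>\<^bsub>S\<^esub>k\<in>I. entry r i k \<otimes>\<^bsub>S\<^esub> entry s k j)" ..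
qed (use assms in \<open>auto intro!: entry_closed S.finsum_closed\<close>)

text \<open>
  The isomorphism sends \<open>n\<close> to the family \<open>(b\<^sub>i e) n\<close>; its inverse sends \<open>y\<close> to
  \<open>\<Sum>(e a\<^sub>i) y\<^sub>i\<close>. They are mutually inverse because \<open>\<Sum>e a\<^sub>i b\<^sub>i e = e\<close> and because
  \<open>b\<^sub>i e a\<^sub>j\<close> are the entries of the matrix of \<open>e\<close>, which fixes the corner of the new module.
  The bound on the carrier serves to embed it into the universe.
\<close>

lemma induced_module:
  fixes N :: "('s, 'n) module"
  assumes N: "left_module S N"
  shows "\<exists>X :: ('a, 'i \<Rightarrow> 'n) module. left_module R X \<and> carrier X \<subseteq> (\<Pi>\<^sub>E i\<in>I. UNIV)
           \<and> (\<exists>h. module_iso S N (corner_module X) h)"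
proof -
  interpret N: left_module S N by fact
  define act where "act = (\<lambda>r y. \<lambda>i\<in>I. \<Oplus>\<^bsub>N\<^esub>j\<in>I. entry r i j \<odot>\<^bsub>N\<^esub> y j)"
  define X :: "('a, 'i \<Rightarrow> 'n) module" where "X = \<lparr>carrier = {y \<in> (\<Pi>\<^sub>E i\<in>I. carrier N). act \<one>\<^bsub>R\<^esub> y = y},
       mult = undefined, one = undefined, zero = (\<lambda>i\<in>I. \<zero>\<^bsub>N\<^esub>),
       add = (\<lambda>y z. \<lambda>i\<in>I. y i \<oplus>\<^bsub>N\<^esub> z i), smult = act\<rparr>"
  note matrix = R.ring_axioms N fin entry_closed entry_add entry_mult
  have act_mult: "act (r \<otimes>\<^bsub>R\<^esub> s) y = act r (act s y)"
    if "r \<in> carrier R" "s \<in> carrier R" "y \<in> (\<Pi>\<^sub>E i\<in>I. carrier N)" for r s y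
    unfolding act_def using that by (intro matrix_act_mult[OF matrix])
  have X: "left_module R X"
    unfolding X_def act_def by (rule left_module_matrix_act[OF matrix])
  have be: "b i \<otimes>\<^bsub>R\<^esub> e \<in> carrier R" "e \<otimes>\<^bsub>R\<^esub> (b i \<otimes>\<^bsub>R\<^esub> e) = b i \<otimes>\<^bsub>R\<^esub> e" "b i \<otimes>\<^bsub>R\<^esub> e \<otimes>\<^bsub>R\<^esub> e = b i \<otimes>\<^bsub>R\<^esub> e"
    and ea: "e \<otimes>\<^bsub>R\<^esub> a i \<in> carrier R" "e \<otimes>\<^bsub>R\<^esub> (e \<otimes>\<^bsub>R\<^esub> a i) = e \<otimes>\<^bsub>R\<^esub> a i" "e \<otimes>\<^bsub>R\<^esub> a i \<otimes>\<^bsub>R\<^esub> e = e \<otimes>\<^bsub>R\<^esub> a i"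
    if "i \<in> I" for i
    using that by (simp_all add: a_closed b_closed e_closed R.m_assoc e_idem a_corner)
      (simp_all add: a_closed b_closed e_closed e_idem b_corner flip: R.m_assoc)
  \<comment> \<open>Elements of \<open>S\<close> standing for \<open>b\<^sub>i e\<close> and \<open>e a\<^sub>i\<close>.\<close>
  define \<beta> where "\<beta> i = corner_pullback (b i \<otimes>\<^bsub>R\<^esub> e)" for i
  define \<alpha> where "\<alpha> i = corner_pullback (e \<otimes>\<^bsub>R\<^esub> a i)" for i
  have \<beta>: "\<beta> i \<in> carrier S" "\<phi> (\<beta> i) = b i \<otimes>\<^bsub>R\<^esub> e" and \<alpha>: "\<alpha> i \<in> carrier S" "\<phi> (\<alpha> i) = e \<otimes>\<^bsub>R\<^esub> a i"
    if "i \<in> I" for i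
    unfolding \<alpha>_def \<beta>_def using be ea that by (auto intro: corner_pullback_closed \<phi>_corner_pullback)
  define up where "up n = (\<lambda>i\<in>I. \<beta> i \<odot>\<^bsub>N\<^esub> n)" for n
  define down where "down y = (\<Oplus>\<^bsub>N\<^esub>i\<in>I. \<alpha> i \<odot>\<^bsub>N\<^esub> y i)" for y
  have up_P: "up n \<in> (\<Pi>\<^sub>E i\<in>I. carrier N)" if "n \<in> carrier N" for n
    using that by (auto simp: up_def intro!: N.smult_closed \<beta>)
  have act_up: "act (\<phi> s) (up n) = up (s \<odot>\<^bsub>N\<^esub> n)" if s: "s \<in> carrier S" and n: "n \<in> carrier N" for s n
  proof -
    have "(\<Oplus>\<^bsub>N\<^esub>j\<in>I. entry (\<phi> s) i j \<odot>\<^bsub>N\<^esub> up n j) = \<beta> i \<odot>\<^bsub>N\<^esub> (s \<odot>\<^bsub>N\<^esub> n)" if i: "i \<in> I" for i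
    proof -
      have "(\<Oplus>\<^bsub>S\<^esub>j\<in>I. entry (\<phi> s) i j \<otimes>\<^bsub>S\<^esub> \<beta> j) = \<beta> i \<otimes>\<^bsub>S\<^esub> s"
      proof (rule \<phi>_eqD)
        have "\<phi> (\<Oplus>\<^bsub>S\<^esub>j\<in>I. entry (\<phi> s) i j \<otimes>\<^bsub>S\<^esub> \<beta> j)
            = (\<Oplus>\<^bsub>R\<^esub>j\<in>I. (b i \<otimes>\<^bsub>R\<^esub> \<phi> s \<otimes>\<^bsub>R\<^esub> a j) \<otimes>\<^bsub>R\<^esub> (b j \<otimes>\<^bsub>R\<^esub> e))"
          using i s by (subst \<phi>_finsum)
            (auto simp: entry_closed \<phi>_closed \<beta> \<phi>_mult \<phi>_entry a_closed b_closed be intro!: R.finsum_cong')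
        also have "\<dots> = \<phi> (\<beta> i \<otimes>\<^bsub>S\<^esub> s)"
          using i s by (subst insert_unit)
            (auto simp: \<phi>_mult \<beta> b_closed \<phi>_closed e_closed R.m_assoc e_\<phi> \<phi>_e)
        finally show "\<phi> (\<Oplus>\<^bsub>S\<^esub>j\<in>I. entry (\<phi> s) i j \<otimes>\<^bsub>S\<^esub> \<beta> j) = \<phi> (\<beta> i \<otimes>\<^bsub>S\<^esub> s)" .
      qed (use i s in \<open>auto intro!: S.finsum_closed entry_closed \<phi>_closed \<beta>\<close>)
      then have "\<beta> i \<odot>\<^bsub>N\<^esub> (s \<odot>\<^bsub>N\<^esub> n) = (\<Oplus>\<^bsub>S\<^esub>j\<in>I. entry (\<phi> s) i j \<otimes>\<^bsub>S\<^esub> \<beta> j) \<odot>\<^bsub>N\<^esub> n"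
        using i s n by (simp add: N.smult_assoc \<beta>)
      also have "\<dots> = (\<Oplus>\<^bsub>N\<^esub>j\<in>I. entry (\<phi> s) i j \<odot>\<^bsub>N\<^esub> up n j)"
        using i s n by (subst N.smult_finsum_left)
          (auto simp: up_def N.smult_assoc entry_closed \<beta> \<phi>_closed N.smult_closed intro!: N.finsum_cong')
      finally show ?thesis ..
    qed
    then show ?thesis unfolding act_def up_def[of "s \<odot>\<^bsub>N\<^esub> n"] by (intro restrict_ext) auto
  qed
  have up_corner: "up n \<in> carrier (corner_module X)" if n: "n \<in> carrier N" for n
  proof -
    have "act e (up n) = up n" using act_up[of "\<one>\<^bsub>S\<^esub>"] n by (simp add: N.smult_one)
    moreover from this have "act \<one>\<^bsub>R\<^esub> (up n) = up n"
      using act_mult[of "\<one>\<^bsub>R\<^esub>" e "up n"] up_P[OF n] by (simp add: e_closed)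
    ultimately show ?thesis using up_P[OF n] by (simp add: corner_module_simps X_def)
  qed
  have down_closed: "down y \<in> carrier N" if "y \<in> (\<Pi>\<^sub>E i\<in>I. carrier N)" for y
    using that unfolding down_def by (intro N.finsum_closed) (auto intro!: N.smult_closed \<alpha>)
  have down_up: "down (up n) = n" if n: "n \<in> carrier N" for n
  proof -
    have "(\<Oplus>\<^bsub>S\<^esub>i\<in>I. \<alpha> i \<otimes>\<^bsub>S\<^esub> \<beta> i) = \<one>\<^bsub>S\<^esub>"
    proof (rule \<phi>_eqD)
      have "\<phi> (\<Oplus>\<^bsub>S\<^esub>i\<in>I. \<alpha> i \<otimes>\<^bsub>S\<^esub> \<beta> i) = (\<Oplus>\<^bsub>R\<^esub>i\<in>I. (e \<otimes>\<^bsub>R\<^esub> a i) \<otimes>\<^bsub>R\<^esub> (b i \<otimes>\<^bsub>R\<^esub> e))"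
        by (subst \<phi>_finsum) (auto simp: \<alpha> \<beta> \<phi>_mult be ea intro!: R.finsum_cong')
      then show "\<phi> (\<Oplus>\<^bsub>S\<^esub>i\<in>I. \<alpha> i \<otimes>\<^bsub>S\<^esub> \<beta> i) = e" by (simp add: insert_unit e_closed e_idem)
    qed (auto intro!: S.finsum_closed \<alpha> \<beta>)
    then have "n = (\<Oplus>\<^bsub>S\<^esub>i\<in>I. \<alpha> i \<otimes>\<^bsub>S\<^esub> \<beta> i) \<odot>\<^bsub>N\<^esub> n" using n by (simp add: N.smult_one)
    also have "\<dots> = down (up n)"
      using n unfolding down_def by (subst N.smult_finsum_left)
        (auto simp: up_def N.smult_assoc \<alpha> \<beta> N.smult_closed intro!: N.finsum_cong')
    finally show ?thesis ..
  qed
  have up_down: "up (down y) = y" if y: "y \<in> carrier (corner_module X)" for y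
  proof -
    have yP: "y \<in> (\<Pi>\<^sub>E i\<in>I. carrier N)" and "act e y = y"
      using y by (auto simp: corner_module_simps X_def)
    have yc: "y i \<in> carrier N" if "i \<in> I" for i using yP that by auto
    have "up (down y) = act e y"
      unfolding up_def act_def
    proof (rule restrict_ext)
      fix i assume i: "i \<in> I"
      have "\<beta> i \<otimes>\<^bsub>S\<^esub> \<alpha> j = entry e i j" if "j \<in> I" for j
        using i that by (intro \<phi>_eqD)
          (auto simp: \<phi>_mult \<alpha> \<beta> \<phi>_entry entry_closed e_closed a_closed b_closed R.m_assoc,
           simp_all add: a_closed e_closed e_idem flip: R.m_assoc)
      then show "\<beta> i \<odot>\<^bsub>N\<^esub> down y = (\<Oplus>\<^bsub>N\<^esub>j\<in>I. entry e i j \<odot>\<^bsub>N\<^esub> y j)"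
        using i unfolding down_def
        by (subst N.smult_finsum_right)
          (auto simp: \<alpha> \<beta> yc N.smult_closed entry_closed e_closed simp flip: N.smult_assoc intro!: N.finsum_cong')
    qed
    then show ?thesis using \<open>act e y = y\<close> by simp
  qed
  have "module_iso S N (corner_module X) up"
    unfolding module_iso_def
  proof (intro conjI ballI)
    show "bij_betw up (carrier N) (carrier (corner_module X))"
      by (rule bij_betwI[where g = down])
        (use up_corner down_up up_down in \<open>auto simp: corner_module_simps(1) X_def intro: down_closed\<close>)
  next
    fix x y assume "x \<in> carrier N" "y \<in> carrier N"
    then show "up (x \<oplus>\<^bsub>N\<^esub> y) = up x \<oplus>\<^bsub>corner_module X\<^esub> up y"
      by (auto simp: corner_module_simps X_def up_def N.smult_r_distr \<beta> intro!: restrict_ext)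
  next
    fix s x assume "s \<in> carrier S" "x \<in> carrier N"
    then show "up (s \<odot>\<^bsub>N\<^esub> x) = s \<odot>\<^bsub>corner_module X\<^esub> up x"
      by (simp add: corner_module_simps X_def act_up)
  qed
  moreover have "carrier X \<subseteq> (\<Pi>\<^sub>E i\<in>I. UNIV)"
    by (auto simp: X_def)
  ultimately show ?thesis using X by blast
qed

text \<open>
  Taking corners is functorial also for isomorphisms between modules on different types, to which
  \<^const>\<open>corner_functor\<close> does not apply.
\<close>

lemma module_iso_corner:
  assumes M: "left_module R M" and h: "module_iso R M N h"
  shows "module_iso S (corner_module M) (corner_module N) h"
proof -
  interpret M: left_module R M by fact
  from h have bij: "bij_betw h (carrier M) (carrier N)"
    and sm: "\<And>r x. r \<in> carrier R \<Longrightarrow> x \<in> carrier M \<Longrightarrow> h (r \<odot>\<^bsub>M\<^esub> x) = r \<odot>\<^bsub>N\<^esub> h x"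
    by (auto simp: module_iso_def)
  have "e \<odot>\<^bsub>N\<^esub> h x = h x \<longleftrightarrow> e \<odot>\<^bsub>M\<^esub> x = x" if "x \<in> carrier M" for x
    using that bij by (auto simp: sm[symmetric] e_closed M.smult_closed bij_betw_def inj_on_eq_iff)
  then have "h ` carrier (corner_module M) = carrier (corner_module N)"
    using bij_betw_imp_surj_on[OF bij] by (force simp: corner_module_simps)
  moreover have "inj_on h (carrier (corner_module M))"
    using bij_betw_imp_inj_on[OF bij] by (rule inj_on_subset) (auto simp: corner_module_simps)
  ultimately have "bij_betw h (carrier (corner_module M)) (carrier (corner_module N))"
    by (simp add: bij_betw_def)
  then show ?thesis
    using h by (auto simp: module_iso_def corner_module_simps \<phi>_closed)
qed

lemma corner_functor_essentially_surjective:
  fixes N :: "('s, 'u) module"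
  assumes inf: "infinite (UNIV :: 'u set)" and N: "left_module S N"
  shows "\<exists>M :: ('a, 'u) module. left_module R M \<and> (\<exists>k. is_iso (left_module_cat U S) (corner_module M) N k)"
proof -
  obtain X :: "('a, 'i \<Rightarrow> 'u) module" and h where X: "left_module R X" "carrier X \<subseteq> (\<Pi>\<^sub>E i\<in>I. UNIV)"
    and h: "module_iso S N (corner_module X) h"
    using induced_module[OF N] by blast
  obtain c :: "('i \<Rightarrow> 'u) \<Rightarrow> 'u" where "inj_on c (\<Pi>\<^sub>E i\<in>I. UNIV)"
    using infinite_product_embedding[OF inf fin] by blast
  then obtain M where M: "left_module R M" and c: "module_iso R X M c"
    using module_iso_transport[OF X(1)] X(2) by (metis inj_on_subset)
  have "module_iso S N (corner_module M) (c \<circ> h)"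
    using N h module_iso_corner[OF X(1) c] by (rule module_iso_compose)
  then show ?thesis
    using M N left_module_corner_module[OF M] by (blast intro: module_iso_is_iso)
qed

text \<open>
  A ring is Morita equivalent to each of its full corners.
\<close>

theorem morita_equivalent_corner:
  assumes "infinite (UNIV :: 'u set)"
  shows "morita_equivalent TYPE('u) R S"
proof -
  have "equivalent_categories (left_module_cat TYPE('u) R) (left_module_cat TYPE('u) S)"
  proof (rule equivalent_categories_if_fully_faithful[OF is_category_left_module_cat
          is_category_left_module_cat is_functor_corner])
    fix M N :: "('a, 'u) module"
    assume "M \<in> Obj (left_module_cat TYPE('u) R)" "N \<in> Obj (left_module_cat TYPE('u) R)"
    then show "bij_betw (fmap corner_functor M N) (Hom (left_module_cat TYPE('u) R) M N)
        (Hom (left_module_cat TYPE('u) S) (fobj corner_functor M) (fobj corner_functor N))"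
      using corner_functor_fully_faithful by (simp add: left_module_cat_def corner_functor_def)
  next
    fix N :: "('s, 'u) module"
    assume "N \<in> Obj (left_module_cat TYPE('u) S)"
    then have "left_module S N" by (simp add: left_module_cat_def)
    then show "\<exists>M \<in> Obj (left_module_cat TYPE('u) R).
        \<exists>k. is_iso (left_module_cat TYPE('u) S) (fobj corner_functor M) N k"
      using corner_functor_essentially_surjective[OF assms, of N "TYPE('u)"]
      by (simp add: left_module_cat_def[of _ R] corner_functor_def)
  qed
  then show ?thesis
    unfolding morita_equivalent_def by (simp add: R.ring_axioms S.ring_axioms)
qed

end

section \<open>The free algebra and its matrix representations\<close>

lemma poly_mapping_expansion:
  "p = (\<Sum>w\<in>Poly_Mapping.keys p. Poly_Mapping.single w (Poly_Mapping.lookup p w))"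
proof (rule poly_mapping_eqI)
  fix w
  show "Poly_Mapping.lookup p w =
    Poly_Mapping.lookup (\<Sum>w\<in>Poly_Mapping.keys p. Poly_Mapping.single w (Poly_Mapping.lookup p w)) w"
    by (simp add: lookup_sum lookup_single when_def in_keys_iff cong: if_cong)
qed

lemma poly_mapping_additive_induct [case_names zero single add]:
  fixes p :: "'x \<Rightarrow>\<^sub>0 'k::comm_monoid_add"
  assumes "P 0" "\<And>w c. P (Poly_Mapping.single w c)" "\<And>p q. \<lbrakk>P p; P q\<rbrakk> \<Longrightarrow> P (p + q)"
  shows "P p"
proof -
  have "P (\<Sum>w\<in>W. Poly_Mapping.single w (f w))" if "finite W" for W f
    using that by (induction W) (auto intro: assms)
  then show ?thesis by (subst poly_mapping_expansion) simp
qed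

lemma scalar_commute:
  fixes p :: "'x::monoid_add \<Rightarrow>\<^sub>0 'k::comm_ring_1"
  shows "Poly_Mapping.single 0 c * p = p * Poly_Mapping.single 0 c"
  by (induction p rule: poly_mapping_additive_induct)
    (simp_all add: mult_single algebra_simps)

lemma scalar_left_commute:
  fixes p q :: "'x::monoid_add \<Rightarrow>\<^sub>0 'k::comm_ring_1"
  shows "p * (Poly_Mapping.single 0 c * q) = Poly_Mapping.single 0 c * (p * q)"
  unfolding mult.assoc[symmetric] scalar_commute[of c p] ..

lemma scalar_mult_mult:
  fixes p q :: "'x::monoid_add \<Rightarrow>\<^sub>0 'k::comm_ring_1"
  shows "(Poly_Mapping.single 0 c * p) * (Poly_Mapping.single 0 d * q) =
     Poly_Mapping.single 0 (c * d) * (p * q)"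
  unfolding mult.assoc scalar_left_commute[of p] by (simp add: mult_single flip: mult.assoc)

lemma scalar_uminus:
  fixes p :: "'x::monoid_add \<Rightarrow>\<^sub>0 'k::comm_ring_1"
  shows "- p = Poly_Mapping.single 0 (- 1) * p"
  by (simp add: single_uminus)

text \<open>
  A word acts by the product of the matrices \<open>\<rho> x\<close> of its letters. Matrices are functions of two
  indices, of which only the values on the finite set \<open>I\<close> matter.
\<close>

primrec word_matrix :: "'i set \<Rightarrow> ('x \<Rightarrow> 'i \<Rightarrow> 'i \<Rightarrow> 'a) \<Rightarrow> 'x list \<Rightarrow> 'i \<Rightarrow> 'i \<Rightarrow> 'a::ring_1" where
  "word_matrix I \<rho> [] = (\<lambda>i j. if i = j then 1 else 0)"
| "word_matrix I \<rho> (x # xs) = (\<lambda>i j. \<Sum>k\<in>I. \<rho> x i k * word_matrix I \<rho> xs k j)"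

lemma word_matrix_append:
  assumes "finite I" "i \<in> I"
  shows "word_matrix I \<rho> (xs @ ys) i j = (\<Sum>k\<in>I. word_matrix I \<rho> xs i k * word_matrix I \<rho> ys k j)"
  using assms(2)
proof (induction xs arbitrary: i)
  case Nil
  then show ?case using assms(1) by (simp add: if_distrib[of "\<lambda>z. z * _"] cong: if_cong)
next
  case (Cons x xs)
  have "word_matrix I \<rho> ((x # xs) @ ys) i j
      = (\<Sum>l\<in>I. \<Sum>k\<in>I. \<rho> x i l * word_matrix I \<rho> xs l k * word_matrix I \<rho> ys k j)"
    by (simp add: Cons.IH sum_distrib_left mult.assoc)
  also have "\<dots> = (\<Sum>k\<in>I. word_matrix I \<rho> (x # xs) i k * word_matrix I \<rho> ys k j)"
    by (subst sum.swap) (simp add: sum_distrib_right)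
  finally show ?case .
qed

text \<open>
  The linear extension of \<^const>\<open>word_matrix\<close>: the homomorphism from the free algebra to matrices
  given by its universal property. Algebra homomorphisms are the case of a one-element \<open>I\<close>.
\<close>

definition matrix_extension ::
  "'i set \<Rightarrow> ('x \<Rightarrow> 'i \<Rightarrow> 'i \<Rightarrow> ('y word \<Rightarrow>\<^sub>0 'k)) \<Rightarrow> ('x word \<Rightarrow>\<^sub>0 'k::field) \<Rightarrow> 'i \<Rightarrow> 'i \<Rightarrow> ('y word \<Rightarrow>\<^sub>0 'k)"
where
  "matrix_extension I \<rho> p i j =
     (\<Sum>w\<in>Poly_Mapping.keys p. Poly_Mapping.single 0 (Poly_Mapping.lookup p w) * word_matrix I \<rho> (letters w) i j)"

lemma matrix_extension_superset:
  assumes "finite W" "Poly_Mapping.keys p \<subseteq> W"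
  shows "matrix_extension I \<rho> p i j =
     (\<Sum>w\<in>W. Poly_Mapping.single 0 (Poly_Mapping.lookup p w) * word_matrix I \<rho> (letters w) i j)"
  unfolding matrix_extension_def using assms by (intro sum.mono_neutral_left) (auto simp: in_keys_iff)

lemma matrix_extension_zero [simp]: "matrix_extension I \<rho> 0 i j = 0"
  by (simp add: matrix_extension_def)

lemma matrix_extension_add: "matrix_extension I \<rho> (p + q) i j = matrix_extension I \<rho> p i j + matrix_extension I \<rho> q i j"
proof -
  let ?W = "Poly_Mapping.keys p \<union> Poly_Mapping.keys q"
  have "Poly_Mapping.keys (p + q) \<subseteq> ?W" by (rule Poly_Mapping.keys_add)
  then show ?thesis
    by (simp add: matrix_extension_superset[where W = ?W] lookup_add single_add distrib_right sum.distrib)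
qed

lemma matrix_extension_uminus: "matrix_extension I \<rho> (- p) i j = - matrix_extension I \<rho> p i j"
  by (metis add.right_inverse matrix_extension_add matrix_extension_zero minus_unique)

lemma matrix_extension_diff: "matrix_extension I \<rho> (p - q) i j = matrix_extension I \<rho> p i j - matrix_extension I \<rho> q i j"
  by (metis diff_conv_add_uminus matrix_extension_add matrix_extension_uminus)

lemma matrix_extension_sum: "matrix_extension I \<rho> (\<Sum>x\<in>A. f x) i j = (\<Sum>x\<in>A. matrix_extension I \<rho> (f x) i j)"
  by (induction A rule: infinite_finite_induct) (simp_all add: matrix_extension_add)

lemma matrix_extension_single:
  "matrix_extension I \<rho> (Poly_Mapping.single w c) i j = Poly_Mapping.single 0 c * word_matrix I \<rho> (letters w) i j"
  by (subst matrix_extension_superset[where W = "{w}"]) auto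

lemma matrix_extension_mult:
  assumes "finite I" "i \<in> I"
  shows "matrix_extension I \<rho> (p * q) i j = (\<Sum>k\<in>I. matrix_extension I \<rho> p i k * matrix_extension I \<rho> q k j)"
proof (induction p rule: poly_mapping_additive_induct)
  case (single w c)
  show ?case
  proof (induction q rule: poly_mapping_additive_induct)
    case (single u d)
    show ?case using assms
      by (simp add: mult_single matrix_extension_single plus_word_def word_matrix_append scalar_mult_mult
          sum_distrib_left)
  qed (simp_all add: distrib_left matrix_extension_add sum.distrib)
qed (simp_all add: distrib_right matrix_extension_add sum.distrib)

lemma matrix_extension_scale:
  assumes "finite I" "i \<in> I"
  shows "matrix_extension I \<rho> (Poly_Mapping.single 0 c * p) i j = Poly_Mapping.single 0 c * matrix_extension I \<rho> p i j"
  using assms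
  by (simp add: matrix_extension_mult matrix_extension_single zero_word_def if_distrib[of "\<lambda>z. _ * z"]
      if_distrib[of "\<lambda>z. z * _"] cong: if_cong)

lemma matrix_extension_var:
  assumes "finite I" "j \<in> I"
  shows "matrix_extension I \<rho> (var x) i j = \<rho> x i j"
  using assms by (simp add: var_def matrix_extension_single if_distrib[of "\<lambda>z. _ * z"] cong: if_cong)

section \<open>The ideal of relations\<close>

lemma free_carrier_zero: "0 \<in> free_carrier E"
  by (simp add: free_carrier_def)

lemma free_carrier_add: "\<lbrakk>p \<in> free_carrier E; q \<in> free_carrier E\<rbrakk> \<Longrightarrow> p + q \<in> free_carrier E"
  using Poly_Mapping.keys_add[of p q] by (auto simp: free_carrier_def)

lemma free_carrier_mult: "\<lbrakk>p \<in> free_carrier E; q \<in> free_carrier E\<rbrakk> \<Longrightarrow> p * q \<in> free_carrier E"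
  using keys_mult[of p q] by (fastforce simp: free_carrier_def plus_word_def)

lemma free_carrier_scale: "p \<in> free_carrier E \<Longrightarrow> Poly_Mapping.single 0 c * p \<in> free_carrier E"
  using keys_mult[of "Poly_Mapping.single 0 c" p]
  by (fastforce simp: free_carrier_def split: if_splits)

lemma free_carrier_uminus: "p \<in> free_carrier E \<Longrightarrow> - p \<in> free_carrier E"
  by (subst scalar_uminus) (rule free_carrier_scale)

lemma free_carrier_diff: "\<lbrakk>p \<in> free_carrier E; q \<in> free_carrier E\<rbrakk> \<Longrightarrow> p - q \<in> free_carrier E"
  using free_carrier_add[of p E "- q"] free_carrier_uminus[of q E] by simp

lemma free_carrier_sum: "(\<And>x. x \<in> A \<Longrightarrow> f x \<in> free_carrier E) \<Longrightarrow> (\<Sum>x\<in>A. f x) \<in> free_carrier E"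
  by (induction A rule: infinite_finite_induct) (simp_all add: free_carrier_add free_carrier_zero)

lemma free_carrier_var: "x \<in> gens E \<Longrightarrow> var x \<in> free_carrier E"
  by (simp add: free_carrier_def var_def)

lemmas free_carrier_intros = free_carrier_zero free_carrier_add free_carrier_mult free_carrier_diff
  free_carrier_sum free_carrier_var

lemma free_carrier_induct [consumes 1, case_names zero var mult scale add]:
  fixes p :: "('k::field, 'v, 'e) free_elem"
  assumes p: "p \<in> free_carrier E"
    and zero: "P 0"
    and var: "\<And>x. x \<in> gens E \<Longrightarrow> P (var x)"
    and mult: "\<And>p q. \<lbrakk>p \<in> free_carrier E; q \<in> free_carrier E; P p; P q\<rbrakk> \<Longrightarrow> P (p * q)"
    and scale: "\<And>c p. \<lbrakk>p \<in> free_carrier E; P p\<rbrakk> \<Longrightarrow> P (Poly_Mapping.single 0 c * p)"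
    and add: "\<And>p q. \<lbrakk>p \<in> free_carrier E; q \<in> free_carrier E; P p; P q\<rbrakk> \<Longrightarrow> P (p + q)"
  shows "P p"
proof -
  have word: "P (Poly_Mapping.single (Word xs) (1 :: 'k)) \<and> Poly_Mapping.single (Word xs) (1 :: 'k) \<in> free_carrier E"
    if "xs \<noteq> []" "set xs \<subseteq> gens E" for xs
    using that
  proof (induction xs rule: list_nonempty_induct)
    case (single x)
    then show ?case using var[of x] free_carrier_var[of x E] by (simp add: var_def)
  next
    case (cons x xs)
    have eq: "Poly_Mapping.single (Word (x # xs)) (1 :: 'k) = var x * Poly_Mapping.single (Word xs) 1"
      by (simp add: var_def mult_single plus_word_def)
    show ?case
      unfolding eq using cons by (auto intro!: mult var free_carrier_var free_carrier_mult)
  qed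
  have "P (\<Sum>w\<in>W. Poly_Mapping.single w (f w)) \<and> (\<Sum>w\<in>W. Poly_Mapping.single w (f w)) \<in> free_carrier E"
    if "finite W" "\<And>w. w \<in> W \<Longrightarrow> letters w \<noteq> [] \<and> set (letters w) \<subseteq> gens E" for W f
    using that
  proof (induction W)
    case (insert w W)
    have eq: "Poly_Mapping.single w (f w) = Poly_Mapping.single 0 (f w) * Poly_Mapping.single (Word (letters w)) 1"
      by (simp add: mult_single)
    show ?case
      using insert word[of "letters w"]
      by (auto simp: eq intro!: add scale free_carrier_add free_carrier_scale)
  qed (simp add: zero free_carrier_zero)
  then show ?thesis
    using p by (subst poly_mapping_expansion) (simp add: free_carrier_def)
qed

text \<open>
  Equality in the Leavitt path algebra, expressed for representatives. Calculations are done with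
  polynomials, which form a type with ring operations, instead of with cosets.
\<close>

definition leavitt_cong ::
  "('v, 'e) pre_digraph \<Rightarrow> ('k::field, 'v, 'e) free_elem \<Rightarrow> ('k, 'v, 'e) free_elem \<Rightarrow> bool" where
  "leavitt_cong E p q \<longleftrightarrow> p - q \<in> leavitt_ideal E"

lemma leavitt_ideal_uminus: "p \<in> leavitt_ideal E \<Longrightarrow> - p \<in> leavitt_ideal E"
  by (subst scalar_uminus) (rule leavitt_ideal.scale)

lemma leavitt_ideal_sum: "(\<And>x. x \<in> A \<Longrightarrow> f x \<in> leavitt_ideal E) \<Longrightarrow> (\<Sum>x\<in>A. f x) \<in> leavitt_ideal E"
  by (induction A rule: infinite_finite_induct) (simp_all add: leavitt_ideal.add leavitt_ideal.zero)

lemma leavitt_cong_refl [simp]: "leavitt_cong E p p"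
  by (simp add: leavitt_cong_def leavitt_ideal.zero)

lemma leavitt_cong_sym: "leavitt_cong E p q \<Longrightarrow> leavitt_cong E q p"
  using leavitt_ideal_uminus[of "p - q" E] by (simp add: leavitt_cong_def)

lemma leavitt_cong_trans [trans]: "\<lbrakk>leavitt_cong E p q; leavitt_cong E q r\<rbrakk> \<Longrightarrow> leavitt_cong E p r"
  using leavitt_ideal.add[of "p - q" E "q - r"] by (simp add: leavitt_cong_def)

lemma leavitt_cong_add:
  "\<lbrakk>leavitt_cong E p p'; leavitt_cong E q q'\<rbrakk> \<Longrightarrow> leavitt_cong E (p + q) (p' + q')"
  using leavitt_ideal.add[of "p - p'" E "q - q'"] by (simp add: leavitt_cong_def algebra_simps)

lemma leavitt_cong_scale:
  "leavitt_cong E p q \<Longrightarrow> leavitt_cong E (Poly_Mapping.single 0 c * p) (Poly_Mapping.single 0 c * q)"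
  using leavitt_ideal.scale[of "p - q" E c] by (simp add: leavitt_cong_def algebra_simps)

lemma leavitt_cong_sum:
  "(\<And>x. x \<in> A \<Longrightarrow> leavitt_cong E (f x) (g x)) \<Longrightarrow> leavitt_cong E (\<Sum>x\<in>A. f x) (\<Sum>x\<in>A. g x)"
  by (simp add: leavitt_cong_def leavitt_ideal_sum flip: sum_subtractf)

text \<open>
  \<open>p q - p' q' = (p - p') q + p' (q - q')\<close>; the membership conditions are there because the ideal
  is closed only under multiplication by scalars and by polynomials in nonempty words.
\<close>

lemma leavitt_cong_mult:
  assumes "leavitt_cong E p p'" "leavitt_cong E q q'" "p' \<in> free_carrier E" "q \<in> free_carrier E"
  shows "leavitt_cong E (p * q) (p' * q')"
proof -
  have "p * q - p' * q' = (p - p') * q + p' * (q - q')" by (simp add: algebra_simps)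
  then show ?thesis
    using assms unfolding leavitt_cong_def
    by (auto intro: leavitt_ideal.add leavitt_ideal.left leavitt_ideal.right)
qed

lemma leavitt_cong_0_iff: "leavitt_cong E p 0 \<longleftrightarrow> p \<in> leavitt_ideal E"
  by (simp add: leavitt_cong_def)

lemma matrix_extension_free_carrier:
  assumes I: "finite I"
    and \<rho>: "\<And>x i j. \<lbrakk>x \<in> gens E; i \<in> I; j \<in> I\<rbrakk> \<Longrightarrow> \<rho> x i j \<in> free_carrier G"
    and "p \<in> free_carrier E" "i \<in> I" "j \<in> I"
  shows "matrix_extension I \<rho> p i j \<in> free_carrier G"
  using assms(3-)
proof (induction p arbitrary: i j rule: free_carrier_induct)
  case (scale c p)
  then show ?case by (simp only: matrix_extension_scale[OF I]) (simp add: free_carrier_scale)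
qed (auto simp: matrix_extension_var matrix_extension_mult matrix_extension_add I \<rho> intro!: free_carrier_intros)

text \<open>
  The universal property of the Leavitt path algebra for maps into matrices: the ideal goes to the
  ideal as soon as the defining relations do.
\<close>

lemma matrix_extension_leavitt_ideal:
  assumes I: "finite I"
    and \<rho>: "\<And>x i j. \<lbrakk>x \<in> gens E; i \<in> I; j \<in> I\<rbrakk> \<Longrightarrow> \<rho> x i j \<in> free_carrier G"
    and relators: "\<And>p i j. \<lbrakk>p \<in> leavitt_relators E; i \<in> I; j \<in> I\<rbrakk> \<Longrightarrow> matrix_extension I \<rho> p i j \<in> leavitt_ideal G"
    and "p \<in> leavitt_ideal E" "i \<in> I" "j \<in> I"
  shows "matrix_extension I \<rho> p i j \<in> leavitt_ideal G"
  using assms(4-)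
proof (induction p arbitrary: i j rule: leavitt_ideal.induct)
  case (scale p c)
  then show ?case by (simp only: matrix_extension_scale[OF I]) (simp add: leavitt_ideal.scale)
qed (auto simp: matrix_extension_mult matrix_extension_add I relators leavitt_ideal.zero leavitt_ideal.add
       intro!: leavitt_ideal_sum intro: leavitt_ideal.left leavitt_ideal.right matrix_extension_free_carrier[OF I \<rho>])

section \<open>Leavitt path algebras of finite graphs as rings\<close>

text \<open>
  The free algebra has no identity, so the quotient is shown to be a ring by hand; its identity is
  the class of the sum of all vertices.
\<close>

locale leavitt_algebra = fin_digraph E
  for K :: "'k::field itself" and E :: "('v, 'e) pre_digraph"
begin

abbreviation L :: "('k, 'v, 'e) free_elem set ring" where
  "L \<equiv> leavitt_path_algebra K E"

definition cls :: "('k, 'v, 'e) free_elem \<Rightarrow> ('k, 'v, 'e) free_elem set" where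
  "cls p = leavitt_ideal E +>\<^bsub>free_algebra E\<^esub> p"

definition vsum :: "'v set \<Rightarrow> ('k, 'v, 'e) free_elem" where
  "vsum W = (\<Sum>w\<in>W. var (Vertex w))"

abbreviation "FC \<equiv> (free_carrier E :: ('k, 'v, 'e) free_elem set)"

lemma gens_simps [simp]:
  "Vertex w \<in> gens E \<longleftrightarrow> w \<in> verts E" "Edge e \<in> gens E \<longleftrightarrow> e \<in> arcs E" "Ghost e \<in> gens E \<longleftrightarrow> e \<in> arcs E"
  by (auto simp: gens_def)

lemma relators_subset: "leavitt_relators E \<subseteq> FC"
proof
  fix p :: "('k, 'v, 'e) free_elem" assume "p \<in> leavitt_relators E"
  then show "p \<in> free_carrier E"
    by cases (auto intro!: free_carrier_intros simp: regular_vertex_def)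
qed

lemma leavitt_ideal_subset: "p \<in> leavitt_ideal E \<Longrightarrow> p \<in> FC"
  by (induction rule: leavitt_ideal.induct)
    (use relators_subset in \<open>auto intro: free_carrier_intros free_carrier_scale\<close>)

lemma cls_altdef: "cls p = {q. leavitt_cong E q p}"
proof -
  have "q = (q - p) + p" for q :: "('k, 'v, 'e) free_elem" by simp
  then show ?thesis
    by (auto simp: cls_def a_r_coset_def' free_algebra_def leavitt_cong_def)
qed

lemma cls_eq_iff: "cls p = cls q \<longleftrightarrow> leavitt_cong E p q"
  unfolding cls_altdef by (auto intro: leavitt_cong_trans leavitt_cong_sym)

lemma carrier_L: "carrier L = cls ` FC"
  by (auto simp: leavitt_path_algebra_def FactRing_def A_RCOSETS_def' cls_def free_algebra_def)

lemma cls_closed [simp]: "p \<in> FC \<Longrightarrow> cls p \<in> carrier L"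
  by (simp add: carrier_L)

lemma cong_closed: "leavitt_cong E q p \<Longrightarrow> p \<in> FC \<Longrightarrow> q \<in> FC"
  using free_carrier_add[of "q - p" E p] leavitt_ideal_subset[of "q - p"]
  by (simp add: leavitt_cong_def)

lemma cls_mult: "p \<in> FC \<Longrightarrow> q \<in> FC \<Longrightarrow> cls (p * q) = cls p \<otimes>\<^bsub>L\<^esub> cls q"
proof -
  assume p: "p \<in> FC" and q: "q \<in> FC"
  have "cls p \<otimes>\<^bsub>L\<^esub> cls q = (\<Union>x\<in>cls p. \<Union>y\<in>cls q. cls (x * y))"
    by (simp add: leavitt_path_algebra_def FactRing_def rcoset_mult_def cls_def[symmetric])
      (simp add: cls_def free_algebra_def)
  moreover have "cls (x * y) = cls (p * q)" if "x \<in> cls p" "y \<in> cls q" for x y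
    using that p q cong_closed unfolding cls_eq_iff
    by (auto simp: cls_altdef intro!: leavitt_cong_mult)
  moreover have "p \<in> cls p" "q \<in> cls q" by (simp_all add: cls_altdef)
  ultimately show ?thesis by blast
qed

lemma cls_add: "cls (p + q) = cls p \<oplus>\<^bsub>L\<^esub> cls q"
proof -
  have "cls p \<oplus>\<^bsub>L\<^esub> cls q = {x + y |x y. x \<in> cls p \<and> y \<in> cls q}"
    by (auto simp: leavitt_path_algebra_def FactRing_def set_add_def' free_algebra_def)
  also have "\<dots> = cls (p + q)"
  proof -
    have "\<exists>x y. z = x + y \<and> leavitt_cong E x p \<and> leavitt_cong E y q" if "leavitt_cong E z (p + q)" for z
      using that by (intro exI[of _ "z - q"] exI[of _ q]) (simp add: leavitt_cong_def algebra_simps)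
    then show ?thesis by (auto simp: cls_altdef intro: leavitt_cong_add)
  qed
  finally show ?thesis ..
qed

lemma cls_zero: "\<zero>\<^bsub>L\<^esub> = cls 0"
  by (simp add: leavitt_path_algebra_def FactRing_def cls_altdef leavitt_cong_0_iff)

lemma cls_one: "\<one>\<^bsub>L\<^esub> = cls (vsum (verts E))"
  by (simp add: leavitt_path_algebra_def cls_def vsum_def)

lemma vsum_closed: "W \<subseteq> verts E \<Longrightarrow> vsum W \<in> FC"
  by (auto simp: vsum_def intro!: free_carrier_intros)

lemma cong_relator: "p - q \<in> leavitt_relators E \<Longrightarrow> leavitt_cong E p q"
  by (simp add: leavitt_cong_def leavitt_ideal.relator)

text \<open>
  A sum of distinct vertices acts on a generator as the identity or as zero, according to whether
  the relevant endpoint is among the summands. For the set of all vertices this gives the identity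
  of the ring, for the vertices of the collapse the idempotent of the corner.
\<close>

lemma vsum_vertex:
  assumes W: "W \<subseteq> verts E" and w: "w \<in> verts E"
  shows "leavitt_cong E (vsum W * var (Vertex w)) (if w \<in> W then var (Vertex w) else 0)"
    and "leavitt_cong E (var (Vertex w) * vsum W) (if w \<in> W then var (Vertex w) else 0)"
proof -
  have fin: "finite W" using W by (rule finite_subset) auto
  have "leavitt_cong E (vsum W * var (Vertex w)) (\<Sum>u\<in>W. if u = w then var (Vertex w) else 0)"
    unfolding vsum_def sum_distrib_right using W w
    by (intro leavitt_cong_sum cong_relator leavitt_relators.vertices) auto
  then show "leavitt_cong E (vsum W * var (Vertex w)) (if w \<in> W then var (Vertex w) else 0)"
    using fin by simp
  have "leavitt_cong E (var (Vertex w) * vsum W) (\<Sum>u\<in>W. if w = u then var (Vertex u) else 0)"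
    unfolding vsum_def sum_distrib_left using W w
    by (intro leavitt_cong_sum cong_relator leavitt_relators.vertices) auto
  then show "leavitt_cong E (var (Vertex w) * vsum W) (if w \<in> W then var (Vertex w) else 0)"
    using fin by simp
qed

lemma vsum_left:
  assumes W: "W \<subseteq> verts E" and w: "w \<in> verts E" and p: "p \<in> FC"
    and wp: "leavitt_cong E (var (Vertex w) * p) p"
  shows "leavitt_cong E (vsum W * p) (if w \<in> W then p else 0)"
proof -
  have "leavitt_cong E (vsum W * p) (vsum W * (var (Vertex w) * p))"
    using W w p by (intro leavitt_cong_mult leavitt_cong_sym[OF wp]) (auto intro: vsum_closed)
  also have "leavitt_cong E \<dots> ((if w \<in> W then var (Vertex w) else 0) * p)"
    unfolding mult.assoc[symmetric] using W w p
    by (intro leavitt_cong_mult vsum_vertex) (auto intro!: free_carrier_intros)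
  also have "leavitt_cong E \<dots> (if w \<in> W then p else 0)"
    using wp by simp
  finally show ?thesis .
qed

lemma vsum_right:
  assumes W: "W \<subseteq> verts E" and w: "w \<in> verts E" and p: "p \<in> FC"
    and pw: "leavitt_cong E (p * var (Vertex w)) p"
  shows "leavitt_cong E (p * vsum W) (if w \<in> W then p else 0)"
proof -
  have "leavitt_cong E (p * vsum W) (p * var (Vertex w) * vsum W)"
    using W w p by (intro leavitt_cong_mult leavitt_cong_sym[OF pw])
      (auto intro!: vsum_closed free_carrier_mult free_carrier_var)
  also have "leavitt_cong E \<dots> (p * (if w \<in> W then var (Vertex w) else 0))"
    unfolding mult.assoc using W w p
    by (intro leavitt_cong_mult vsum_vertex) (auto intro!: free_carrier_intros vsum_closed)
  also have "leavitt_cong E \<dots> (if w \<in> W then p else 0)"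
    using pw by simp
  finally show ?thesis .
qed

lemma edge_vertices:
  assumes e: "e \<in> arcs E"
  shows "leavitt_cong E (var (Vertex (tail E e)) * var (Edge e)) (var (Edge e))"
    "leavitt_cong E (var (Edge e) * var (Vertex (head E e))) (var (Edge e))"
    "leavitt_cong E (var (Vertex (head E e)) * var (Ghost e)) (var (Ghost e))"
    "leavitt_cong E (var (Ghost e) * var (Vertex (tail E e))) (var (Ghost e))"
  by (rule cong_relator[OF leavitt_relators.source_edge[OF e]]
      cong_relator[OF leavitt_relators.edge_range[OF e]]
      cong_relator[OF leavitt_relators.range_ghost[OF e]]
      cong_relator[OF leavitt_relators.ghost_source[OF e]])+

lemma vsum_edge:
  assumes W: "W \<subseteq> verts E" and e: "e \<in> arcs E"
  shows "leavitt_cong E (vsum W * var (Edge e)) (if tail E e \<in> W then var (Edge e) else 0)"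
    and "leavitt_cong E (var (Edge e) * vsum W) (if head E e \<in> W then var (Edge e) else 0)"
    and "leavitt_cong E (vsum W * var (Ghost e)) (if head E e \<in> W then var (Ghost e) else 0)"
    and "leavitt_cong E (var (Ghost e) * vsum W) (if tail E e \<in> W then var (Ghost e) else 0)"
  using e
  by (simp_all only: vsum_left[OF W _ _ edge_vertices(1)[OF e]] vsum_right[OF W _ _ edge_vertices(2)[OF e]]
      vsum_left[OF W _ _ edge_vertices(3)[OF e]] vsum_right[OF W _ _ edge_vertices(4)[OF e]]
      free_carrier_var gens_simps tail_in_verts head_in_verts)

lemma vsum_verts_unit:
  assumes "p \<in> FC"
  shows "leavitt_cong E (vsum (verts E) * p) p \<and> leavitt_cong E (p * vsum (verts E)) p"
  using assms
proof (induction p rule: free_carrier_induct)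
  case (var x)
  then show ?case
  proof (cases x)
    case (Vertex w)
    then show ?thesis using var vsum_vertex[OF order_refl, of w] by simp
  next
    case (Edge e)
    then show ?thesis using var vsum_edge(1,2)[OF order_refl, of e] by simp
  next
    case (Ghost e)
    then show ?thesis using var vsum_edge(3,4)[OF order_refl, of e] by simp
  qed
next
  case (mult p q)
  have "leavitt_cong E (vsum (verts E) * p * q) (p * q)" "leavitt_cong E (p * (q * vsum (verts E))) (p * q)"
    using mult by (simp_all add: leavitt_cong_mult free_carrier_mult vsum_closed)
  then show ?case by (simp add: mult.assoc)
next
  case (scale c p)
  have "leavitt_cong E (Poly_Mapping.single 0 c * (vsum (verts E) * p)) (Poly_Mapping.single 0 c * p)"
    "leavitt_cong E (Poly_Mapping.single 0 c * (p * vsum (verts E))) (Poly_Mapping.single 0 c * p)"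
    using scale by (simp_all add: leavitt_cong_scale)
  then show ?case by (simp add: mult.assoc scalar_left_commute)
next
  case (add p q)
  then show ?case by (simp add: distrib_left distrib_right leavitt_cong_add)
qed simp

lemma ring_L: "ring L"
proof (rule ringI)
  show "abelian_group L"
  proof (rule abelian_groupI)
    fix X assume "X \<in> carrier L"
    then obtain p where p: "p \<in> FC" "X = cls p" by (auto simp: carrier_L)
    then have "cls (- p) \<oplus>\<^bsub>L\<^esub> X = \<zero>\<^bsub>L\<^esub>" by (simp add: cls_zero flip: cls_add)
    then show "\<exists>Y \<in> carrier L. Y \<oplus>\<^bsub>L\<^esub> X = \<zero>\<^bsub>L\<^esub>"
      using p by (intro bexI[of _ "cls (- p)"]) (simp_all add: free_carrier_uminus)
    show "\<zero>\<^bsub>L\<^esub> \<oplus>\<^bsub>L\<^esub> X = X" using p by (simp add: cls_zero flip: cls_add)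
  next
    fix X Y assume "X \<in> carrier L" "Y \<in> carrier L"
    then obtain p q where "p \<in> FC" "X = cls p" "q \<in> FC" "Y = cls q" by (auto simp: carrier_L)
    then show "X \<oplus>\<^bsub>L\<^esub> Y \<in> carrier L" "X \<oplus>\<^bsub>L\<^esub> Y = Y \<oplus>\<^bsub>L\<^esub> X"
      by (simp_all add: free_carrier_add add.commute flip: cls_add)
  next
    fix X Y Z assume "X \<in> carrier L" "Y \<in> carrier L" "Z \<in> carrier L"
    then obtain p q r where "X = cls p" "Y = cls q" "Z = cls r" by (auto simp: carrier_L)
    then show "X \<oplus>\<^bsub>L\<^esub> Y \<oplus>\<^bsub>L\<^esub> Z = X \<oplus>\<^bsub>L\<^esub> (Y \<oplus>\<^bsub>L\<^esub> Z)"
      by (simp add: add.assoc flip: cls_add)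
  qed (simp add: cls_zero free_carrier_zero)
  have one: "vsum (verts E) \<in> FC" by (simp add: vsum_closed)
  show "Group.monoid L"
  proof (rule monoidI)
    fix X assume "X \<in> carrier L"
    then obtain p where "p \<in> FC" "X = cls p" by (auto simp: carrier_L)
    then show "\<one>\<^bsub>L\<^esub> \<otimes>\<^bsub>L\<^esub> X = X" "X \<otimes>\<^bsub>L\<^esub> \<one>\<^bsub>L\<^esub> = X"
      using one vsum_verts_unit[of p] by (simp_all add: cls_one cls_eq_iff flip: cls_mult)
  next
    fix X Y assume "X \<in> carrier L" "Y \<in> carrier L"
    then obtain p q where "p \<in> FC" "X = cls p" "q \<in> FC" "Y = cls q" by (auto simp: carrier_L)
    then show "X \<otimes>\<^bsub>L\<^esub> Y \<in> carrier L" by (simp add: free_carrier_mult flip: cls_mult)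
  next
    fix X Y Z assume "X \<in> carrier L" "Y \<in> carrier L" "Z \<in> carrier L"
    then obtain p q r where "p \<in> FC" "X = cls p" "q \<in> FC" "Y = cls q" "r \<in> FC" "Z = cls r"
      by (auto simp: carrier_L)
    then show "X \<otimes>\<^bsub>L\<^esub> Y \<otimes>\<^bsub>L\<^esub> Z = X \<otimes>\<^bsub>L\<^esub> (Y \<otimes>\<^bsub>L\<^esub> Z)"
      by (simp add: mult.assoc free_carrier_mult flip: cls_mult)
  qed (simp add: cls_one one)
next
  fix X Y Z assume "X \<in> carrier L" "Y \<in> carrier L" "Z \<in> carrier L"
  then obtain p q r where "p \<in> FC" "X = cls p" "q \<in> FC" "Y = cls q" "r \<in> FC" "Z = cls r"
    by (auto simp: carrier_L)
  then show "(X \<oplus>\<^bsub>L\<^esub> Y) \<otimes>\<^bsub>L\<^esub> Z = X \<otimes>\<^bsub>L\<^esub> Z \<oplus>\<^bsub>L\<^esub> Y \<otimes>\<^bsub>L\<^esub> Z"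
    "Z \<otimes>\<^bsub>L\<^esub> (X \<oplus>\<^bsub>L\<^esub> Y) = Z \<otimes>\<^bsub>L\<^esub> X \<oplus>\<^bsub>L\<^esub> Z \<otimes>\<^bsub>L\<^esub> Y"
    by (simp_all add: free_carrier_add distrib_left distrib_right flip: cls_mult cls_add)
qed

sublocale L: ring L
  by (rule ring_L)

lemma cls_sum:
  "(\<And>x. x \<in> A \<Longrightarrow> f x \<in> FC) \<Longrightarrow> cls (\<Sum>x\<in>A. f x) = (\<Oplus>\<^bsub>L\<^esub>x\<in>A. cls (f x))"
  by (induction A rule: infinite_finite_induct) (auto simp: cls_add cls_zero L.finsum_insert L.finsum_infinite)

abbreviation V where "V w \<equiv> cls (var (Vertex w))"
abbreviation Ed where "Ed e \<equiv> cls (var (Edge e))"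
abbreviation Gh where "Gh e \<equiv> cls (var (Ghost e))"

lemma generators_closed [simp]:
  "w \<in> verts E \<Longrightarrow> var (Vertex w) \<in> FC" "e \<in> arcs E \<Longrightarrow> var (Edge e) \<in> FC" "e \<in> arcs E \<Longrightarrow> var (Ghost e) \<in> FC"
  by (simp_all add: free_carrier_var)

lemma leavitt_relations:
  "\<lbrakk>v \<in> verts E; w \<in> verts E\<rbrakk> \<Longrightarrow> V v \<otimes>\<^bsub>L\<^esub> V w = (if v = w then V w else \<zero>\<^bsub>L\<^esub>)"
  "e \<in> arcs E \<Longrightarrow> V (tail E e) \<otimes>\<^bsub>L\<^esub> Ed e = Ed e"
  "e \<in> arcs E \<Longrightarrow> Ed e \<otimes>\<^bsub>L\<^esub> V (head E e) = Ed e"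
  "e \<in> arcs E \<Longrightarrow> V (head E e) \<otimes>\<^bsub>L\<^esub> Gh e = Gh e"
  "e \<in> arcs E \<Longrightarrow> Gh e \<otimes>\<^bsub>L\<^esub> V (tail E e) = Gh e"
  "\<lbrakk>e \<in> arcs E; f \<in> arcs E\<rbrakk> \<Longrightarrow> Gh e \<otimes>\<^bsub>L\<^esub> Ed f = (if e = f then V (head E e) else \<zero>\<^bsub>L\<^esub>)"
  by (auto simp flip: cls_mult simp: cls_zero cls_eq_iff intro!: cong_relator
      dest: leavitt_relators.intros(1-6)[of _ E])

text \<open>
  Two generators whose endpoints do not match multiply to zero, as a product of two distinct
  vertices can be inserted between them.
\<close>

lemma generator_products:
  "\<lbrakk>w \<in> verts E; e \<in> arcs E\<rbrakk> \<Longrightarrow> V w \<otimes>\<^bsub>L\<^esub> Ed e = (if w = tail E e then Ed e else \<zero>\<^bsub>L\<^esub>)"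
  "\<lbrakk>w \<in> verts E; e \<in> arcs E\<rbrakk> \<Longrightarrow> Ed e \<otimes>\<^bsub>L\<^esub> V w = (if w = head E e then Ed e else \<zero>\<^bsub>L\<^esub>)"
  "\<lbrakk>w \<in> verts E; e \<in> arcs E\<rbrakk> \<Longrightarrow> V w \<otimes>\<^bsub>L\<^esub> Gh e = (if w = head E e then Gh e else \<zero>\<^bsub>L\<^esub>)"
  "\<lbrakk>w \<in> verts E; e \<in> arcs E\<rbrakk> \<Longrightarrow> Gh e \<otimes>\<^bsub>L\<^esub> V w = (if w = tail E e then Gh e else \<zero>\<^bsub>L\<^esub>)"
  "\<lbrakk>e \<in> arcs E; f \<in> arcs E; head E e \<noteq> tail E f\<rbrakk> \<Longrightarrow> Ed e \<otimes>\<^bsub>L\<^esub> Ed f = \<zero>\<^bsub>L\<^esub>"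
  "\<lbrakk>e \<in> arcs E; f \<in> arcs E; head E e \<noteq> tail E f\<rbrakk> \<Longrightarrow> Gh f \<otimes>\<^bsub>L\<^esub> Gh e = \<zero>\<^bsub>L\<^esub>"
proof -
  have split: "X \<otimes>\<^bsub>L\<^esub> Y = \<zero>\<^bsub>L\<^esub>"
    if "X \<in> carrier L" "Y \<in> carrier L" "w \<in> verts E" "w' \<in> verts E" "w \<noteq> w'"
      "X \<otimes>\<^bsub>L\<^esub> V w = X" "V w' \<otimes>\<^bsub>L\<^esub> Y = Y" for X Y w w'
  proof -
    have "X \<otimes>\<^bsub>L\<^esub> Y = (X \<otimes>\<^bsub>L\<^esub> V w) \<otimes>\<^bsub>L\<^esub> (V w' \<otimes>\<^bsub>L\<^esub> Y)" using that by simp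
    also have "\<dots> = X \<otimes>\<^bsub>L\<^esub> (V w \<otimes>\<^bsub>L\<^esub> V w') \<otimes>\<^bsub>L\<^esub> Y"
      using that(1-4) by (simp only: L.m_assoc L.m_closed cls_closed generators_closed)
    finally show ?thesis using that(1-5) by (simp add: leavitt_relations)
  qed
  show "\<lbrakk>w \<in> verts E; e \<in> arcs E\<rbrakk> \<Longrightarrow> V w \<otimes>\<^bsub>L\<^esub> Ed e = (if w = tail E e then Ed e else \<zero>\<^bsub>L\<^esub>)"
    by (simp add: split[of _ _ w "tail E e"] leavitt_relations)
  show "\<lbrakk>w \<in> verts E; e \<in> arcs E\<rbrakk> \<Longrightarrow> Ed e \<otimes>\<^bsub>L\<^esub> V w = (if w = head E e then Ed e else \<zero>\<^bsub>L\<^esub>)"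
    by (simp add: split[of _ _ "head E e" w] leavitt_relations)
  show "\<lbrakk>w \<in> verts E; e \<in> arcs E\<rbrakk> \<Longrightarrow> V w \<otimes>\<^bsub>L\<^esub> Gh e = (if w = head E e then Gh e else \<zero>\<^bsub>L\<^esub>)"
    by (simp add: split[of _ _ w "head E e"] leavitt_relations)
  show "\<lbrakk>w \<in> verts E; e \<in> arcs E\<rbrakk> \<Longrightarrow> Gh e \<otimes>\<^bsub>L\<^esub> V w = (if w = tail E e then Gh e else \<zero>\<^bsub>L\<^esub>)"
    by (simp add: split[of _ _ "tail E e" w] leavitt_relations)
  show "\<lbrakk>e \<in> arcs E; f \<in> arcs E; head E e \<noteq> tail E f\<rbrakk> \<Longrightarrow> Ed e \<otimes>\<^bsub>L\<^esub> Ed f = \<zero>\<^bsub>L\<^esub>"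
    by (simp add: split[of _ _ "head E e" "tail E f"] leavitt_relations)
  show "\<lbrakk>e \<in> arcs E; f \<in> arcs E; head E e \<noteq> tail E f\<rbrakk> \<Longrightarrow> Gh f \<otimes>\<^bsub>L\<^esub> Gh e = \<zero>\<^bsub>L\<^esub>"
    by (simp add: split[of _ _ "tail E f" "head E e"] leavitt_relations)
qed

lemma vsum_products:
  assumes W: "W \<subseteq> verts E"
  shows "w \<in> verts E \<Longrightarrow> cls (vsum W) \<otimes>\<^bsub>L\<^esub> V w = (if w \<in> W then V w else \<zero>\<^bsub>L\<^esub>)"
    and "w \<in> verts E \<Longrightarrow> V w \<otimes>\<^bsub>L\<^esub> cls (vsum W) = (if w \<in> W then V w else \<zero>\<^bsub>L\<^esub>)"
    and "e \<in> arcs E \<Longrightarrow> cls (vsum W) \<otimes>\<^bsub>L\<^esub> Ed e = (if tail E e \<in> W then Ed e else \<zero>\<^bsub>L\<^esub>)"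
    and "e \<in> arcs E \<Longrightarrow> Ed e \<otimes>\<^bsub>L\<^esub> cls (vsum W) = (if head E e \<in> W then Ed e else \<zero>\<^bsub>L\<^esub>)"
    and "e \<in> arcs E \<Longrightarrow> cls (vsum W) \<otimes>\<^bsub>L\<^esub> Gh e = (if head E e \<in> W then Gh e else \<zero>\<^bsub>L\<^esub>)"
    and "e \<in> arcs E \<Longrightarrow> Gh e \<otimes>\<^bsub>L\<^esub> cls (vsum W) = (if tail E e \<in> W then Gh e else \<zero>\<^bsub>L\<^esub>)"
  using vsum_vertex[OF W, of w] vsum_edge[OF W, of e] W
  by (simp_all add: vsum_closed cls_zero cls_eq_iff split: if_splits flip: cls_mult)

lemma vsum_idem:
  assumes W: "W \<subseteq> verts E"
  shows "leavitt_cong E (vsum W * vsum W) (vsum W)"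
proof -
  have "leavitt_cong E (\<Sum>w\<in>W. vsum W * var (Vertex w)) (\<Sum>w\<in>W. var (Vertex w))"
  proof (rule leavitt_cong_sum)
    fix w assume "w \<in> W"
    then show "leavitt_cong E (vsum W * var (Vertex w)) (var (Vertex w))"
      using vsum_vertex(1)[OF W, of w] W by auto
  qed
  then show ?thesis unfolding sum_distrib_left[symmetric] by (simp add: vsum_def)
qed

end

section \<open>The collapse graph\<close>

text \<open>
  Moves Kronecker deltas outside a product so that \<open>sum.delta\<close> evaluates matrix products.
\<close>

lemma if_times_0:
  "(if c then x else 0) * y = (if c then x * y else (0 :: 'a :: ring_1))"
  "y * (if c then x else 0) = (if c then y * x else (0 :: 'a :: ring_1))"
  by simp_all

locale graph_collapse = leavitt_algebra K E
  for K :: "'k::field itself" and E :: "('v, 'e) pre_digraph" +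
  fixes v :: 'v
  assumes regular_v: "regular_vertex E v"
    and no_loop: "\<not> base_of_loop E v"
begin

abbreviation G where "G \<equiv> collapse E v"

lemma collapse_simps [simp]:
  "verts G = verts E - {v}"
  "tail G (Old e) = tail E e" "tail G (New e f) = tail E e"
  "head G (Old e) = head E e" "head G (New e f) = head E f"
  "Old e \<in> arcs G \<longleftrightarrow> e \<in> arcs E \<and> head E e \<noteq> v \<and> tail E e \<noteq> v"
  "New e f \<in> arcs G \<longleftrightarrow> e \<in> arcs E \<and> head E e = v \<and> f \<in> arcs E \<and> tail E f = v"
  by (auto simp: collapse_def)

lemma v_in_verts [simp]: "v \<in> verts E"
  using regular_v by (simp add: regular_vertex_def)

lemma not_loop: "e \<in> arcs E \<Longrightarrow> head E e = v \<Longrightarrow> tail E e = v \<Longrightarrow> False"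
  using no_loop by (auto simp: base_of_loop_def)

lemma fin_digraph_collapse: "fin_digraph G"
proof
  fix x assume "x \<in> arcs G"
  then show "tail G x \<in> verts G" "head G x \<in> verts G"
    by (cases x; auto dest: not_loop)+
next
  have "arcs G \<subseteq> Old ` arcs E \<union> (\<lambda>(e, f). New e f) ` (arcs E \<times> arcs E)"
    by (auto simp: collapse_def)
  then show "finite (arcs G)" by (rule finite_subset) simp
qed simp

sublocale G: leavitt_algebra K G
  by (intro leavitt_algebra.intro fin_digraph_collapse)

text \<open>
  Passing to the collapse replaces each edge \<open>e\<close> into \<open>v\<close> by the family of the \<open>[ef]\<close>; this
  compares the two forms of the relation at a regular vertex.
\<close>

lemma sum_out_arcs_collapse:
  fixes g :: "'e collapse_edge \<Rightarrow> 'b :: comm_monoid_add"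
  assumes "w \<noteq> v"
  shows "(\<Sum>x\<in>out_arcs G w. g x) =
    (\<Sum>e\<in>out_arcs E w. if head E e = v then \<Sum>f\<in>out_arcs E v. g (New e f) else g (Old e))"
proof -
  let ?A = "{e \<in> out_arcs E w. head E e \<noteq> v}" and ?B = "{e \<in> out_arcs E w. head E e = v}"
  have eq: "out_arcs G w = Old ` ?A \<union> (\<lambda>(e, f). New e f) ` (?B \<times> out_arcs E v)"
  proof (rule Set.set_eqI)
    fix x show "x \<in> out_arcs G w \<longleftrightarrow> x \<in> Old ` ?A \<union> (\<lambda>(e, f). New e f) ` (?B \<times> out_arcs E v)"
      using assms by (cases x) auto
  qed
  have "(\<Sum>x\<in>out_arcs G w. g x) = (\<Sum>e\<in>?A. g (Old e)) + (\<Sum>(e, f)\<in>?B \<times> out_arcs E v. g (New e f))"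
    unfolding eq
    by (subst sum.union_disjoint)
      (auto simp: sum.reindex inj_on_def split_def finite_out_arcs)
  also have "\<dots> = (\<Sum>e\<in>?A. g (Old e)) + (\<Sum>e\<in>?B. \<Sum>f\<in>out_arcs E v. g (New e f))"
    by (simp add: sum.cartesian_product)
  also have "\<dots> = (\<Sum>e\<in>out_arcs E w. if head E e = v then \<Sum>f\<in>out_arcs E v. g (New e f) else g (Old e))"
    by (subst sum.If_cases) (auto simp: finite_out_arcs Int_def add.commute)
  finally show ?thesis .
qed

section \<open>The map from the collapse into the corner\<close>

primrec corner_word :: "('v, 'e collapse_edge) gen \<Rightarrow> ('k, 'v, 'e) free_elem" where
  "corner_word (Vertex w) = var (Vertex w)"
| "corner_word (Edge x) = (case x of Old e \<Rightarrow> var (Edge e) | New e f \<Rightarrow> var (Edge e) * var (Edge f))"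
| "corner_word (Ghost x) = (case x of Old e \<Rightarrow> var (Ghost e) | New e f \<Rightarrow> var (Ghost f) * var (Ghost e))"

definition corner_subst :: "('k, 'v, 'e collapse_edge) free_elem \<Rightarrow> ('k, 'v, 'e) free_elem" where
  "corner_subst p = matrix_extension {()} (\<lambda>x _ _. corner_word x) p () ()"

lemma corner_subst_simps:
  "corner_subst 0 = 0" "corner_subst (p + q) = corner_subst p + corner_subst q" "corner_subst (p - q) = corner_subst p - corner_subst q" "corner_subst (p * q) = corner_subst p * corner_subst q"
  "corner_subst (Poly_Mapping.single 0 c * p) = Poly_Mapping.single 0 c * corner_subst p"
  "corner_subst (var x) = corner_word x" "corner_subst (\<Sum>y\<in>Y. f y) = (\<Sum>y\<in>Y. corner_subst (f y))"
  unfolding corner_subst_def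
  by (simp_all add: matrix_extension_add matrix_extension_diff matrix_extension_sum matrix_extension_scale matrix_extension_var)
    (simp add: matrix_extension_mult)

lemma corner_word_closed: "x \<in> gens G \<Longrightarrow> corner_word x \<in> FC"
  by (cases x) (auto split: collapse_edge.split intro!: free_carrier_mult)

lemma corner_subst_closed: "p \<in> free_carrier G \<Longrightarrow> corner_subst p \<in> FC"
  unfolding corner_subst_def by (rule matrix_extension_free_carrier) (auto intro: corner_word_closed)

lemmas relations = leavitt_relations generator_products

text \<open>
  Associativity in the form needed to simplify nested products with a known head.
\<close>

lemma left_relation: "\<lbrakk>X \<otimes>\<^bsub>L\<^esub> Y = Z; X \<in> carrier L; Y \<in> carrier L; U \<in> carrier L\<rbrakk> \<Longrightarrow> X \<otimes>\<^bsub>L\<^esub> (Y \<otimes>\<^bsub>L\<^esub> U) = Z \<otimes>\<^bsub>L\<^esub> U"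
  by (simp flip: L.m_assoc)

lemma corner_word_relations:
  "w \<in> verts G \<Longrightarrow> cls (corner_word (Vertex w)) = V w"
  "x \<in> arcs G \<Longrightarrow> V (tail G x) \<otimes>\<^bsub>L\<^esub> cls (corner_word (Edge x)) = cls (corner_word (Edge x))"
  "x \<in> arcs G \<Longrightarrow> cls (corner_word (Edge x)) \<otimes>\<^bsub>L\<^esub> V (head G x) = cls (corner_word (Edge x))"
  "x \<in> arcs G \<Longrightarrow> V (head G x) \<otimes>\<^bsub>L\<^esub> cls (corner_word (Ghost x)) = cls (corner_word (Ghost x))"
  "x \<in> arcs G \<Longrightarrow> cls (corner_word (Ghost x)) \<otimes>\<^bsub>L\<^esub> V (tail G x) = cls (corner_word (Ghost x))"
  by (simp_all split: collapse_edge.split)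
    (auto simp: cls_mult relations L.m_assoc simp flip: L.m_assoc[of "V _"])

lemma corner_word_ghost_edge:
  assumes "x \<in> arcs G" "y \<in> arcs G"
  shows "cls (corner_word (Ghost x)) \<otimes>\<^bsub>L\<^esub> cls (corner_word (Edge y)) = (if x = y then V (head G x) else \<zero>\<^bsub>L\<^esub>)"
proof -
  have ee: "Gh e \<otimes>\<^bsub>L\<^esub> (Ed f \<otimes>\<^bsub>L\<^esub> X) = (if e = f then V (head E e) else \<zero>\<^bsub>L\<^esub>) \<otimes>\<^bsub>L\<^esub> X"
    if "e \<in> arcs E" "f \<in> arcs E" "X \<in> carrier L" for e f X
    using that by (intro left_relation) (auto simp: relations)
  show ?thesis
    using assms by (cases x; cases y) (auto simp: cls_mult L.m_assoc ee relations)
qed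

text \<open>
  The only relation that is not immediate is the one at a regular vertex \<open>w\<close>: the sum over the
  \<open>[ef]\<close> gives \<open>\<Sum>e f f\<^sup>* e\<^sup>* = e v e\<^sup>* = e e\<^sup>*\<close>, so the relation at \<open>w\<close> for the collapse becomes
  the one for \<open>E\<close>.
\<close>

lemma corner_subst_relators:
  assumes "p \<in> leavitt_relators G"
  shows "corner_subst p \<in> leavitt_ideal E"
proof -
  have cong: "cls a = cls b \<Longrightarrow> a - b \<in> leavitt_ideal E" for a b
    by (simp add: cls_eq_iff leavitt_cong_def)
  from assms show ?thesis
  proof cases
    case (regular w)
    then have w: "w \<in> verts E" "w \<noteq> v" and ne: "out_arcs G w \<noteq> {}"
      by (auto simp: regular_vertex_def is_sink_def)
    from ne obtain x where "x \<in> out_arcs G w" by blast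
    then have "regular_vertex E w"
      using w by (cases x) (auto simp: regular_vertex_def is_sink_def)
    then have "leavitt_cong E (var (Vertex w) :: ('k, 'v, 'e) free_elem) (\<Sum>e\<in>out_arcs E w. var (Edge e) * var (Ghost e))"
      by (intro cong_relator leavitt_relators.regular)
    also have "leavitt_cong E \<dots> (\<Sum>e\<in>out_arcs E w. if head E e = v
        then \<Sum>f\<in>out_arcs E v. corner_word (Edge (New e f)) * corner_word (Ghost (New e f))
        else corner_word (Edge (Old e)) * corner_word (Ghost (Old e)))"
    proof (rule leavitt_cong_sum)
      fix e assume "e \<in> out_arcs E w"
      then have e: "e \<in> arcs E" by simp
      show "leavitt_cong E (var (Edge e) * var (Ghost e)) (if head E e = v
        then \<Sum>f\<in>out_arcs E v. corner_word (Edge (New e f)) * corner_word (Ghost (New e f))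
        else corner_word (Edge (Old e)) * corner_word (Ghost (Old e)))"
      proof (cases "head E e = v")
        case True
        have "leavitt_cong E (var (Edge e) * var (Ghost e) :: ('k, 'v, 'e) free_elem)
            (var (Edge e) * var (Vertex v) * var (Ghost e))"
          using edge_vertices(2)[OF e] e True
          by (intro leavitt_cong_mult leavitt_cong_refl) (auto intro: leavitt_cong_sym free_carrier_mult)
        also have "leavitt_cong E \<dots> (var (Edge e) * (\<Sum>f\<in>out_arcs E v. var (Edge f) * var (Ghost f)) * var (Ghost e))"
          using e regular_v
          by (intro leavitt_cong_mult leavitt_cong_refl cong_relator leavitt_relators.regular)
            (auto intro!: free_carrier_mult free_carrier_sum)
        also have "\<dots> = (\<Sum>f\<in>out_arcs E v. corner_word (Edge (New e f)) * corner_word (Ghost (New e f)))"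
          by (simp add: sum_distrib_left sum_distrib_right mult.assoc)
        finally show ?thesis using True by simp
      qed simp
    qed
    finally show ?thesis
      unfolding regular(1) by (simp add: corner_subst_simps sum_out_arcs_collapse w leavitt_cong_def if_distrib[of corner_subst] cong: if_cong)
  next
    case (vertices u w)
    have "cls (corner_word (Vertex u) * corner_word (Vertex w)) = cls (if u = w then corner_word (Vertex w) else 0)"
      using vertices by (simp add: cls_mult relations cls_zero)
    then show ?thesis
      unfolding vertices(1) corner_subst_simps if_distrib[of corner_subst] by (intro cong)
  next
    case (source_edge x)
    have "cls (corner_word (Vertex (tail G x)) * corner_word (Edge x)) = cls (corner_word (Edge x))"
      using source_edge(2-) corner_word_relations(1)[of "tail G x"] corner_word_relations(2)[of x]
        corner_word_closed[of "Vertex (tail G x)"] corner_word_closed[of "Edge x"]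
      by (simp add: cls_mult corner_word_ghost_edge cls_zero del: corner_word.simps collapse_simps)
    then show ?thesis
      unfolding source_edge(1) corner_subst_simps by (intro cong)
  next
    case (edge_range x)
    have "cls (corner_word (Edge x) * corner_word (Vertex (head G x))) = cls (corner_word (Edge x))"
      using edge_range(2-) corner_word_relations(1)[of "head G x"] corner_word_relations(3)[of x]
        corner_word_closed[of "Vertex (head G x)"] corner_word_closed[of "Edge x"]
      by (simp add: cls_mult corner_word_ghost_edge cls_zero del: corner_word.simps collapse_simps)
    then show ?thesis
      unfolding edge_range(1) corner_subst_simps by (intro cong)
  next
    case (range_ghost x)
    have "cls (corner_word (Vertex (head G x)) * corner_word (Ghost x)) = cls (corner_word (Ghost x))"
      using range_ghost(2-) corner_word_relations(1)[of "head G x"] corner_word_relations(4)[of x]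
        corner_word_closed[of "Vertex (head G x)"] corner_word_closed[of "Ghost x"]
      by (simp add: cls_mult corner_word_ghost_edge cls_zero del: corner_word.simps collapse_simps)
    then show ?thesis
      unfolding range_ghost(1) corner_subst_simps by (intro cong)
  next
    case (ghost_source x)
    have "cls (corner_word (Ghost x) * corner_word (Vertex (tail G x))) = cls (corner_word (Ghost x))"
      using ghost_source(2-) corner_word_relations(1)[of "tail G x"] corner_word_relations(5)[of x]
        corner_word_closed[of "Vertex (tail G x)"] corner_word_closed[of "Ghost x"]
      by (simp add: cls_mult corner_word_ghost_edge cls_zero del: corner_word.simps collapse_simps)
    then show ?thesis
      unfolding ghost_source(1) corner_subst_simps by (intro cong)
  next
    case (ghost_edge x y)
    have "cls (corner_word (Ghost x) * corner_word (Edge y)) = cls (if x = y then corner_word (Vertex (head G x)) else 0)"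
      using ghost_edge(2-) corner_word_closed[of "Ghost x"] corner_word_closed[of "Edge y"] corner_word_relations(1)[of "head G x"]
      by (simp add: cls_mult corner_word_ghost_edge cls_zero del: corner_word.simps(2,3) collapse_simps)
    then show ?thesis
      unfolding ghost_edge(1) corner_subst_simps if_distrib[of corner_subst] by (intro cong)
  qed
qed

lemma corner_subst_ideal: "p \<in> leavitt_ideal G \<Longrightarrow> corner_subst p \<in> leavitt_ideal E"
  unfolding corner_subst_def
  by (rule matrix_extension_leavitt_ideal[where E = G])
    (simp_all add: corner_word_closed corner_subst_relators[unfolded corner_subst_def])

section \<open>The matrix of an element of the original algebra\<close>

text \<open>
  The index \<open>None\<close> stands for the idempotent \<open>e\<close> of the corner and \<open>Some f\<close> for an edge \<open>f\<close>
  leaving \<open>v\<close>.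
\<close>

definition idx :: "'e option set" where
  "idx = insert None (Some ` out_arcs E v)"

lemma finite_idx: "finite idx"
  by (simp add: idx_def finite_out_arcs)

lemma idx_simps [simp]: "None \<in> idx" "Some f \<in> idx \<longleftrightarrow> f \<in> arcs E \<and> tail E f = v"
  by (auto simp: idx_def)

lemma sum_idx: "(\<Sum>k\<in>idx. g k) = g None + (\<Sum>f\<in>out_arcs E v. g (Some f))"
  by (simp add: idx_def finite_out_arcs sum.reindex)

text \<open>
  The entry at \<open>(i, j)\<close> is what \<open>b\<^sub>i x a\<^sub>j\<close> becomes in the algebra of the collapse, where
  \<open>a\<^sub>i = b\<^sub>i = e\<close> for \<open>i = None\<close>, and \<open>a\<^sub>i = f\<close>, \<open>b\<^sub>i = f\<^sup>*\<close> for \<open>i = Some f\<close>. For instance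
  \<open>f\<^sup>* v g\<close> is the range of \<open>f\<close> if \<open>f = g\<close> and zero otherwise, \<open>e x f\<close> is the new edge \<open>[xf]\<close>
  for an edge \<open>x\<close> into \<open>v\<close>, and \<open>f\<^sup>* x e\<close> is the range of \<open>f\<close> if \<open>x = f\<close> and zero otherwise.
  Reading the definition with this in mind, \<open>corner_subst_corner_matrix\<close> is a table check.
\<close>

primrec gen_matrix :: "('v, 'e) gen \<Rightarrow> 'e option \<Rightarrow> 'e option \<Rightarrow> ('k, 'v, 'e collapse_edge) free_elem" where
  "gen_matrix (Vertex w) i j = (if i = j then
     (case i of None \<Rightarrow> if w = v then 0 else var (Vertex w)
      | Some f \<Rightarrow> if w = v then var (Vertex (head E f)) else 0) else 0)"
| "gen_matrix (Edge e) i j = (case (i, j) of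
     (None, None) \<Rightarrow> if head E e \<noteq> v \<and> tail E e \<noteq> v then var (Edge (Old e)) else 0
   | (None, Some f) \<Rightarrow> if head E e = v then var (Edge (New e f)) else 0
   | (Some f, None) \<Rightarrow> if f = e then var (Vertex (head E e)) else 0
   | (Some f, Some g) \<Rightarrow> 0)"
| "gen_matrix (Ghost e) i j = (case (i, j) of
     (None, None) \<Rightarrow> if head E e \<noteq> v \<and> tail E e \<noteq> v then var (Ghost (Old e)) else 0
   | (Some f, None) \<Rightarrow> if head E e = v then var (Ghost (New e f)) else 0
   | (None, Some f) \<Rightarrow> if f = e then var (Vertex (head E e)) else 0
   | (Some f, Some g) \<Rightarrow> 0)"

definition corner_matrix :: "('k, 'v, 'e) free_elem \<Rightarrow> 'e option \<Rightarrow> 'e option \<Rightarrow> ('k, 'v, 'e collapse_edge) free_elem" where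
  "corner_matrix = matrix_extension idx gen_matrix"

lemma corner_matrix_simps:
  "corner_matrix 0 i j = 0" "corner_matrix (p + q) i j = corner_matrix p i j + corner_matrix q i j" "corner_matrix (p - q) i j = corner_matrix p i j - corner_matrix q i j"
  "corner_matrix (\<Sum>y\<in>Y. f y) i j = (\<Sum>y\<in>Y. corner_matrix (f y) i j)"
  "i \<in> idx \<Longrightarrow> corner_matrix (p * q) i j = (\<Sum>k\<in>idx. corner_matrix p i k * corner_matrix q k j)"
  "i \<in> idx \<Longrightarrow> corner_matrix (Poly_Mapping.single 0 c * p) i j = Poly_Mapping.single 0 c * corner_matrix p i j"
  "j \<in> idx \<Longrightarrow> corner_matrix (var x) i j = gen_matrix x i j"
  unfolding corner_matrix_def
  by (simp_all add: matrix_extension_add matrix_extension_diff matrix_extension_sum matrix_extension_scale matrix_extension_var finite_idx)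
    (simp add: matrix_extension_mult finite_idx)

lemma head_out_v: "f \<in> arcs E \<Longrightarrow> tail E f = v \<Longrightarrow> head E f \<noteq> v"
  using not_loop by blast

lemma gen_matrix_closed: "\<lbrakk>x \<in> gens E; i \<in> idx; j \<in> idx\<rbrakk> \<Longrightarrow> gen_matrix x i j \<in> free_carrier G"
  by (cases x; cases i; cases j; simp add: free_carrier_zero free_carrier_var head_out_v)
    (metis free_carrier_var G.gens_simps(1) collapse_simps(1) head_in_verts head_out_v Diff_iff singletonD)+

lemma corner_matrix_closed: "\<lbrakk>p \<in> FC; i \<in> idx; j \<in> idx\<rbrakk> \<Longrightarrow> corner_matrix p i j \<in> free_carrier G"
  unfolding corner_matrix_def by (rule matrix_extension_free_carrier[OF finite_idx gen_matrix_closed])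

text \<open>
  The defining relations of the collapse in the shapes in which they arise as matrix entries.
\<close>

lemma collapse_relations:
  "\<lbrakk>u \<in> verts G; w \<in> verts G\<rbrakk> \<Longrightarrow>
     var (Vertex u) * var (Vertex w) - (if u = w then var (Vertex w) else 0) \<in> leavitt_ideal G"
  "\<lbrakk>w \<in> verts G\<rbrakk> \<Longrightarrow> var (Vertex w) * var (Vertex w) - var (Vertex w) \<in> leavitt_ideal G"
  "\<lbrakk>u \<in> verts G; w \<in> verts G; u \<noteq> w\<rbrakk> \<Longrightarrow> var (Vertex u) * var (Vertex w) \<in> leavitt_ideal G"
  "\<lbrakk>x \<in> arcs G; w = tail G x\<rbrakk> \<Longrightarrow> var (Vertex w) * var (Edge x) - var (Edge x) \<in> leavitt_ideal G"
  "\<lbrakk>x \<in> arcs G; w = head G x\<rbrakk> \<Longrightarrow> var (Edge x) * var (Vertex w) - var (Edge x) \<in> leavitt_ideal G"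
  "\<lbrakk>x \<in> arcs G; w = head G x\<rbrakk> \<Longrightarrow> var (Vertex w) * var (Ghost x) - var (Ghost x) \<in> leavitt_ideal G"
  "\<lbrakk>x \<in> arcs G; w = tail G x\<rbrakk> \<Longrightarrow> var (Ghost x) * var (Vertex w) - var (Ghost x) \<in> leavitt_ideal G"
  "\<lbrakk>x \<in> arcs G; y \<in> arcs G; x \<noteq> y\<rbrakk> \<Longrightarrow> var (Ghost x) * var (Edge y) \<in> leavitt_ideal G"
  "\<lbrakk>x \<in> arcs G; w = head G x\<rbrakk> \<Longrightarrow> var (Ghost x) * var (Edge x) - var (Vertex w) \<in> leavitt_ideal G"
  subgoal by (rule leavitt_ideal.relator, rule leavitt_relators.vertices)
  subgoal by (frule leavitt_relators.vertices[of w G w, THEN leavitt_ideal.relator]) (simp_all del: collapse_simps)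
  subgoal by (frule leavitt_relators.vertices[of u G w, THEN leavitt_ideal.relator]) (simp_all del: collapse_simps)
  subgoal by (simp only: leavitt_ideal.relator leavitt_relators.source_edge)
  subgoal by (simp only: leavitt_ideal.relator leavitt_relators.edge_range)
  subgoal by (simp only: leavitt_ideal.relator leavitt_relators.range_ghost)
  subgoal by (simp only: leavitt_ideal.relator leavitt_relators.ghost_source)
  subgoal by (frule leavitt_relators.ghost_edge[of x G y, THEN leavitt_ideal.relator]) (simp_all del: collapse_simps)
  subgoal by (frule leavitt_relators.ghost_edge[of x G x, THEN leavitt_ideal.relator]) (simp_all del: collapse_simps)
  done

text \<open>
  Multiplying out the sparse matrices turns each entry of a relation of \<open>E\<close> into zero or into a
  single relation of the collapse. The relation at \<open>v\<close> reduces to the idempotency of the ranges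
  of the edges leaving \<open>v\<close>; the relation at another regular vertex reduces to the one for the
  collapse, where the vertex is still regular because \<open>v\<close> has an outgoing edge.
\<close>

lemma corner_matrix_relators:
  assumes "p \<in> leavitt_relators E" "i \<in> idx" "j \<in> idx"
  shows "corner_matrix p i j \<in> leavitt_ideal G"
proof -
  note simps = corner_matrix_simps sum_idx if_times_0 head_out_v leavitt_ideal.zero finite_out_arcs
    if_distrib[of "\<lambda>p. corner_matrix p _ _"]
  from assms(1) show ?thesis
  proof cases
    case (regular w)
    then have w: "w \<in> verts E" by (simp add: regular_vertex_def)
    show ?thesis
    proof (cases "w = v")
      case True
      have "corner_matrix (var (Edge e) * var (Ghost e)) i j =
          (if i = j \<and> i = Some e then var (Vertex (head E e)) * var (Vertex (head E e)) else 0)"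
        if "e \<in> out_arcs E v" for e
        using that assms(2,3) by (cases i; cases j) (auto simp: simps)
      then have "corner_matrix p i j = gen_matrix (Vertex v) i j -
          (\<Sum>e\<in>out_arcs E v. if i = j \<and> i = Some e
             then var (Vertex (head E e)) * var (Vertex (head E e)) else 0)"
        unfolding regular(1) using True assms(3) by (simp add: corner_matrix_simps(3,4,7))
      also have "- \<dots> \<in> leavitt_ideal G"
      proof (cases "i = j")
        case True
        then show ?thesis
          using assms(3)
          by (cases j; simp add: leavitt_ideal.zero finite_out_arcs collapse_relations head_out_v)
      qed (simp add: leavitt_ideal.zero)
      finally show ?thesis using leavitt_ideal_uminus by fastforce
    next
      case False
      have entry: "corner_matrix (var (Edge e) * var (Ghost e)) i j =
          (if i = None \<and> j = None then
             if head E e = v then \<Sum>f\<in>out_arcs E v. var (Edge (New e f)) * var (Ghost (New e f))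
             else var (Edge (Old e)) * var (Ghost (Old e)) else 0)"
        if "e \<in> out_arcs E w" for e
        using that assms(2,3) False by (cases i; cases j) (auto simp: simps intro!: sum.neutral)
      have "corner_matrix p i j = gen_matrix (Vertex w) i j - (\<Sum>e\<in>out_arcs E w. if i = None \<and> j = None then
             if head E e = v then \<Sum>f\<in>out_arcs E v. var (Edge (New e f)) * var (Ghost (New e f))
             else var (Edge (Old e)) * var (Ghost (Old e)) else 0)"
        unfolding regular(1) using assms(3) by (simp add: corner_matrix_simps(3,4,7) entry)
      also have "\<dots> = (if i = None \<and> j = None then
          var (Vertex w) - (\<Sum>x\<in>out_arcs G w. var (Edge x) * var (Ghost x)) else 0)"
        using False by (cases i; cases j; simp add: sum_out_arcs_collapse)
      finally have "corner_matrix p i j = (if i = None \<and> j = None then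
          var (Vertex w) - (\<Sum>x\<in>out_arcs G w. var (Edge x) * var (Ghost x)) else 0)" .
      moreover have "regular_vertex G w"
      proof -
        obtain e where e: "e \<in> out_arcs E w"
          using regular(2) unfolding regular_vertex_def is_sink_def by blast
        obtain f where f: "f \<in> out_arcs E v"
          using regular_v unfolding regular_vertex_def is_sink_def by blast
        have "(if head E e = v then New e f else Old e) \<in> out_arcs G w"
          using e f False by auto
        then show ?thesis using w False by (auto simp: regular_vertex_def is_sink_def)
      qed
      ultimately show ?thesis
        by (simp add: leavitt_ideal.zero leavitt_ideal.relator leavitt_relators.regular)
    qed
  next
    case (vertices u w)
    then show ?thesis
      using assms(2,3)
      by (cases i; cases j; simp add: simps collapse_relations(1-3) cong: if_cong)
  next
    case (source_edge e)
    then show ?thesis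
      using assms(2,3)
      by (cases i; cases j; simp add: simps)
        (auto simp: collapse_relations leavitt_ideal.zero head_out_v dest: not_loop)
  next
    case (edge_range e)
    then show ?thesis
      using assms(2,3)
      by (cases i; cases j; simp add: simps)
        (auto simp: collapse_relations leavitt_ideal.zero head_out_v dest: not_loop)
  next
    case (range_ghost e)
    then show ?thesis
      using assms(2,3)
      by (cases i; cases j; simp add: simps)
        (auto simp: collapse_relations leavitt_ideal.zero head_out_v dest: not_loop)
  next
    case (ghost_source e)
    then show ?thesis
      using assms(2,3)
      by (cases i; cases j; simp add: simps)
        (auto simp: collapse_relations leavitt_ideal.zero head_out_v dest: not_loop)
  next
    case (ghost_edge e f)
    then show ?thesis
      using assms(2,3)
      by (cases i; cases j; simp add: simps)
        (auto simp: collapse_relations leavitt_ideal.zero head_out_v dest: not_loop)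
  qed
qed

lemma corner_matrix_ideal: "\<lbrakk>p \<in> leavitt_ideal E; i \<in> idx; j \<in> idx\<rbrakk> \<Longrightarrow> corner_matrix p i j \<in> leavitt_ideal G"
  unfolding corner_matrix_def
  by (rule matrix_extension_leavitt_ideal[where E = E])
    (simp_all add: gen_matrix_closed finite_idx corner_matrix_relators[unfolded corner_matrix_def])

text \<open>
  An element coming from the collapse lies in the corner, so its matrix vanishes outside the
  position of \<open>e\<close>; there the element itself is recovered. This makes the map into the corner
  injective.
\<close>

lemma corner_matrix_corner_subst:
  assumes "p \<in> free_carrier G" "i \<in> idx" "j \<in> idx"
  shows "leavitt_cong G (corner_matrix (corner_subst p) i j) (if i = None \<and> j = None then p else 0)"
  using assms
proof (induction p arbitrary: i j rule: free_carrier_induct)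
  case zero
  then show ?case by (simp add: corner_subst_simps corner_matrix_simps)
next
  case (var x)
  note simps = corner_subst_simps corner_matrix_simps sum_idx if_times_0 finite_out_arcs
  show ?case
  proof (cases x)
    case (Vertex w)
    then show ?thesis
      using var by (cases i; cases j) (auto simp: simps)
  next
    case (Edge y)
    then show ?thesis
      using var by (cases y; cases i; cases j; simp add: simps head_out_v)
        (auto simp: leavitt_cong_def collapse_relations leavitt_ideal.zero head_out_v dest: not_loop)
  next
    case (Ghost y)
    then show ?thesis
      using var by (cases y; cases i; cases j; simp add: simps head_out_v)
        (auto simp: leavitt_cong_def collapse_relations leavitt_ideal.zero head_out_v dest: not_loop)
  qed
next
  case (mult p q)
  have "leavitt_cong G (\<Sum>k\<in>idx. corner_matrix (corner_subst p) i k * corner_matrix (corner_subst q) k j)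
      (\<Sum>k\<in>idx. (if i = None \<and> k = None then p else 0) * (if k = None \<and> j = None then q else 0))"
    using mult by (intro leavitt_cong_sum leavitt_cong_mult) (auto intro: free_carrier_zero corner_matrix_closed corner_subst_closed)
  then show ?case
    using mult.prems by (cases i; cases j; simp add: corner_subst_simps corner_matrix_simps sum_idx if_times_0)
next
  case (scale c p)
  from leavitt_cong_scale[OF scale.IH[OF scale.prems], of c] scale.prems show ?case
    by (simp only: corner_subst_simps(5) corner_matrix_simps(6)) (cases i; cases j; simp)
next
  case (add p q)
  from leavitt_cong_add[OF add.IH(1)[OF add.prems] add.IH(2)[OF add.prems]] show ?case
    by (cases i; cases j; simp add: corner_subst_simps corner_matrix_simps)
qed

text \<open>
  The elements \<open>a\<^sub>i\<close> and \<open>b\<^sub>i\<close> of the decomposition of \<open>1\<close>.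
\<close>

definition unit_left :: "'e option \<Rightarrow> ('k, 'v, 'e) free_elem" where
  "unit_left i = (case i of None \<Rightarrow> vsum (verts G) | Some f \<Rightarrow> var (Edge f))"

definition unit_right :: "'e option \<Rightarrow> ('k, 'v, 'e) free_elem" where
  "unit_right i = (case i of None \<Rightarrow> vsum (verts G) | Some f \<Rightarrow> var (Ghost f))"

lemma verts_G_subset: "verts E - {v} \<subseteq> verts E"
  by blast

lemma unit_left_closed: "i \<in> idx \<Longrightarrow> unit_left i \<in> FC" and unit_right_closed: "i \<in> idx \<Longrightarrow> unit_right i \<in> FC"
  using vsum_closed[OF verts_G_subset] by (cases i; simp add: unit_left_def unit_right_def)+

lemma sum_units: "leavitt_cong E (\<Sum>k\<in>idx. unit_left k * unit_right k) (vsum (verts E))"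
proof -
  have "leavitt_cong E (\<Sum>k\<in>idx. unit_left k * unit_right k) (vsum (verts E - {v}) + var (Vertex v))"
    unfolding sum_idx using regular_v
    by (intro leavitt_cong_add)
      (simp_all add: unit_left_def unit_right_def vsum_idem leavitt_cong_sym cong_relator leavitt_relators.regular)
  also have "\<dots> = vsum (verts E)"
    by (simp add: vsum_def sum.remove[of _ v] add.commute)
  finally show ?thesis .
qed

text \<open>
  Both sides are multiplicative in \<open>p\<close>, the right-hand side because \<open>\<Sum>a\<^sub>k b\<^sub>k = 1\<close>, so it
  suffices to compare them on generators. For \<open>i = j = None\<close> this says that \<open>e p e\<close> is in the
  image of the algebra of the collapse.
\<close>

lemma corner_subst_corner_matrix:
  assumes "p \<in> FC" "i \<in> idx" "j \<in> idx"
  shows "leavitt_cong E (corner_subst (corner_matrix p i j)) (unit_right i * p * unit_left j)"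
  using assms
proof (induction p arbitrary: i j rule: free_carrier_induct)
  case zero
  then show ?case by (simp add: corner_subst_simps corner_matrix_simps)
next
  case (var x)
  have "cls (corner_subst (gen_matrix x i j)) = cls (unit_right i) \<otimes>\<^bsub>L\<^esub> cls (var x) \<otimes>\<^bsub>L\<^esub> cls (unit_left j)"
  proof -
    note W = verts_G_subset
    note simps = unit_left_def unit_right_def corner_subst_simps if_distrib[of corner_subst] relations vsum_products[OF W] vsum_closed[OF W]
      cls_mult cls_zero[symmetric] head_out_v
    show ?thesis
    proof (cases x)
      case (Vertex w)
      then show ?thesis using var by (cases i; cases j; simp add: simps)
    next
      case (Edge e)
      then show ?thesis using var
        by (cases i; cases j; simp add: simps) (use not_loop in blast)+
    next
      case (Ghost e)
      have "Gh f \<otimes>\<^bsub>L\<^esub> Gh e \<otimes>\<^bsub>L\<^esub> X = Gh f \<otimes>\<^bsub>L\<^esub> (Gh e \<otimes>\<^bsub>L\<^esub> X)"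
        if "f \<in> arcs E" "X \<in> carrier L" for f X
        using that Ghost var by (simp add: L.m_assoc)
      with Ghost show ?thesis using var not_loop[of e]
        by (cases i; cases j) (simp_all add: simps)
    qed
  qed
  then show ?case
    using var by (simp add: corner_matrix_simps unit_left_closed unit_right_closed free_carrier_var free_carrier_mult flip: cls_eq_iff cls_mult)
next
  case (mult p q)
  have "leavitt_cong E (corner_subst (corner_matrix (p * q) i j))
      (\<Sum>k\<in>idx. (unit_right i * p * unit_left k) * (unit_right k * q * unit_left j))"
    using mult
    by (simp add: corner_matrix_simps corner_subst_simps)
      (intro leavitt_cong_sum leavitt_cong_mult; simp add: free_carrier_mult unit_left_closed unit_right_closed corner_matrix_closed corner_subst_closed)
  also have "\<dots> = unit_right i * p * (\<Sum>k\<in>idx. unit_left k * unit_right k) * (q * unit_left j)"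
    by (simp add: sum_distrib_left sum_distrib_right mult.assoc)
  \<comment> \<open>Here \<open>\<Sum>a\<^sub>k b\<^sub>k = 1\<close> is used.\<close>
  also have "leavitt_cong E \<dots> (unit_right i * p * vsum (verts E) * (q * unit_left j))"
    using mult by (intro leavitt_cong_mult sum_units leavitt_cong_refl free_carrier_mult free_carrier_sum unit_left_closed unit_right_closed vsum_closed order_refl)
  also have "leavitt_cong E \<dots> (unit_right i * p * (q * unit_left j))"
    using mult vsum_verts_unit[of "unit_right i * p"]
    by (intro leavitt_cong_mult[of _ _ "unit_right i * p"]) (simp_all add: free_carrier_mult unit_left_closed unit_right_closed)
  finally show ?case by (simp add: mult.assoc)
next
  case (scale c p)
  from leavitt_cong_scale[OF scale.IH[OF scale.prems], of c] scale.prems show ?case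
    by (simp only: corner_subst_simps(5) corner_matrix_simps(6) scalar_left_commute[of "unit_right i"] mult.assoc)
next
  case (add p q)
  from leavitt_cong_add[OF add.IH(1)[OF add.prems] add.IH(2)[OF add.prems]] show ?case
    by (simp add: corner_subst_simps corner_matrix_simps distrib_left distrib_right)
qed

section \<open>The collapse as a full corner\<close>

text \<open>
  The map on cosets induced by \<^const>\<open>corner_subst\<close>, through a choice of representative.
\<close>

definition collapse_hom :: "('k, 'v, 'e collapse_edge) free_elem set \<Rightarrow> ('k, 'v, 'e) free_elem set" where
  "collapse_hom X = cls (corner_subst (SOME p. p \<in> free_carrier G \<and> G.cls p = X))"

lemma cls_corner_subst_eq:
  "leavitt_cong G p q \<Longrightarrow> cls (corner_subst p) = cls (corner_subst q)"
  using corner_subst_ideal[of "p - q"] by (simp add: cls_eq_iff leavitt_cong_def corner_subst_simps)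

lemma collapse_hom_cls:
  assumes "p \<in> free_carrier G"
  shows "collapse_hom (G.cls p) = cls (corner_subst p)"
  unfolding collapse_hom_def
  by (rule someI2[of _ p]) (use assms in \<open>simp_all add: G.cls_eq_iff cls_corner_subst_eq\<close>)

lemma collapse_hom_one: "collapse_hom \<one>\<^bsub>G.L\<^esub> = cls (vsum (verts G))"
  unfolding G.cls_one collapse_hom_cls[OF G.vsum_closed[OF order_refl]]
  by (simp add: G.vsum_def vsum_def corner_subst_simps)

lemma full_corner_collapse: "full_corner L G.L collapse_hom idx (\<lambda>i. cls (unit_left i)) (\<lambda>i. cls (unit_right i))"
proof (intro full_corner.intro full_corner_axioms.intro ring_L G.ring_L)
  fix X assume "X \<in> carrier G.L"
  then obtain p where p: "p \<in> free_carrier G" "X = G.cls p" by (auto simp: G.carrier_L)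
  then show "collapse_hom X \<in> carrier L" by (simp add: collapse_hom_cls corner_subst_closed)
  fix Y assume "Y \<in> carrier G.L"
  then obtain q where q: "q \<in> free_carrier G" "Y = G.cls q" by (auto simp: G.carrier_L)
  show "collapse_hom (X \<oplus>\<^bsub>G.L\<^esub> Y) = collapse_hom X \<oplus>\<^bsub>L\<^esub> collapse_hom Y"
    using p q by (simp add: collapse_hom_cls free_carrier_add corner_subst_simps flip: G.cls_add cls_add)
  show "collapse_hom (X \<otimes>\<^bsub>G.L\<^esub> Y) = collapse_hom X \<otimes>\<^bsub>L\<^esub> collapse_hom Y"
    using p q by (simp add: collapse_hom_cls free_carrier_mult corner_subst_simps corner_subst_closed flip: G.cls_mult cls_mult)
next
  show "inj_on collapse_hom (carrier G.L)"
  proof (rule inj_onI)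
    fix X Y assume XY: "X \<in> carrier G.L" "Y \<in> carrier G.L" and eq: "collapse_hom X = collapse_hom Y"
    from XY obtain p q where p: "p \<in> free_carrier G" "X = G.cls p" and q: "q \<in> free_carrier G" "Y = G.cls q"
      by (auto simp: G.carrier_L)
    have pq: "p - q \<in> free_carrier G" using p q by (simp add: free_carrier_diff)
    have "corner_subst (p - q) \<in> leavitt_ideal E"
      using eq p q by (simp add: collapse_hom_cls cls_eq_iff leavitt_cong_def corner_subst_simps)
    then have "leavitt_cong G (corner_matrix (corner_subst (p - q)) None None) 0"
      by (simp add: leavitt_cong_0_iff corner_matrix_ideal)
    moreover have "leavitt_cong G (p - q) (corner_matrix (corner_subst (p - q)) None None)"
      using leavitt_cong_sym[OF corner_matrix_corner_subst[OF pq, of None None]] by simp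
    ultimately have "leavitt_cong G (p - q) 0" by (rule leavitt_cong_trans[rotated])
    then show "X = Y" using p q by (simp add: G.cls_eq_iff leavitt_cong_def)
  qed
next
  fix X assume "X \<in> carrier L"
  then obtain p where p: "p \<in> FC" "X = cls p" by (auto simp: carrier_L)
  have W: "vsum (verts G) \<in> FC" using vsum_closed[OF verts_G_subset] by simp
  have "collapse_hom \<one>\<^bsub>G.L\<^esub> \<otimes>\<^bsub>L\<^esub> X \<otimes>\<^bsub>L\<^esub> collapse_hom \<one>\<^bsub>G.L\<^esub> = cls (unit_right None * p * unit_left None)"
    using p W unfolding collapse_hom_one by (simp add: unit_left_def unit_right_def free_carrier_mult cls_mult)
  also have "\<dots> = cls (corner_subst (corner_matrix p None None))"
    unfolding cls_eq_iff using p by (intro leavitt_cong_sym[OF corner_subst_corner_matrix]) auto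
  also have "\<dots> = collapse_hom (G.cls (corner_matrix p None None))"
    using p by (simp add: collapse_hom_cls corner_matrix_closed)
  finally show "collapse_hom \<one>\<^bsub>G.L\<^esub> \<otimes>\<^bsub>L\<^esub> X \<otimes>\<^bsub>L\<^esub> collapse_hom \<one>\<^bsub>G.L\<^esub> \<in> collapse_hom ` carrier G.L"
    using p by (simp add: corner_matrix_closed)
next
  note W = verts_G_subset
  fix i assume i: "i \<in> idx"
  show "cls (unit_left i) \<in> carrier L" "cls (unit_right i) \<in> carrier L"
    using i by (simp_all add: unit_left_closed unit_right_closed)
  have "leavitt_cong E (vsum (verts G) * vsum (verts G)) (vsum (verts G))"
    using vsum_idem[OF W] by simp
  then have "cls (vsum (verts G)) \<otimes>\<^bsub>L\<^esub> cls (vsum (verts G)) = cls (vsum (verts G))"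
    using vsum_closed[OF W] by (simp add: cls_eq_iff flip: cls_mult)
  then show "cls (unit_left i) \<otimes>\<^bsub>L\<^esub> collapse_hom \<one>\<^bsub>G.L\<^esub> = cls (unit_left i)" "collapse_hom \<one>\<^bsub>G.L\<^esub> \<otimes>\<^bsub>L\<^esub> cls (unit_right i) = cls (unit_right i)"
    unfolding collapse_hom_one using i
    by (cases i; simp add: unit_left_def unit_right_def vsum_products[OF W] head_out_v)+
next
  have "(\<Oplus>\<^bsub>L\<^esub>i\<in>idx. cls (unit_left i) \<otimes>\<^bsub>L\<^esub> cls (unit_right i)) = (\<Oplus>\<^bsub>L\<^esub>i\<in>idx. cls (unit_left i * unit_right i))"
    by (intro L.finsum_cong' refl) (auto simp: unit_left_closed unit_right_closed cls_mult free_carrier_mult)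
  also have "\<dots> = cls (\<Sum>i\<in>idx. unit_left i * unit_right i)"
    by (intro cls_sum[symmetric] free_carrier_mult unit_left_closed unit_right_closed)
  also have "\<dots> = \<one>\<^bsub>L\<^esub>"
    unfolding cls_one cls_eq_iff by (rule sum_units)
  finally show "(\<Oplus>\<^bsub>L\<^esub>i\<in>idx. cls (unit_left i) \<otimes>\<^bsub>L\<^esub> cls (unit_right i)) = \<one>\<^bsub>L\<^esub>" .
qed (rule finite_idx)

end

theorem theorem2p11:
  fixes E :: "('v, 'e) pre_digraph" and v :: 'v
  assumes "fin_digraph E"
    and "regular_vertex E v"
    and "\<not> base_of_loop E v"
    and "infinite (UNIV :: 'u set)"
  shows "morita_equivalent TYPE('u)
           (leavitt_path_algebra TYPE('k::field) E)
           (leavitt_path_algebra TYPE('k) (collapse E v))"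
proof -
  interpret graph_collapse "TYPE('k)" E v
    using assms(1-3) by (intro graph_collapse.intro leavitt_algebra.intro graph_collapse_axioms.intro)
  show ?thesis
    using full_corner.morita_equivalent_corner[OF full_corner_collapse assms(4)] .
qed

end
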